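(* If $\mathcal{A}:f=0$ is any arrangement of $d\geq 4$ distinct lines in $\mathbb{P}^2$, then $$reg(f) \leq 2d-5 \quad\text{and}\quad st(f)\leq 2d-4.$$ When $\mathcal{A}:f=0$ is a generic arrangement of $d\geq 4$ lines, both of the inequalities $reg(f)\leq 2d-5$ and $st(f)\leq 2d-4$ become equalities.
   Context: $S=\mathbb{C}[x,y,z]$ with its standard grading; $\mathbb{P}^2$ is the complex projective plane; $f\in S_d$ is a product of $d$ pairwise non-proportional linear forms defining $\mathcal{A}$. $M(f)=S/(f_x,f_y,f_z)$ is the Milnor (Jacobian) algebra. $\tau(f)$ is the total Tjurina number of the curve $f=0$ (for a line arrangement $\tau(f)=\sum_p(m_p-1)^2$, the sum over the multiple points $p$, of multiplicity $m_p\ge 2$); one has $\dim M(f)_k=\tau(f)$ for all $k>3(d-2)$. $st(f)=\min\{q : \dim M(f)_k=\tau(f)\text{ for all }k\ge q\}$, and $reg(f)$ is the Castelnuovo–Mumford regularity of $M(f)$ as a graded $S$-module. A line arrangement is generic if it has only double points (no three of its lines are concurrent).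
   Formalization: The bound reg(f) ≤ 2d−5 is stated only for arrangements whose lines do not all pass through one point; when all d lines are concurrent, reg(f) = 2d−4, so the bound fails there. The bound st(f) ≤ 2d−4 is kept for all arrangements. *)

theory Defs
  imports
    "HOL-Library.Poly_Mapping"
    "HOL-Library.Numeral_Type"
    "HOL-Library.FuncSet"
    "Jordan_Normal_Form.Matrix_Kernel"
begin

section \<open>The graded ring \<open>S = \<complex>[x,y,z]\<close>\<close>

text \<open>A monomial is an exponent vector indexed by the three-element type \<open>3\<close>; multiplication of
  \<open>poly_mapping\<close>s is convolution, so \<open>poly3\<close> is the polynomial ring.\<close>

type_synonym mon3 = "3 \<Rightarrow>\<^sub>0 nat"
type_synonym poly3 = "mon3 \<Rightarrow>\<^sub>0 complex"

definition mon_degree :: "mon3 \<Rightarrow> nat" where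
  "mon_degree m = (\<Sum>i\<in>UNIV. Poly_Mapping.lookup m i)"

text \<open>Degrees are integers, so that the entries of a matrix between shifted free modules can be
  required to have degree \<open>b - a\<close> even if \<open>b < a\<close> (such an entry is then zero).\<close>

definition homogeneous :: "int \<Rightarrow> poly3 \<Rightarrow> bool" where
  "homogeneous k p \<longleftrightarrow> (\<forall>m\<in>Poly_Mapping.keys p. int (mon_degree m) = k)"

definition graded_piece :: "nat \<Rightarrow> poly3 set" where
  "graded_piece k = {p. homogeneous (int k) p}"

definition scale :: "complex \<Rightarrow> poly3 \<Rightarrow> poly3" where
  "scale c p = Poly_Mapping.single 0 c * p"

definition partial_deriv :: "3 \<Rightarrow> poly3 \<Rightarrow> poly3" where
  "partial_deriv i p = (\<Sum>m\<in>Poly_Mapping.keys p.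
     Poly_Mapping.single (m - Poly_Mapping.single i 1)
       (of_nat (Poly_Mapping.lookup m i) * Poly_Mapping.lookup p m))"

definition ideal_gen :: "poly3 set \<Rightarrow> poly3 set" where
  "ideal_gen B = Modules.module.span (*) B"

section \<open>Line arrangements in the projective plane\<close>

text \<open>The line \<open>a\<^sub>0x + a\<^sub>1y + a\<^sub>2z = 0\<close> is given by its coefficient vector \<open>a\<close>, which is unique up
  to a nonzero factor.\<close>

definition linear_form :: "(3 \<Rightarrow> complex) \<Rightarrow> poly3" where
  "linear_form a = (\<Sum>i\<in>UNIV. Poly_Mapping.single (Poly_Mapping.single i 1) (a i))"

definition line_arrangement :: "(3 \<Rightarrow> complex) set \<Rightarrow> bool" where
  "line_arrangement A \<longleftrightarrow> finite A \<and> (\<forall>a\<in>A. a \<noteq> (\<lambda>_. 0)) \<and>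
     (\<forall>a\<in>A. \<forall>b\<in>A. a \<noteq> b \<longrightarrow> \<not> (\<exists>c. b = (\<lambda>i. c * a i)))"

definition defining_poly :: "(3 \<Rightarrow> complex) set \<Rightarrow> poly3" where
  "defining_poly A = (\<Prod>a\<in>A. linear_form a)"

text \<open>A point of the projective plane is the set of all its homogeneous coordinate vectors.\<close>

definition proj_plane :: "(3 \<Rightarrow> complex) set set" where
  "proj_plane = {{w. \<exists>c. c \<noteq> 0 \<and> w = (\<lambda>i. c * v i)} | v. v \<noteq> (\<lambda>_. 0)}"

definition lines_through :: "(3 \<Rightarrow> complex) set \<Rightarrow> (3 \<Rightarrow> complex) set \<Rightarrow> (3 \<Rightarrow> complex) set" where
  "lines_through A P = {a\<in>A. \<forall>v\<in>P. (\<Sum>i\<in>UNIV. a i * v i) = 0}"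

definition multiplicity_at :: "(3 \<Rightarrow> complex) set \<Rightarrow> (3 \<Rightarrow> complex) set \<Rightarrow> nat" where
  "multiplicity_at A P = card (lines_through A P)"

definition generic_arrangement :: "(3 \<Rightarrow> complex) set \<Rightarrow> bool" where
  "generic_arrangement A \<longleftrightarrow> (\<forall>P\<in>proj_plane. multiplicity_at A P \<le> 2)"

text \<open>All lines pass through one point. In suitable coordinates \<open>f\<close> then involves only \<open>x\<close> and
  \<open>y\<close>, the ideal \<open>(f\<^sub>x, f\<^sub>y, f\<^sub>z)\<close> is a complete intersection of two forms of degree \<open>d - 1\<close>, and
  its Koszul resolution shows that the regularity of \<open>M(f)\<close> is exactly \<open>2d - 4\<close>.\<close>

definition pencil :: "(3 \<Rightarrow> complex) set \<Rightarrow> bool" where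
  "pencil A \<longleftrightarrow> (\<exists>P\<in>proj_plane. lines_through A P = A)"

text \<open>The local Tjurina number of \<open>m\<close> concurrent lines is \<open>(m - 1)\<^sup>2\<close>.\<close>

definition total_tjurina :: "(3 \<Rightarrow> complex) set \<Rightarrow> nat" where
  "total_tjurina A = (\<Sum>P | P \<in> proj_plane \<and> multiplicity_at A P \<ge> 2. (multiplicity_at A P - 1)\<^sup>2)"

section \<open>The Milnor algebra\<close>

definition jacobian_ideal :: "poly3 \<Rightarrow> poly3 set" where
  "jacobian_ideal f = ideal_gen (range (\<lambda>i. partial_deriv i f))"

text \<open>Complex dimension of \<open>V / W\<close>: the \<open>n\<close> for which the residue classes of some
  \<open>b 0, \<dots>, b (n - 1)\<close> in \<open>V\<close> form a basis of \<open>V / W\<close>.\<close>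

definition quotient_dim :: "poly3 set \<Rightarrow> poly3 set \<Rightarrow> nat" where
  "quotient_dim V W = (THE n. \<exists>b. (\<forall>i<n. b i \<in> V) \<and>
     (\<forall>v\<in>V. \<exists>!c. c \<in> {..<n} \<rightarrow>\<^sub>E UNIV \<and> v - (\<Sum>i<n. scale (c i) (b i)) \<in> W))"

text \<open>\<open>M(f)\<^sub>k = S\<^sub>k / (J\<^sub>f \<inter> S\<^sub>k)\<close>\<close>

definition milnor_dim :: "poly3 \<Rightarrow> nat \<Rightarrow> nat" where
  "milnor_dim f k = quotient_dim (graded_piece k) (jacobian_ideal f \<inter> graded_piece k)"

definition st :: "(3 \<Rightarrow> complex) set \<Rightarrow> nat" where
  "st A = (LEAST q. \<forall>k\<ge>q. milnor_dim (defining_poly A) k = total_tjurina A)"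

section \<open>Castelnuovo--Mumford regularity\<close>

text \<open>A minimal graded free resolution
  \<open>\<cdots> \<rightarrow> F\<^sub>2 \<rightarrow> F\<^sub>1 \<rightarrow> F\<^sub>0 \<rightarrow> S/I \<rightarrow> 0\<close> with \<open>F\<^sub>i = \<Oplus>\<^bsub>j < n i\<^esub> S(-a i j)\<close>:
  \<open>D i\<close> is the matrix of \<open>F\<^bsub>i+1\<^esub> \<rightarrow> F\<^sub>i\<close>, and the \<open>j\<close>-th generator of \<open>F\<^sub>0\<close> is sent to the class of
  \<open>g $ j\<close>. Minimality says that the entries of every \<open>D i\<close> lie in \<open>(x,y,z)\<close>.\<close>

definition minimal_graded_free_resolution ::
  "poly3 set \<Rightarrow> (nat \<Rightarrow> nat) \<Rightarrow> (nat \<Rightarrow> nat \<Rightarrow> int) \<Rightarrow> poly3 vec \<Rightarrow> (nat \<Rightarrow> poly3 mat) \<Rightarrow> bool" where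
  "minimal_graded_free_resolution I n a g D \<longleftrightarrow>
     g \<in> carrier_vec (n 0) \<and>
     (\<forall>i. D i \<in> carrier_mat (n i) (n (Suc i))) \<and>
     (\<forall>j<n 0. homogeneous (a 0 j) (g $ j)) \<and>
     (\<forall>i. \<forall>k<n i. \<forall>j<n (Suc i). homogeneous (a (Suc i) j - a i k) (D i $$ (k, j))) \<and>
     (\<forall>s. \<exists>v\<in>carrier_vec (n 0). s - g \<bullet> v \<in> I) \<and>
     {v \<in> carrier_vec (n 0). g \<bullet> v \<in> I} = (\<lambda>w. D 0 *\<^sub>v w) ` carrier_vec (n 1) \<and>
     (\<forall>i. mat_kernel (D i) = (\<lambda>w. D (Suc i) *\<^sub>v w) ` carrier_vec (n (Suc (Suc i)))) \<and>
     (\<forall>i. \<forall>k<n i. \<forall>j<n (Suc i). Poly_Mapping.lookup (D i $$ (k, j)) 0 = 0)"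

text \<open>The regularity of the graded module \<open>S/I\<close>, for a homogeneous ideal \<open>I \<noteq> S\<close>, is the largest
  \<open>a i j - i\<close> in a minimal graded free resolution. All these resolutions are isomorphic, so the
  supremum over all of them is the one over any of them; it is attained, since only finitely
  many \<open>F\<^sub>i\<close> are nonzero.\<close>

definition cm_regularity :: "poly3 set \<Rightarrow> int" where
  "cm_regularity I = Sup {a i j - int i | n a g D i j.
     minimal_graded_free_resolution I n a g D \<and> j < n i}"

definition reg :: "poly3 \<Rightarrow> int" where
  "reg f = cm_regularity (jacobian_ideal f)"

end

theory Submission
  imports Defs "HOL-Library.Function_Algebras"
begin

text \<open>Write \<open>f\<close> for the defining polynomial of \<open>A\<close>, \<open>d = card A\<close>, \<open>J\<close> for the Jacobian ideal, and \<open>D(A)\<close> for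
  the module of derivations \<open>\<theta>\<close> of \<open>S\<close> such that every linear form \<open>l\<^sub>a\<close> of the arrangement divides
  \<open>\<theta>(l\<^sub>a)\<close>. The syzygies of the partial derivatives form a complement in \<open>D(A)\<close> of the multiples of
  the Euler derivation, so that the Hilbert function of \<open>D(A)\<close> and a bound for its regularity yield those
  of the syzygies, then of \<open>J\<close>, and finally of \<open>S/J\<close>. The module \<open>D(A)\<close> is studied by adding one line at
  a time.

  Let \<open>h\<close> be a line that is not in \<open>A\<close>, let \<open>l\<close> be its linear form and let \<open>R \<subseteq> A\<close> contain exactly one
  line through each point in which \<open>h\<close> meets \<open>A\<close>. Put \<open>b = \<Prod>\<^bsub>a \<in> A - R\<^esub> l\<^sub>a\<close>. Evaluation at \<open>l\<close>, read
  modulo \<open>l\<close>, maps \<open>D(A)\<close> to \<open>S/l\<close> with kernel \<open>D(A \<union> {h})\<close>. Its image consists of multiples of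
  \<open>b\<close> (\<open>restriction_divisible\<close>), because \<open>u \<theta>(l) - l \<theta>(u)\<close> is divisible by all the forms of lines
  through a point of \<open>h\<close> when \<open>u\<close> is one of these forms. In degrees \<open>k \<ge> card A - 2\<close> the image
  consists of all multiples of \<open>b\<close> (\<open>restriction_surjective\<close>): a constant derivation that kills two
  forms of \<open>R\<close>, multiplied by the remaining forms of \<open>A\<close>, lies in \<open>D(A)\<close>, and such derivations suffice.

  Two consequences are drawn. First, dimensions can be counted: the increment of the codimension of
  \<open>D(A)\<close> matches that of the total Tjurina number, so \<open>dim M(f)\<^sub>k = \<tau>\<close> for all \<open>k \<ge> 2d - 4\<close>
  (\<open>milnor_dim_stable\<close>). Second, regularity can be bounded: \<open>D(A)\<close> is \<open>(d - 2)\<close>-regular unless \<open>A\<close> is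
  a pencil (\<open>regular_log_der_not_pencil\<close>), and hence \<open>S/J\<close> is \<open>(2d - 5)\<close>-regular. Here \<open>r\<close>-regularity
  means that the Koszul homology in homological degree \<open>i\<close> vanishes in all internal degrees above
  \<open>i + r\<close>. This form makes the behaviour in short exact sequences a diagram chase, and it is inherited by
  the syzygy modules with \<open>r\<close> replaced by \<open>r + 1\<close>. It therefore bounds the shifts of every minimal free
  resolution (\<open>resolution_shift_bound\<close>), and it also yields the existence of such a resolution
  (\<open>resolution_exists\<close>), since an \<open>r\<close>-regular submodule of a free module is generated in
  degrees at most \<open>r\<close> and so by finitely many elements.

  For a generic arrangement \<open>\<tau> = d(d - 1)/2\<close>, and the same count shows that there are no syzygies of
  degree at most \<open>d - 3\<close> but some of degree \<open>d - 2\<close>. Every minimal generator of the module of syzygies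
  then has shift at least \<open>2d - 3\<close>, so the regularity is at least \<open>2d - 5\<close>. If \<open>dim M(f)\<^sub>k\<close> were \<open>\<tau>\<close> for
  \<open>k = 2d - 5\<close>, the syzygies of degree \<open>d - 4\<close> would have the negative dimension \<open>3 - d\<close>.\<close>

section \<open>Monomials and coefficients\<close>

lemma UNIV_3: "(UNIV :: 3 set) = {0, 1, 2}"
proof -
  have "card {0, 1, 2 :: 3} = card (UNIV :: 3 set)" by simp
  then show ?thesis by (metis card_subset_eq finite subset_UNIV)
qed

lemma sum_UNIV_3: "sum g (UNIV :: 3 set) = g 0 + g 1 + g 2"
  unfolding UNIV_3 by (simp add: add.assoc)

lemma all_3: "(\<forall>i::3. P i) \<longleftrightarrow> P 0 \<and> P 1 \<and> P 2"
  using UNIV_3 by (metis UNIV_I insertE singletonD)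

abbreviation "mcoeff \<equiv> Poly_Mapping.lookup"
abbreviation "mterm \<equiv> Poly_Mapping.single"
abbreviation "keys \<equiv> Poly_Mapping.keys"

definition const :: "complex \<Rightarrow> poly3" where "const c = mterm 0 c"
definition var :: "3 \<Rightarrow> poly3" where "var i = mterm (mterm i 1) 1"

lemma poly_as_sum:
  assumes "finite K" "keys p \<subseteq> K"
  shows "p = (\<Sum>m\<in>K. mterm m (mcoeff p m))"
proof (rule poly_mapping_eqI)
  fix k
  have "mcoeff (\<Sum>m\<in>K. mterm m (mcoeff p m)) k = (\<Sum>m\<in>K. if m = k then mcoeff p m else 0)"
    by (simp add: lookup_sum lookup_single when_def)
  also have "\<dots> = mcoeff p k"
    using assms by (auto simp: in_keys_iff)
  finally show "mcoeff p k = mcoeff (\<Sum>m\<in>K. mterm m (mcoeff p m)) k" by simp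
qed

text \<open>Additive maps are determined by their values on terms. An identity that is additive in two
  polynomials, such as a product rule, is reduced to terms by two applications.\<close>

lemma additive_eqI:
  fixes F G :: "poly3 \<Rightarrow> 'b::ab_group_add"
  assumes "\<And>p q. F (p + q) = F p + F q" "\<And>p q. G (p + q) = G p + G q"
    and "\<And>m c. F (mterm m c) = G (mterm m c)"
  shows "F p = G p"
proof -
  have z: "F 0 = 0" "G 0 = 0"
    using assms(1)[of 0 0] assms(2)[of 0 0] by simp_all
  have "F (\<Sum>m\<in>K. mterm m (mcoeff p m)) = G (\<Sum>m\<in>K. mterm m (mcoeff p m))" if "finite K" for K
    using that by induction (simp_all add: z assms)
  from this[of "keys p"] show ?thesis
    unfolding poly_as_sum[of "keys p" p, OF finite_keys order_refl, symmetric] by simp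
qed

lemma mon_degree_simps [simp]:
  "mon_degree 0 = 0" "mon_degree (m + n) = mon_degree m + mon_degree n"
  "mon_degree (mterm i k) = k"
  by (simp_all add: mon_degree_def lookup_add sum.distrib lookup_single when_def)

lemma mon_degree_0_iff [simp]: "mon_degree m = 0 \<longleftrightarrow> m = 0"
proof
  assume "mon_degree m = 0"
  then have "\<forall>i. mcoeff m i = 0" by (simp add: mon_degree_def)
  then show "m = 0" by (simp add: poly_mapping_eqI)
qed simp

section \<open>Homogeneous polynomials\<close>

lemma homogeneousI: "(\<And>m. mcoeff p m \<noteq> 0 \<Longrightarrow> int (mon_degree m) = k) \<Longrightarrow> homogeneous k p"
  by (simp add: homogeneous_def in_keys_iff)

lemma homogeneousD: "homogeneous k p \<Longrightarrow> mcoeff p m \<noteq> 0 \<Longrightarrow> int (mon_degree m) = k"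
  by (simp add: homogeneous_def in_keys_iff)

lemma homogeneous_0 [simp]: "homogeneous k 0" by (simp add: homogeneous_def)

lemma homogeneous_add: "homogeneous k p \<Longrightarrow> homogeneous k q \<Longrightarrow> homogeneous k (p + q)"
  by (rule homogeneousI) (metis add.right_neutral homogeneousD lookup_add)

lemma homogeneous_uminus [simp]: "homogeneous k (- p) \<longleftrightarrow> homogeneous k p"
  by (auto simp: homogeneous_def in_keys_iff)

lemma homogeneous_diff: "homogeneous k p \<Longrightarrow> homogeneous k q \<Longrightarrow> homogeneous k (p - q)"
  using homogeneous_add[of k p "- q"] by simp

lemma homogeneous_sum: "(\<And>i. i \<in> I \<Longrightarrow> homogeneous k (g i)) \<Longrightarrow> homogeneous k (sum g I)"
  by (induction I rule: infinite_finite_induct) (auto intro: homogeneous_add)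

lemma homogeneous_mult:
  assumes "homogeneous j p" "homogeneous k q"
  shows "homogeneous (j + k) (p * q)"
  unfolding homogeneous_def
proof
  fix m assume "m \<in> keys (p * q)"
  then obtain a b where "m = a + b" "a \<in> keys p" "b \<in> keys q"
    using keys_mult[of p q] by blast
  then show "int (mon_degree m) = j + k" using assms by (simp add: homogeneous_def)
qed

lemma homogeneous_mult': "homogeneous j p \<Longrightarrow> homogeneous k q \<Longrightarrow> n = j + k \<Longrightarrow> homogeneous n (p * q)"
  using homogeneous_mult by simp

lemma homogeneous_const [simp]: "homogeneous 0 (const c)"
  by (simp add: homogeneous_def const_def)

lemma homogeneous_1 [simp]: "homogeneous 0 1"
  by (simp add: homogeneous_def)

lemma homogeneous_var [simp]: "homogeneous 1 (var i)"
  by (simp add: homogeneous_def var_def)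

lemma homogeneous_prod:
  "(\<And>i. i \<in> I \<Longrightarrow> homogeneous 1 (g i)) \<Longrightarrow> homogeneous (int (card I)) (prod g I)"
  by (induction I rule: infinite_finite_induct) (auto intro!: homogeneous_mult')

lemma homogeneous_neg: "homogeneous k p \<Longrightarrow> k < 0 \<Longrightarrow> p = 0"
  using homogeneousD[of k p] by (intro poly_mapping_eqI) force

lemma homogeneous_0_const: "homogeneous 0 p \<Longrightarrow> p = const (mcoeff p 0)"
  unfolding const_def
  using homogeneousD[of 0 p] by (intro poly_mapping_eqI) (force simp: lookup_single when_def)

lemma mcoeff_0_homogeneous: "homogeneous k p \<Longrightarrow> k \<noteq> 0 \<Longrightarrow> mcoeff p 0 = 0"
  by (metis homogeneousD mon_degree_simps(1) of_nat_0)

definition hcomp :: "int \<Rightarrow> poly3 \<Rightarrow> poly3" where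
  "hcomp k p = (\<Sum>m\<in>{m \<in> keys p. int (mon_degree m) = k}. mterm m (mcoeff p m))"

lemma mcoeff_hcomp: "mcoeff (hcomp k p) m = (if int (mon_degree m) = k then mcoeff p m else 0)"
proof -
  have "mcoeff (hcomp k p) m = (\<Sum>n\<in>{n \<in> keys p. int (mon_degree n) = k}. if n = m then mcoeff p n else 0)"
    by (simp add: lookup_sum lookup_single when_def hcomp_def)
  also have "\<dots> = (if int (mon_degree m) = k then mcoeff p m else 0)"
    by (auto simp: in_keys_iff)
  finally show ?thesis .
qed

lemma hcomp_add: "hcomp k (p + q) = hcomp k p + hcomp k q"
  by (rule poly_mapping_eqI) (simp add: mcoeff_hcomp lookup_add)

lemma hcomp_0 [simp]: "hcomp k 0 = 0"
  by (rule poly_mapping_eqI) (simp add: mcoeff_hcomp)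

lemma hcomp_diff: "hcomp k (p - q) = hcomp k p - hcomp k q"
  by (rule poly_mapping_eqI) (simp add: mcoeff_hcomp lookup_minus)

lemma hcomp_sum: "hcomp k (sum g I) = (\<Sum>i\<in>I. hcomp k (g i))"
  by (induction I rule: infinite_finite_induct) (auto simp: hcomp_add)

lemma homogeneous_hcomp [simp]: "homogeneous k (hcomp k p)"
  by (rule homogeneousI) (simp add: mcoeff_hcomp split: if_splits)

lemma hcomp_homogeneous: "homogeneous j p \<Longrightarrow> hcomp k p = (if j = k then p else 0)"
  by (rule poly_mapping_eqI) (auto simp: mcoeff_hcomp dest: homogeneousD)

lemma poly_as_sum_hcomp:
  assumes "finite K" "(\<lambda>m. int (mon_degree m)) ` keys p \<subseteq> K"
  shows "p = (\<Sum>k\<in>K. hcomp k p)"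
proof (rule poly_mapping_eqI)
  fix m
  have "mcoeff (\<Sum>k\<in>K. hcomp k p) m = (\<Sum>k\<in>K. if int (mon_degree m) = k then mcoeff p m else 0)"
    by (simp add: lookup_sum mcoeff_hcomp)
  also have "\<dots> = (if int (mon_degree m) \<in> K then mcoeff p m else 0)"
    using assms(1) by (rule sum.delta')
  also have "\<dots> = mcoeff p m"
    using assms(2) by (metis (full_types) image_subset_iff in_keys_iff)
  finally show "mcoeff p m = mcoeff (\<Sum>k\<in>K. hcomp k p) m" by simp
qed

text \<open>Only the component of \<open>q\<close> in degree \<open>k - c\<close> can contribute, since \<open>p\<close> shifts
  degrees by \<open>c\<close>. Because of this rule, linear equations with homogeneous coefficients can be solved
  degree by degree.\<close>

lemma hcomp_mult:
  assumes "homogeneous c p"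
  shows "hcomp k (p * q) = p * hcomp (k - c) q"
proof -
  define K where "K = insert (k - c) ((\<lambda>m. int (mon_degree m)) ` keys q)"
  have f: "finite K" unfolding K_def by simp
  have "q = (\<Sum>j\<in>K. hcomp j q)" by (rule poly_as_sum_hcomp) (auto simp: K_def)
  then have "hcomp k (p * q) = hcomp k (p * (\<Sum>j\<in>K. hcomp j q))" by (rule arg_cong)
  also have "\<dots> = (\<Sum>j\<in>K. hcomp k (p * hcomp j q))"
    by (simp only: hcomp_sum sum_distrib_left)
  also have "\<dots> = (\<Sum>j\<in>K. if j = k - c then p * hcomp j q else 0)"
    by (intro sum.cong refl) (auto simp: hcomp_homogeneous[OF homogeneous_mult[OF assms homogeneous_hcomp]])
  also have "\<dots> = p * hcomp (k - c) q" using f by (simp add: K_def)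
  finally show ?thesis .
qed

section \<open>Constant polynomials\<close>

lemma const_simps: "const (a + b) = const a + const b" "const (a * b) = const a * const b"
  "const 0 = 0" "const 1 = 1" "const (- a) = - const a" "const (a - b) = const a - const b"
  by (simp_all add: const_def single_add mult_single single_uminus single_diff)

lemma const_of_nat: "const (of_nat n) = of_nat n"
  by (simp add: const_def)

lemma const_of_int: "const (of_int n) = of_int n"
  by (simp add: const_def)

lemma const_eq_0_iff [simp]: "const c = 0 \<longleftrightarrow> c = 0"
  by (metis const_def const_simps(3) lookup_single_eq)

lemma scale_eq: "scale c p = const c * p"
  by (simp add: scale_def const_def)

lemma const_inverse: "c \<noteq> 0 \<Longrightarrow> const c * (const (inverse c) * p) = p"
  by (metis const_simps(2,4) mult.assoc mult_1 right_inverse)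

lemma const_mult_mono: "const c * mterm m a = mterm m (c * a)"
  by (simp add: const_def mult_single)

lemma const_sum: "const (sum g I) = (\<Sum>i\<in>I. const (g i))"
  by (induction I rule: infinite_finite_induct) (auto simp: const_simps)

lemma mcoeff_mult_0:
  fixes p q :: poly3
  shows "mcoeff (p * q) 0 = mcoeff p 0 * mcoeff q 0"
proof (rule additive_eqI[of "\<lambda>p. mcoeff (p * q) 0" "\<lambda>p. mcoeff p 0 * mcoeff q 0"])
  fix m c
  show "mcoeff (mterm m c * q) 0 = mcoeff (mterm m c) 0 * mcoeff q 0"
  proof (rule additive_eqI[of "\<lambda>q. mcoeff (mterm m c * q) 0" "\<lambda>q. mcoeff (mterm m c) 0 * mcoeff q 0"])
    fix n b
    have "m + n = 0 \<longleftrightarrow> m = 0 \<and> n = 0"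
      by (metis add_is_0 mon_degree_0_iff mon_degree_simps(2))
    then show "mcoeff (mterm m c * mterm n b) 0 = mcoeff (mterm m c) 0 * mcoeff (mterm n b) 0"
      by (auto simp: mult_single lookup_single when_def)
  qed (simp_all add: algebra_simps lookup_add)
qed (simp_all add: algebra_simps lookup_add)

section \<open>Partial derivatives\<close>

lemma partial_deriv_superset:
  assumes "finite K" "keys p \<subseteq> K"
  shows "partial_deriv i p = (\<Sum>m\<in>K. mterm (m - mterm i 1) (of_nat (mcoeff m i) * mcoeff p m))"
  unfolding partial_deriv_def using assms
  by (intro sum.mono_neutral_left) (auto simp: in_keys_iff)

lemma partial_deriv_add: "partial_deriv i (p + q) = partial_deriv i p + partial_deriv i q"
proof -
  define K where "K = keys p \<union> keys q"
  have "finite K" "keys p \<subseteq> K" "keys q \<subseteq> K" "keys (p + q) \<subseteq> K"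
    using keys_add[of p q] by (auto simp: K_def)
  then show ?thesis
    by (simp add: partial_deriv_superset[of K] lookup_add algebra_simps single_add sum.distrib)
qed

lemma partial_deriv_mono: "partial_deriv i (mterm m c) = mterm (m - mterm i 1) (of_nat (mcoeff m i) * c)"
  by (subst partial_deriv_superset[of "{m}"]) auto

lemma partial_deriv_0 [simp]: "partial_deriv i 0 = 0"
  by (simp add: partial_deriv_def)

lemma partial_deriv_uminus: "partial_deriv i (- p) = - partial_deriv i p"
  using partial_deriv_add[of i p "- p"] by (simp add: eq_neg_iff_add_eq_0 add.commute)

lemma partial_deriv_mult:
  "partial_deriv i (p * q) = p * partial_deriv i q + partial_deriv i p * q"
proof (rule additive_eqI[where F = "\<lambda>p. partial_deriv i (p * q)" and G = "\<lambda>p. p * partial_deriv i q + partial_deriv i p * q"])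
  fix m c
  show "partial_deriv i (mterm m c * q) = mterm m c * partial_deriv i q + partial_deriv i (mterm m c) * q"
  proof (rule additive_eqI[where F = "\<lambda>q. partial_deriv i (mterm m c * q)" and G = "\<lambda>q. mterm m c * partial_deriv i q + partial_deriv i (mterm m c) * q"])
    fix n b
    \<comment> \<open>The subtraction of exponents truncates, hence the restriction to exponents that contain \<open>i\<close>.\<close>
    have *: "m + n - mterm i 1 = m + (n - mterm i 1)" if "mcoeff n i \<noteq> 0" for m n :: mon3
      using that by (intro poly_mapping_eqI) (auto simp: lookup_add lookup_minus lookup_single when_def)
    have **: "m + n - mterm i 1 = (m - mterm i 1) + n" if "mcoeff m i \<noteq> 0" for m n :: mon3
      using *[OF that, of n] by (simp add: add.commute)
    have "mterm m c * partial_deriv i (mterm n b) = mterm (m + n - mterm i 1) (c * (of_nat (mcoeff n i) * b))"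
      using * by (cases "mcoeff n i = 0") (simp_all add: partial_deriv_mono mult_single)
    moreover have "partial_deriv i (mterm m c) * mterm n b = mterm (m + n - mterm i 1) (of_nat (mcoeff m i) * c * b)"
      using ** by (cases "mcoeff m i = 0") (simp_all add: partial_deriv_mono mult_single)
    ultimately show "partial_deriv i (mterm m c * mterm n b) =
      mterm m c * partial_deriv i (mterm n b) + partial_deriv i (mterm m c) * mterm n b"
      by (simp add: mult_single partial_deriv_mono lookup_add algebra_simps flip: single_add)
  qed (simp_all add: algebra_simps partial_deriv_add)
qed (simp_all add: algebra_simps partial_deriv_add)

lemma partial_deriv_const [simp]: "partial_deriv i (const c) = 0"
  by (simp add: const_def partial_deriv_mono)

lemma partial_deriv_var: "partial_deriv i (var j) = (if i = j then 1 else 0)"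
  by (auto simp: var_def partial_deriv_mono lookup_single when_def)

lemma homogeneous_partial_deriv:
  assumes "homogeneous k p" shows "homogeneous (k - 1) (partial_deriv i p)"
proof -
  have "homogeneous (k - 1) (mterm (m - mterm i 1) (of_nat (mcoeff m i) * mcoeff p m))" if "m \<in> keys p" for m
  proof (cases "mcoeff m i = 0")
    case False
    then have "m = (m - mterm i 1) + mterm i 1"
      by (intro poly_mapping_eqI) (auto simp: lookup_add lookup_minus lookup_single when_def)
    then have "mon_degree m = mon_degree (m - mterm i 1) + 1"
      by (metis mon_degree_simps(2,3))
    then show ?thesis using that assms by (auto simp: homogeneous_def)
  qed simp
  then show ?thesis unfolding partial_deriv_def by (rule homogeneous_sum)
qed

lemma euler_formula:
  assumes "homogeneous k p"
  shows "(\<Sum>i\<in>UNIV. var i * partial_deriv i p) = of_int k * p"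
proof -
  have "(\<Sum>i\<in>UNIV. var i * partial_deriv i p) =
     (\<Sum>m\<in>keys p. \<Sum>i\<in>UNIV. var i * mterm (m - mterm i 1) (of_nat (mcoeff m i) * mcoeff p m))"
    unfolding partial_deriv_def by (simp add: sum_distrib_left) (rule sum.swap)
  also have "\<dots> = (\<Sum>m\<in>keys p. \<Sum>i\<in>UNIV. mterm m (of_nat (mcoeff m i) * mcoeff p m))"
  proof (intro sum.cong refl)
    fix m :: mon3 and i :: 3
    show "var i * mterm (m - mterm i 1) (of_nat (mcoeff m i) * mcoeff p m) = mterm m (of_nat (mcoeff m i) * mcoeff p m)"
    proof (cases "mcoeff m i = 0")
      case False
      then have "m = mterm i 1 + (m - mterm i 1)"
        by (intro poly_mapping_eqI) (auto simp: lookup_add lookup_minus lookup_single when_def)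
      then show ?thesis by (simp add: var_def mult_single)
    qed simp
  qed
  also have "\<dots> = (\<Sum>m\<in>keys p. of_int k * mterm m (mcoeff p m))"
  proof (intro sum.cong refl)
    fix m assume "m \<in> keys p"
    then have k: "int (mon_degree m) = k" using assms by (simp add: homogeneous_def)
    have "(\<Sum>i\<in>UNIV. mterm m (of_nat (mcoeff m i) * mcoeff p m)) = mterm m (\<Sum>i\<in>UNIV. of_nat (mcoeff m i) * mcoeff p m)"
      by (simp add: sum_UNIV_3 single_add)
    also have "(\<Sum>i\<in>UNIV. of_nat (mcoeff m i) * mcoeff p m) = of_int k * mcoeff p m"
      unfolding k[symmetric] mon_degree_def by (simp add: sum_distrib_right)
    also have "mterm m (of_int k * mcoeff p m) = of_int k * mterm m (mcoeff p m)"
      by (simp add: const_mult_mono[symmetric] const_of_int)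
    finally show "(\<Sum>i\<in>UNIV. mterm m (of_nat (mcoeff m i) * mcoeff p m)) = of_int k * mterm m (mcoeff p m)" .
  qed
  also have "\<dots> = of_int k * p"
    unfolding sum_distrib_left[symmetric] by (subst (2) poly_as_sum[of "keys p" p]) simp_all
  finally show ?thesis .
qed

section \<open>Graded modules and the Koszul complex\<close>

definition smul :: "poly3 \<Rightarrow> ('k \<Rightarrow> poly3) \<Rightarrow> ('k \<Rightarrow> poly3)" (infixr "\<cdot>" 75) where
  "p \<cdot> v = (\<lambda>k. p * v k)"

lemma smul_apply [simp]: "(p \<cdot> v) k = p * v k"
  by (simp add: smul_def)

lemma smul_simps: "p \<cdot> (u + v) = p \<cdot> u + p \<cdot> v" "p \<cdot> (u - v) = p \<cdot> u - p \<cdot> v" "p \<cdot> (- u) = - (p \<cdot> u)"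
  "p \<cdot> 0 = 0" "0 \<cdot> u = 0" "p \<cdot> q \<cdot> u = (p * q) \<cdot> u" "1 \<cdot> u = u"
  "(p + q) \<cdot> u = p \<cdot> u + q \<cdot> u" "(p - q) \<cdot> u = p \<cdot> u - q \<cdot> u" "(- p) \<cdot> u = - (p \<cdot> u)"
  by (auto simp: fun_eq_iff algebra_simps)

definition slinear :: "(('k \<Rightarrow> poly3) \<Rightarrow> ('m \<Rightarrow> poly3)) \<Rightarrow> bool" where
  "slinear \<phi> \<longleftrightarrow> (\<forall>u v. \<phi> (u + v) = \<phi> u + \<phi> v) \<and> (\<forall>p u. \<phi> (p \<cdot> u) = p \<cdot> \<phi> u)"

lemma slinear_simps:
  assumes "slinear \<phi>"
  shows "\<phi> (u + v) = \<phi> u + \<phi> v" "\<phi> (p \<cdot> u) = p \<cdot> \<phi> u" "\<phi> 0 = 0" "\<phi> (- u) = - \<phi> u" "\<phi> (u - v) = \<phi> u - \<phi> v"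
proof -
  show a: "\<phi> (u + v) = \<phi> u + \<phi> v" "\<phi> (p \<cdot> u) = p \<cdot> \<phi> u" for u v p
    using assms by (auto simp: slinear_def)
  show "\<phi> 0 = 0" using a(2)[of 0 0] by (simp add: smul_simps)
  show m: "\<phi> (- u) = - \<phi> u" for u using a(2)[of "-1" u] by (simp add: smul_simps)
  show "\<phi> (u - v) = \<phi> u - \<phi> v" using a(1)[of u "- v"] by (simp add: m)
qed

text \<open>Every module below is a subquotient \<open>N/Z\<close> of a module of functions \<open>'k \<Rightarrow> poly3\<close>, given by the
  homogeneous pieces of the two graded submodules \<open>Z\<close> and \<open>N\<close>. No quotients are formed: statements about
  \<open>N/Z\<close> are statements about \<open>N\<close> up to errors in \<open>Z\<close>.\<close>

type_synonym 'k family = "int \<Rightarrow> ('k \<Rightarrow> poly3) set"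

definition graded_submodule :: "'k family \<Rightarrow> bool" where
  "graded_submodule N \<longleftrightarrow> (\<forall>k. 0 \<in> N k \<and> (\<forall>u\<in>N k. \<forall>v\<in>N k. u - v \<in> N k) \<and>
     (\<forall>p c. \<forall>u\<in>N k. homogeneous c p \<longrightarrow> p \<cdot> u \<in> N (k + c)))"

lemma graded_submoduleI:
  assumes "\<And>k. 0 \<in> N k" "\<And>k u v. u \<in> N k \<Longrightarrow> v \<in> N k \<Longrightarrow> u - v \<in> N k"
    "\<And>k p c u. u \<in> N k \<Longrightarrow> homogeneous c p \<Longrightarrow> p \<cdot> u \<in> N (k + c)"
  shows "graded_submodule N"
  using assms by (auto simp: graded_submodule_def)

lemma
  assumes "graded_submodule N"
  shows gs_0: "0 \<in> N k"
    and gs_diff: "u \<in> N k \<Longrightarrow> v \<in> N k \<Longrightarrow> u - v \<in> N k"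
    and gs_uminus: "u \<in> N k \<Longrightarrow> - u \<in> N k"
    and gs_add: "u \<in> N k \<Longrightarrow> v \<in> N k \<Longrightarrow> u + v \<in> N k"
    and gs_smul: "u \<in> N k \<Longrightarrow> homogeneous c p \<Longrightarrow> n = k + c \<Longrightarrow> p \<cdot> u \<in> N n"
proof -
  show 0: "0 \<in> N k" and d: "\<And>u v. u \<in> N k \<Longrightarrow> v \<in> N k \<Longrightarrow> u - v \<in> N k"
    using assms by (auto simp: graded_submodule_def)
  show u: "- u \<in> N k" if "u \<in> N k" for u using d[OF 0 that] by simp
  show "u + v \<in> N k" if "u \<in> N k" "v \<in> N k" using d[OF that(1) u[OF that(2)]] by simp
  show "u \<in> N k \<Longrightarrow> homogeneous c p \<Longrightarrow> n = k + c \<Longrightarrow> p \<cdot> u \<in> N n"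
    using assms by (auto simp: graded_submodule_def)
qed

lemma gs_sum:
  assumes "graded_submodule N" "\<And>i. i \<in> I \<Longrightarrow> g i \<in> N k"
  shows "sum g I \<in> N k"
  using assms(2) by (induction I rule: infinite_finite_induct) (auto intro: gs_0 gs_add assms(1))

lemma gs_zero: "graded_submodule (\<lambda>_. {0})"
  by (rule graded_submoduleI) (auto simp: smul_simps)

text \<open>The components of a Koszul chain are indexed by the subsets of the three variables, encoded by
  their indicator; all exterior powers are kept in one object.\<close>

type_synonym 'k chain = "bool \<times> bool \<times> bool \<Rightarrow> 'k \<Rightarrow> poly3"

definition neg_if :: "bool \<Rightarrow> 'a::ab_group_add \<Rightarrow> 'a" where
  "neg_if b v = (if b then - v else v)"

definition koszul :: "'k chain \<Rightarrow> 'k chain" where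
  "koszul c = (\<lambda>(p, q, r).
     (if p then 0 else var 0 \<cdot> c (True, q, r)) +
     (if q then 0 else neg_if p (var 1 \<cdot> c (p, True, r))) +
     (if r then 0 else neg_if p (neg_if q (var 2 \<cdot> c (p, q, True)))))"

fun wt :: "bool \<times> bool \<times> bool \<Rightarrow> nat" where
  "wt (p, q, r) = of_bool p + of_bool q + of_bool r"

definition in_degree :: "nat \<Rightarrow> 'k chain \<Rightarrow> bool" where
  "in_degree i c \<longleftrightarrow> (\<forall>s. wt s \<noteq> i \<longrightarrow> c s = 0)"

text \<open>Total degree: a component that belongs to an exterior monomial in \<open>w\<close> variables has polynomial
  degree \<open>j - w\<close>, so that the Koszul differential preserves \<open>j\<close>.\<close>

definition chains :: "'k family \<Rightarrow> int \<Rightarrow> 'k chain set" where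
  "chains N j = {c. \<forall>s. c s \<in> N (j - int (wt s))}"

text \<open>Castelnuovo--Mumford regularity at most \<open>r\<close> for the graded module \<open>N/Z\<close>, in terms of Koszul
  homology: \<open>H\<^sub>i(x, y, z; N/Z)\<^sub>j = 0\<close> whenever \<open>j > i + r\<close>. Cycles and boundaries of \<open>N/Z\<close> are
  expressed by chains of \<open>N\<close> whose differential, or whose difference from a boundary, lies in \<open>Z\<close>.\<close>

definition regular :: "int \<Rightarrow> 'k family \<Rightarrow> 'k family \<Rightarrow> bool" where
  "regular r N Z \<longleftrightarrow> (\<forall>i j. \<forall>c \<in> chains N j. j > int i + r \<longrightarrow> in_degree i c \<longrightarrow> koszul c \<in> chains Z j \<longrightarrow>
     (\<exists>b \<in> chains N j. in_degree (Suc i) b \<and> c - koszul b \<in> chains Z j))"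

text \<open>Quantifiers over chain indices are to stay intact; \<open>all_bool3\<close> expands them where a computation
  over all eight subsets is intended.\<close>

declare split_paired_All [simp del]

lemma chainsI: "(\<And>s. c s \<in> N (j - int (wt s))) \<Longrightarrow> c \<in> chains N j"
  by (simp add: chains_def)

lemma chainsD: "c \<in> chains N j \<Longrightarrow> n = j - int (wt s) \<Longrightarrow> c s \<in> N n"
  by (simp add: chains_def)

lemma all_bool3: "(\<forall>s :: bool \<times> bool \<times> bool. P s) \<longleftrightarrow>
   P (False, False, False) \<and> P (False, False, True) \<and> P (False, True, False) \<and> P (False, True, True) \<and>
   P (True, False, False) \<and> P (True, False, True) \<and> P (True, True, False) \<and> P (True, True, True)"
  by (simp add: split_paired_All) (metis (full_types))

lemma koszul_koszul [simp]: "koszul (koszul c) = 0"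
  unfolding fun_eq_iff[of "koszul (koszul c)"] all_bool3
  by (simp add: koszul_def neg_if_def smul_simps mult.commute)

lemma koszul_linear: "koszul (b + c) = koszul b + koszul c" "koszul (b - c) = koszul b - koszul c" "koszul 0 = 0"
  by (auto simp: fun_eq_iff koszul_def neg_if_def algebra_simps)

lemma in_degree_linear: "in_degree i b \<Longrightarrow> in_degree i c \<Longrightarrow> in_degree i (b - c)" "in_degree i 0"
  by (auto simp: in_degree_def)

lemma in_degree_koszul:
  assumes "in_degree (Suc i) c" shows "in_degree i (koszul c)"
  using assms unfolding in_degree_def all_bool3 by (auto simp: koszul_def neg_if_def smul_simps)

lemma koszul_degree_0:
  assumes "in_degree 0 c" shows "koszul c = 0"
  using assms unfolding in_degree_def all_bool3 fun_eq_iff[of "koszul c"] by (auto simp: koszul_def neg_if_def smul_simps)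

lemma chains_diff: "graded_submodule N \<Longrightarrow> b \<in> chains N j \<Longrightarrow> c \<in> chains N j \<Longrightarrow> b - c \<in> chains N j"
  by (auto simp: chains_def gs_diff)

lemma chains_0: "graded_submodule N \<Longrightarrow> 0 \<in> chains N j"
  by (auto simp: chains_def gs_0)

lemma chains_mono: "(\<And>k. N k \<subseteq> L k) \<Longrightarrow> c \<in> chains N j \<Longrightarrow> c \<in> chains L j"
  by (intro chainsI) (meson chainsD subsetD)

lemma chains_koszul:
  assumes N: "graded_submodule N" and c: "c \<in> chains N j" shows "koszul c \<in> chains N j"
proof -
  have v: "var t \<cdot> c s \<in> N n" if "n = j - int (wt s) + 1" for t s n
    using gs_smul[OF N chainsD[OF c refl] homogeneous_var that] .
  show ?thesis unfolding chains_def all_bool3 mem_Collect_eq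
    by (auto simp: koszul_def neg_if_def simp del: add_uminus_conv_diff uminus_add_conv_diff intro!: gs_add[OF N] gs_uminus[OF N] v gs_0[OF N])
qed

lemma regular_mono:
  assumes "regular r N Z" "r \<le> r'" shows "regular r' N Z"
  unfolding regular_def
proof (intro allI ballI impI)
  fix i j c assume "c \<in> chains N j" "j > int i + r'" "in_degree i c" "koszul c \<in> chains Z j"
  then show "\<exists>b \<in> chains N j. in_degree (Suc i) b \<and> c - koszul b \<in> chains Z j"
    using assms by (auto simp: regular_def)
qed

text \<open>The exact sequence \<open>H\<^bsub>i+1\<^esub>(L/K) \<rightarrow> H\<^sub>i(K/Z) \<rightarrow> H\<^sub>i(L/Z)\<close>: a cycle of \<open>K\<close> bounds a chain of \<open>L\<close>,
  which is a cycle of \<open>L/K\<close> and can be moved into \<open>K\<close> by a boundary.\<close>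

lemma regular_kernel:
  assumes gs: "graded_submodule K" "graded_submodule Z" and sub: "\<And>k. Z k \<subseteq> K k" "\<And>k. K k \<subseteq> L k"
    and L: "regular (r + 1) L Z" and N: "regular r L K"
  shows "regular (r + 1) K Z"
  unfolding regular_def
proof (intro allI ballI impI)
  fix i j c assume c: "c \<in> chains K j" "j > int i + (r + 1)" "in_degree i c" "koszul c \<in> chains Z j"
  have "c \<in> chains L j" using chains_mono[OF sub(2)] c(1) .
  with c L obtain b where b: "b \<in> chains L j" "in_degree (Suc i) b" "c - koszul b \<in> chains Z j"
    unfolding regular_def by blast
  have "c - (c - koszul b) \<in> chains K j"
    using chains_diff[OF gs(1) c(1) chains_mono[OF sub(1) b(3)]] .
  then have "koszul b \<in> chains K j" by simp
  moreover have "j > int (Suc i) + r" using c(2) by simp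
  ultimately obtain a where a: "a \<in> chains L j" "in_degree (Suc (Suc i)) a" "b - koszul a \<in> chains K j"
    using N b unfolding regular_def by blast
  show "\<exists>b \<in> chains K j. in_degree (Suc i) b \<and> c - koszul b \<in> chains Z j"
  proof (intro bexI conjI)
    show "in_degree (Suc i) (b - koszul a)" using b(2) in_degree_koszul[OF a(2)] by (rule in_degree_linear)
    show "c - koszul (b - koszul a) \<in> chains Z j" using b(3) by (simp add: koszul_linear)
  qed (rule a(3))
qed

text \<open>The exact sequence \<open>H\<^sub>i(L/Z) \<rightarrow> H\<^sub>i(L/K) \<rightarrow> H\<^bsub>i-1\<^esub>(K/Z)\<close>: the differential of a cycle of \<open>L/K\<close> is a
  cycle of \<open>K\<close>, and once it bounds in \<open>K\<close> the chain can be corrected to a cycle of \<open>L/Z\<close>.\<close>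

lemma regular_quotient:
  assumes gs: "graded_submodule K" "graded_submodule L" and sub: "\<And>k. Z k \<subseteq> K k" "\<And>k. K k \<subseteq> L k"
    and L: "regular r L Z" and K: "regular (r + 1) K Z" and Z: "graded_submodule Z"
  shows "regular r L K"
  unfolding regular_def
proof (intro allI ballI impI)
  fix i j c assume c: "c \<in> chains L j" "j > int i + r" "in_degree i c" "koszul c \<in> chains K j"
  have "\<exists>b \<in> chains K j. in_degree i b \<and> koszul c - koszul b \<in> chains Z j"
  proof (cases i)
    case 0
    then have "koszul c = 0" using c(3) koszul_degree_0 by simp
    then show ?thesis using chains_0[OF gs(1)] chains_0[OF Z]
      by (intro bexI[of _ 0]) (auto simp: in_degree_linear koszul_linear)
  next
    case (Suc i')
    have "koszul (koszul c) \<in> chains Z j" using chains_0[OF Z] by simp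
    moreover have "in_degree i' (koszul c)" using in_degree_koszul c(3) Suc by blast
    moreover have "j > int i' + (r + 1)" using c(2) Suc by simp
    ultimately show ?thesis using K c(4) Suc unfolding regular_def by blast
  qed
  then obtain b where b: "b \<in> chains K j" "in_degree i b" "koszul (c - b) \<in> chains Z j"
    by (auto simp: koszul_linear)
  have bL: "b \<in> chains L j" using chains_mono[OF sub(2) b(1)] .
  obtain a where a: "a \<in> chains L j" "in_degree (Suc i) a" "(c - b) - koszul a \<in> chains Z j"
    using L chains_diff[OF gs(2) c(1) bL] in_degree_linear(1)[OF c(3) b(2)] b(3) c(2) unfolding regular_def by blast
  have "b - (- ((c - b) - koszul a)) \<in> chains K j"
    using chains_diff[OF gs(1) b(1)] chains_mono[OF sub(1) a(3)] chains_diff[OF gs(1) chains_0[OF gs(1)], of "(c - b) - koszul a"]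
    by (metis diff_0)
  then have "c - koszul a \<in> chains K j" by simp
  then show "\<exists>b \<in> chains L j. in_degree (Suc i) b \<and> c - koszul b \<in> chains K j" using a by blast
qed

lemma koszul_slinear:
  assumes "slinear \<phi>" shows "koszul (\<lambda>s. \<phi> (c s)) = (\<lambda>s. \<phi> (koszul c s))"
  unfolding fun_eq_iff all_bool3 koszul_def neg_if_def
  by (simp add: slinear_simps[OF assms])

text \<open>An isomorphism \<open>L/K \<cong> (N/Z)(s)\<close> identifies the Koszul complexes: chains of \<open>N\<close> lift
  to \<open>L\<close> componentwise, and what is lost in lifting lies in \<open>Z\<close>.\<close>

lemma regular_transfer:
  fixes L K :: "'k family" and N Z :: "'m family"
  assumes lin: "slinear \<phi>" and gs: "graded_submodule L" "graded_submodule Z"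
    and into: "\<And>k u. u \<in> L k \<Longrightarrow> \<phi> u \<in> N (k + s)"
    and onto: "\<And>k v. v \<in> N (k + s) \<Longrightarrow> \<exists>u\<in>L k. v - \<phi> u \<in> Z (k + s)"
    and ker: "\<And>k u. u \<in> L k \<Longrightarrow> \<phi> u \<in> Z (k + s) \<longleftrightarrow> u \<in> K k"
  shows "regular r L K \<longleftrightarrow> regular (r + s) N Z"
proof -
  define \<Phi> where "\<Phi> c = (\<lambda>s. \<phi> (c s))" for c :: "'k chain"
  have \<Phi>: "\<Phi> c \<in> chains N (j + s)" if "c \<in> chains L j" for c j
    using that into[of _ "j - _"] by (simp add: chains_def \<Phi>_def algebra_simps)
  have deg: "in_degree i (\<Phi> c)" if "in_degree i c" for i c
    using that slinear_simps(3)[OF lin] by (simp add: in_degree_def \<Phi>_def)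
  have kos: "koszul (\<Phi> c) = \<Phi> (koszul c)" for c
    unfolding \<Phi>_def by (rule koszul_slinear[OF lin])
  have dif: "\<Phi> (b - c) = \<Phi> b - \<Phi> c" for b c
    using slinear_simps(5)[OF lin] by (simp add: fun_eq_iff \<Phi>_def)
  have kern: "\<Phi> c \<in> chains Z (j + s) \<longleftrightarrow> c \<in> chains K j" if "c \<in> chains L j" for c j
    using that ker[of _ "j - _"] by (simp add: chains_def \<Phi>_def algebra_simps)
  have lift: "\<exists>c \<in> chains L j. in_degree i c \<and> b - \<Phi> c \<in> chains Z (j + s)"
    if b: "b \<in> chains N (j + s)" "in_degree i b" for b i j
  proof -
    have "\<forall>t. \<exists>u. u \<in> L (j - int (wt t)) \<and> b t - \<phi> u \<in> Z (j + s - int (wt t)) \<and> (wt t \<noteq> i \<longrightarrow> u = 0)"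
    proof
      fix t show "\<exists>u. u \<in> L (j - int (wt t)) \<and> b t - \<phi> u \<in> Z (j + s - int (wt t)) \<and> (wt t \<noteq> i \<longrightarrow> u = 0)"
      proof (cases "wt t = i")
        case True
        then show ?thesis using b(1) onto[of "b t" "j - int (wt t)"] by (auto simp: chains_def algebra_simps)
      next
        case False
        then have "b t = 0" using b(2) by (simp add: in_degree_def)
        then show ?thesis using slinear_simps(3)[OF lin] gs_0[OF gs(1)] gs_0[OF gs(2)]
          by (intro exI[of _ 0]) auto
      qed
    qed
    then obtain c where "\<forall>t. c t \<in> L (j - int (wt t)) \<and> b t - \<phi> (c t) \<in> Z (j + s - int (wt t)) \<and> (wt t \<noteq> i \<longrightarrow> c t = 0)"
      by metis
    then show ?thesis by (intro bexI[of _ c]) (auto simp: chains_def in_degree_def \<Phi>_def)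
  qed
  show ?thesis
  proof
    assume L: "regular r L K"
    show "regular (r + s) N Z" unfolding regular_def
    proof (intro allI ballI impI)
      fix i j b assume b: "b \<in> chains N j" "j > int i + (r + s)" "in_degree i b" "koszul b \<in> chains Z j"
      define j' where "j' = j - s"
      have j: "j = j' + s" by (simp add: j'_def)
      obtain c where c: "c \<in> chains L j'" "in_degree i c" "b - \<Phi> c \<in> chains Z j"
        using lift b(1,3) unfolding j by blast
      have "koszul b - koszul (b - \<Phi> c) \<in> chains Z j"
        using chains_diff[OF gs(2) b(4) chains_koszul[OF gs(2) c(3)]] .
      then have "\<Phi> (koszul c) \<in> chains Z (j' + s)" by (simp add: koszul_linear kos j)
      then have "koszul c \<in> chains K j'" using kern chains_koszul[OF gs(1) c(1)] by simp
      moreover have "j' > int i + r" using b(2) by (simp add: j'_def)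
      ultimately obtain a where a: "a \<in> chains L j'" "in_degree (Suc i) a" "c - koszul a \<in> chains K j'"
        using L c unfolding regular_def by blast
      have "c - koszul a \<in> chains L j'" using chains_diff[OF gs(1) c(1) chains_koszul[OF gs(1) a(1)]] .
      then have "\<Phi> (c - koszul a) \<in> chains Z j" using a(3) kern j by simp
      then have "(b - \<Phi> c) - (0 - \<Phi> (c - koszul a)) \<in> chains Z j"
        using chains_diff[OF gs(2) c(3) chains_diff[OF gs(2) chains_0[OF gs(2)]]] by blast
      then have "b - koszul (\<Phi> a) \<in> chains Z j" by (simp add: dif kos)
      then show "\<exists>a\<in>chains N j. in_degree (Suc i) a \<and> b - koszul a \<in> chains Z j"
        using \<Phi>[OF a(1)] deg[OF a(2)] j by blast
    qed
  next
    assume N: "regular (r + s) N Z"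
    show "regular r L K" unfolding regular_def
    proof (intro allI ballI impI)
      fix i j c assume c: "c \<in> chains L j" "j > int i + r" "in_degree i c" "koszul c \<in> chains K j"
      have "koszul (\<Phi> c) \<in> chains Z (j + s)"
        using kern[OF chains_koszul[OF gs(1) c(1)]] c(4) by (simp add: kos)
      moreover have "j + s > int i + (r + s)" using c(2) by simp
      ultimately obtain b where b: "b \<in> chains N (j + s)" "in_degree (Suc i) b" "\<Phi> c - koszul b \<in> chains Z (j + s)"
        using N \<Phi>[OF c(1)] deg[OF c(3)] unfolding regular_def by blast
      obtain a where a: "a \<in> chains L j" "in_degree (Suc i) a" "b - \<Phi> a \<in> chains Z (j + s)"
        using lift b(1,2) by blast
      have "(\<Phi> c - koszul b) - (0 - koszul (b - \<Phi> a)) \<in> chains Z (j + s)"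
        using chains_diff[OF gs(2) b(3) chains_diff[OF gs(2) chains_0[OF gs(2)] chains_koszul[OF gs(2) a(3)]]] .
      then have "\<Phi> (c - koszul a) \<in> chains Z (j + s)" by (simp add: koszul_linear kos dif)
      then have "c - koszul a \<in> chains K j"
        using kern chains_diff[OF gs(1) c(1) chains_koszul[OF gs(1) a(1)]] by blast
      then show "\<exists>b\<in>chains L j. in_degree (Suc i) b \<and> c - koszul b \<in> chains K j" using a by blast
    qed
  qed
qed

text \<open>A module that vanishes in degrees \<open>k \<ge> r\<close> has no Koszul chains at all in homological degree \<open>i\<close>
  and total degree \<open>j \<ge> i + r\<close>.\<close>

lemma regular_finite_length:
  assumes "\<And>k. k \<ge> r \<Longrightarrow> N k \<subseteq> Z k" and Z: "graded_submodule Z" and N: "graded_submodule N"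
  shows "regular (r - 1) N Z"
  unfolding regular_def
proof (intro allI ballI impI)
  fix i j c assume c: "c \<in> chains N j" "j > int i + (r - 1)" "in_degree i c"
  have "c s \<in> Z (j - int (wt s))" for s
  proof (cases "wt s = i")
    case True
    then show ?thesis using c(2) assms(1)[of "j - int i"] chainsD[OF c(1), of _ s] by auto
  qed (use c(3) gs_0[OF Z] in \<open>simp add: in_degree_def\<close>)
  then show "\<exists>b\<in>chains N j. in_degree (Suc i) b \<and> c - koszul b \<in> chains Z j"
    using chains_0[OF N] by (intro bexI[of _ 0]) (auto simp: in_degree_linear koszul_linear chains_def)
qed

lemma partial_deriv_diff: "partial_deriv i (p - q) = partial_deriv i p - partial_deriv i q"
  using partial_deriv_add[of i p "- q"] by (simp add: partial_deriv_uminus)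

section \<open>Free modules are regular\<close>

definition free :: "'k set \<Rightarrow> ('k \<Rightarrow> int) \<Rightarrow> 'k family" where
  "free I a k = {v. (\<forall>j\<in>I. homogeneous (k - a j) (v j)) \<and> (\<forall>j. j \<notin> I \<longrightarrow> v j = 0)}"

lemma gs_free: "graded_submodule (free I a)"
  by (rule graded_submoduleI) (auto simp: free_def intro: homogeneous_diff homogeneous_mult')

text \<open>The exterior derivative on polynomial differential forms, which is a contracting homotopy of the
  Koszul complex up to the total degree.\<close>

definition derham :: "(bool \<times> bool \<times> bool \<Rightarrow> poly3) \<Rightarrow> (bool \<times> bool \<times> bool \<Rightarrow> poly3)" where
  "derham c = (\<lambda>(p, q, r).
     (if p then partial_deriv 0 (c (False, q, r)) else 0) +
     (if q then neg_if p (partial_deriv 1 (c (p, False, r))) else 0) +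
     (if r then neg_if p (neg_if q (partial_deriv 2 (c (p, q, False)))) else 0))"

lemma koszul_apply: "koszul c (p, q, r) k =
     (if p then 0 else var 0 * c (True, q, r) k) +
     (if q then 0 else neg_if p (var 1 * c (p, True, r) k)) +
     (if r then 0 else neg_if p (neg_if q (var 2 * c (p, q, True) k)))"
  by (simp add: koszul_def neg_if_def)

text \<open>Cartan's formula for the Euler vector field. The Koszul differential is contraction with that
  field, and the Lie derivative along it multiplies a form by its total degree.\<close>

lemma derham_koszul:
  fixes c :: "'k chain"
  assumes "\<And>s. homogeneous (j - int (wt s)) (c s k)"
  shows "koszul (\<lambda>s k. derham (\<lambda>s. c s k) s) s k + derham (\<lambda>s. koszul c s k) s = of_int j * c s k"
proof -
  have e: "var 0 * partial_deriv 0 (c s k) + var 1 * partial_deriv 1 (c s k) + var 2 * partial_deriv 2 (c s k)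
     = of_int j * c s k - of_nat (wt s) * c s k" for s
    using euler_formula[OF assms[of s]] by (simp add: sum_UNIV_3 algebra_simps)
  have "\<forall>s. koszul (\<lambda>s k. derham (\<lambda>s. c s k) s) s k + derham (\<lambda>s. koszul c s k) s = 
    var 0 * partial_deriv 0 (c s k) + var 1 * partial_deriv 1 (c s k) + var 2 * partial_deriv 2 (c s k) + of_nat (wt s) * c s k"
    unfolding all_bool3 koszul_apply derham_def
    by (simp add: neg_if_def partial_deriv_mult partial_deriv_add partial_deriv_uminus partial_deriv_diff partial_deriv_var algebra_simps)
  then show ?thesis using e[of s] by simp
qed

lemma homogeneous_neg_if: "homogeneous k (neg_if b p) \<longleftrightarrow> homogeneous k p"
  by (simp add: neg_if_def)

text \<open>In a summand with shift \<open>a k\<close> a cycle of total degree \<open>j\<close> is the boundary of its exterior derivative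
  divided by \<open>j - a k\<close>, which is nonzero as \<open>j > i + r \<ge> a k\<close>. This covers every homological degree,
  including \<open>0\<close>.\<close>

lemma regular_free:
  assumes "\<And>j. j \<in> I \<Longrightarrow> a j \<le> r"
  shows "regular r (free I a) (\<lambda>_. {0})"
  unfolding regular_def
proof (intro allI ballI impI)
  fix i j and c :: "'a chain"
  assume c: "c \<in> chains (free I a) j" "j > int i + r" "in_degree i c" "koszul c \<in> chains (\<lambda>_. {0}) j"
  have k0: "koszul c = 0" using c(4) by (auto simp: chains_def fun_eq_iff[of "koszul c"])
  define b :: "'a chain" where "b = (\<lambda>s k. const (inverse (of_int (j - a k))) * derham (\<lambda>s. c s k) s)"
  have ck: "homogeneous (j - a k - int (wt s)) (c s k)" if "k \<in> I" for s k
    using chainsD[OF c(1) refl, of s] that by (simp add: free_def algebra_simps)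
  have ck0: "c s k = 0" if "k \<notin> I" for s k
    using chainsD[OF c(1) refl, of s] that by (simp add: free_def)
  have d0: "derham (\<lambda>s. 0) s = 0" for s by (cases s) (simp add: derham_def neg_if_def)
  have bh: "homogeneous (j - a k - int (wt s)) (b s k)" if k: "k \<in> I" for s k
  proof -
    have dh: "homogeneous n (partial_deriv i (c s k))" if "n = j - a k - int (wt s) - 1" for n i s
      using homogeneous_partial_deriv[OF ck[OF k]] that by simp
    have "\<forall>s. homogeneous (j - a k - int (wt s)) (derham (\<lambda>s. c s k) s)"
      unfolding all_bool3 derham_def
      by (auto simp: homogeneous_neg_if intro!: homogeneous_add dh)
    then show ?thesis unfolding b_def by (metis add_0 homogeneous_const homogeneous_mult)
  qed
  have "b \<in> chains (free I a) j"
    using bh by (auto simp: chains_def free_def algebra_simps b_def ck0 d0)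
  moreover have "in_degree (Suc i) b"
    unfolding in_degree_def all_bool3 b_def derham_def using c(3)
    by (auto simp: in_degree_def neg_if_def fun_eq_iff)
  moreover have "koszul b = c"
  proof (intro ext)
    fix s :: "bool \<times> bool \<times> bool" and k
    obtain p q t where s: "s = (p, q, t)" by (metis prod_cases3)
    show "koszul b s k = c s k"
    proof (cases "k \<in> I")
      case True
      have pos: "j - a k \<noteq> 0" using assms[OF True] c(2) by simp
      have "koszul b s k = const (inverse (of_int (j - a k))) * koszul (\<lambda>s k. derham (\<lambda>s. c s k) s) s k"
        unfolding s koszul_apply b_def by (simp add: neg_if_def algebra_simps)
      also have "koszul (\<lambda>s k. derham (\<lambda>s. c s k) s) s k = of_int (j - a k) * c s k"
        using derham_koszul[where c = c and j = "j - a k" and k = k and s = s] ck[OF True] by (simp add: k0 d0)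
      also have "const (inverse (of_int (j - a k))) * (of_int (j - a k) * c s k) = c s k"
        unfolding const_of_int[symmetric] using pos
        by (metis (no_types, opaque_lifting) const_inverse mult.left_commute of_int_eq_0_iff)
      finally show ?thesis .
    qed (simp add: s koszul_apply b_def ck0 d0 neg_if_def)
  qed
  ultimately show "\<exists>b\<in>chains (free I a) j. in_degree (Suc i) b \<and> c - koszul b \<in> chains (\<lambda>_. {0}) j"
    by (intro bexI[of _ b]) (auto simp: chains_def)
qed

lemma prod_UNIV_3: "prod g (UNIV :: 3 set) = g 0 * g 1 * g 2"
  unfolding UNIV_3 by (simp add: mult.assoc)

section \<open>Substitution homomorphisms\<close>

definition mon_subst :: "(3 \<Rightarrow> poly3) \<Rightarrow> mon3 \<Rightarrow> poly3" where
  "mon_subst t m = (\<Prod>i\<in>UNIV. t i ^ mcoeff m i)"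

definition subst :: "(3 \<Rightarrow> poly3) \<Rightarrow> poly3 \<Rightarrow> poly3" where
  "subst t p = (\<Sum>m\<in>keys p. const (mcoeff p m) * mon_subst t m)"

lemma subst_superset:
  assumes "finite K" "keys p \<subseteq> K"
  shows "subst t p = (\<Sum>m\<in>K. const (mcoeff p m) * mon_subst t m)"
  unfolding subst_def using assms
  by (intro sum.mono_neutral_left) (auto simp: in_keys_iff const_simps)

lemma subst_add: "subst t (p + q) = subst t p + subst t q"
proof -
  define K where "K = keys p \<union> keys q"
  have "finite K" "keys p \<subseteq> K" "keys q \<subseteq> K" "keys (p + q) \<subseteq> K"
    using keys_add[of p q] by (auto simp: K_def)
  then show ?thesis
    by (simp add: subst_superset[of K] lookup_add algebra_simps const_simps sum.distrib)
qed

lemma subst_mterm: "subst t (mterm m c) = const c * mon_subst t m"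
  by (subst subst_superset[of "{m}"]) auto

lemma mon_subst_add: "mon_subst t (m + n) = mon_subst t m * mon_subst t n"
  by (simp add: mon_subst_def lookup_add power_add prod.distrib)

lemma subst_mult: "subst t (p * q) = subst t p * subst t q"
proof (rule additive_eqI[where F = "\<lambda>p. subst t (p * q)" and G = "\<lambda>p. subst t p * subst t q"])
  fix m c
  show "subst t (mterm m c * q) = subst t (mterm m c) * subst t q"
    by (rule additive_eqI[where F = "\<lambda>q. subst t (mterm m c * q)" and G = "\<lambda>q. subst t (mterm m c) * subst t q"])
      (simp_all add: algebra_simps subst_add mult_single subst_mterm mon_subst_add const_simps)
qed (simp_all add: algebra_simps subst_add)

lemma subst_const: "subst t (const c) = const c"
  by (simp add: const_def subst_mterm mon_subst_def mult_single)

lemma subst_var: "subst t (var i) = t i"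
proof -
  have "mon_subst t (mterm i 1) = (\<Prod>j\<in>UNIV. if j = i then t j else 1)"
    unfolding mon_subst_def by (intro prod.cong refl) (simp add: lookup_single when_def)
  then show ?thesis by (simp add: var_def subst_mterm const_simps)
qed

lemma subst_simps: "subst t (p + q) = subst t p + subst t q" "subst t (p * q) = subst t p * subst t q"
  "subst t (const c) = const c" "subst t (var i) = t i" "subst t 0 = 0" "subst t 1 = 1"
  "subst t (- p) = - subst t p" "subst t (p - q) = subst t p - subst t q"
proof -
  show s: "subst t (p + q) = subst t p + subst t q" "subst t (p * q) = subst t p * subst t q"
  "subst t (const c) = const c" "subst t (var i) = t i" for p q c i
    by (simp_all add: subst_add subst_mult subst_const subst_var)
  show "subst t 0 = 0" "subst t 1 = 1" using s(3)[of 0] s(3)[of 1] by (simp_all add: const_simps)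
  show m: "subst t (- p) = - subst t p" for p using s(2)[of "const (-1)" p] s(3)[of "-1"] by (simp add: const_simps)
  show "subst t (p - q) = subst t p - subst t q" using s(1)[of p "- q"] by (simp add: m)
qed

lemma mterm_eq_prod: "mterm m 1 = (\<Prod>i\<in>UNIV. var i ^ mcoeff m i)"
proof -
  have pow: "mterm (mterm i n) 1 = var i ^ n" for i n
  proof (induction n)
    case (Suc n)
    have "mterm (mterm i (Suc n)) 1 = mterm (mterm i 1) 1 * mterm (mterm i n) (1::complex)"
      by (simp add: mult_single flip: single_add)
    then show ?case using Suc by (simp add: var_def)
  qed simp
  have m: "m = mterm 0 (mcoeff m 0) + mterm 1 (mcoeff m 1) + mterm 2 (mcoeff m 2)" (is "_ = ?r")
  proof (rule poly_mapping_eqI)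
    fix i
    have "\<forall>i. mcoeff m i = mcoeff ?r i"
      unfolding all_3 by (simp add: lookup_add lookup_single)
    then show "mcoeff m i = mcoeff ?r i" ..
  qed
  have "mterm m 1 = mterm (mterm 0 (mcoeff m 0) + mterm 1 (mcoeff m 1) + mterm 2 (mcoeff m 2)) (1::complex)"
    using m by (rule arg_cong)
  also have "\<dots> = mterm (mterm 0 (mcoeff m 0)) 1 * mterm (mterm 1 (mcoeff m 1)) 1 * mterm (mterm 2 (mcoeff m 2)) (1::complex)"
    by (simp add: mult_single)
  also have "\<dots> = (\<Prod>i\<in>UNIV. var i ^ mcoeff m i)"
    unfolding pow prod_UNIV_3 ..
  finally show ?thesis .
qed

lemma poly3_induct [case_names const var add mult]:
  assumes c: "\<And>c. P (const c)" and v: "\<And>i. P (var i)"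
    and add: "\<And>p q. P p \<Longrightarrow> P q \<Longrightarrow> P (p + q)" and mult: "\<And>p q. P p \<Longrightarrow> P q \<Longrightarrow> P (p * q)"
  shows "P p"
proof -
  have pow: "P (q ^ n)" if "P q" for q n
    using that c[of 1] mult by (induction n) (auto simp: const_simps)
  have mon: "P (mterm m c)" for m c
  proof -
    have "mterm m c = const c * mterm m 1" by (simp add: const_mult_mono)
    then show ?thesis unfolding mterm_eq_prod
      by (simp only: prod_UNIV_3, intro mult pow v c)
  qed
  have "P (\<Sum>m\<in>K. mterm m (mcoeff p m))" if "finite K" for K
    using that by induction (use c[of 0] in \<open>auto simp: const_simps intro: add mon\<close>)
  from this[of "keys p"] show ?thesis
    unfolding poly_as_sum[of "keys p" p, OF finite_keys order_refl, symmetric] by simp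
qed

section \<open>Vectors in complex three-space\<close>

type_synonym vec3 = "3 \<Rightarrow> complex"

definition dot :: "vec3 \<Rightarrow> vec3 \<Rightarrow> complex" where "dot a v = (\<Sum>i\<in>UNIV. a i * v i)"

lemma dot_3: "dot a v = a 0 * v 0 + a 1 * v 1 + a 2 * v 2"
  by (simp add: dot_def sum_UNIV_3)

definition cross :: "vec3 \<Rightarrow> vec3 \<Rightarrow> vec3" where
  "cross a b = (\<lambda>i. if i = 0 then a 1 * b 2 - a 2 * b 1 else if i = 1 then a 2 * b 0 - a 0 * b 2
     else a 0 * b 1 - a 1 * b 0)"

lemma cross_3: "cross a b 0 = a 1 * b 2 - a 2 * b 1" "cross a b 1 = a 2 * b 0 - a 0 * b 2"
  "cross a b 2 = a 0 * b 1 - a 1 * b 0"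
  by (simp_all add: cross_def)

lemma vec3_eq_iff: "(v :: 3 \<Rightarrow> 'a) = w \<longleftrightarrow> v 0 = w 0 \<and> v 1 = w 1 \<and> v 2 = w 2"
  by (simp add: fun_eq_iff all_3)

definition proportional :: "vec3 \<Rightarrow> vec3 \<Rightarrow> bool" where
  "proportional a b \<longleftrightarrow> (\<exists>c. b = (\<lambda>i. c * a i))"

lemma cross_eq_0:
  assumes "a \<noteq> (\<lambda>_. 0)" "cross a b = (\<lambda>_. 0)" shows "proportional a b"
proof -
  have e: "a 1 * b 2 = a 2 * b 1" "a 2 * b 0 = a 0 * b 2" "a 0 * b 1 = a 1 * b 0"
    using assms(2) by (simp_all add: vec3_eq_iff cross_3)
  consider "a 0 \<noteq> 0" | "a 1 \<noteq> 0" | "a 2 \<noteq> 0" using assms(1) by (auto simp: vec3_eq_iff)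
  then show ?thesis
  proof cases
    case 1
    then show ?thesis unfolding proportional_def vec3_eq_iff
      using e by (intro exI[of _ "b 0 / a 0"]) (simp add: field_simps)
  next
    case 2
    then show ?thesis unfolding proportional_def vec3_eq_iff
      using e by (intro exI[of _ "b 1 / a 1"]) (simp add: field_simps)
  next
    case 3
    then show ?thesis unfolding proportional_def vec3_eq_iff
      using e by (intro exI[of _ "b 2 / a 2"]) (simp add: field_simps)
  qed
qed

lemma dot_cross [simp]: "dot a (cross a b) = 0" "dot b (cross a b) = 0"
  by (simp_all add: dot_3 cross_3 algebra_simps)

text \<open>The expansion \<open>v \<times> (a \<times> b) = (b \<bullet> v) a - (a \<bullet> v) b\<close> of the double cross product: the vectors killed by both \<open>a\<close>
  and \<open>b\<close> are the multiples of \<open>a \<times> b\<close>.\<close>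

lemma cross_cross: "dot a v = 0 \<Longrightarrow> dot b v = 0 \<Longrightarrow> cross v (cross a b) = (\<lambda>_. 0)"
proof -
  assume *: "dot a v = 0" "dot b v = 0"
  have "cross v (cross a b) = (\<lambda>i. dot b v * a i - dot a v * b i)"
    by (simp add: vec3_eq_iff cross_3 dot_3 algebra_simps)
  then show ?thesis using * by simp
qed

lemma cramer: "dot a (cross b c) * w i =
   dot w (cross b c) * a i + dot w (cross c a) * b i + dot w (cross a b) * c i"
proof -
  have "\<forall>i. dot a (cross b c) * w i =
   dot w (cross b c) * a i + dot w (cross c a) * b i + dot w (cross a b) * c i"
    unfolding all_3 by (simp add: cross_3 dot_3 algebra_simps)
  then show ?thesis ..
qed

lemma dot_nonzero_ex: "a \<noteq> (\<lambda>_. 0) \<Longrightarrow> \<exists>v. dot a v \<noteq> 0"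
proof (rule ccontr)
  assume a: "a \<noteq> (\<lambda>_. 0)" "\<nexists>v. dot a v \<noteq> 0"
  then have "dot a (\<lambda>j. if j = i then 1 else 0) = 0" for i by blast
  then have "\<forall>i. a i = 0" by (simp add: dot_def if_distrib cong: if_cong)
  then show False using a(1) by auto
qed

section \<open>Linear forms are prime\<close>

lemma linear_form_eq: "linear_form a = (\<Sum>i\<in>UNIV. const (a i) * var i)"
  by (simp add: linear_form_def const_def var_def mult_single)

lemma linear_form_add: "linear_form (\<lambda>i. c * a i + d * b i) = const c * linear_form a + const d * linear_form b"
  by (simp add: linear_form_eq sum_UNIV_3 const_simps algebra_simps)

lemma homogeneous_const_mult: "homogeneous k p \<Longrightarrow> homogeneous k (const c * p)"
  by (rule homogeneous_mult'[where j = 0]) auto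

lemma homogeneous_linear_form [simp]: "homogeneous 1 (linear_form a)"
  unfolding linear_form_eq by (intro homogeneous_sum homogeneous_const_mult homogeneous_var)

lemma partial_deriv_linear_form: "partial_deriv i (linear_form a) = const (a i)"
proof -
  have "\<forall>i. partial_deriv i (linear_form a) = const (a i)"
    unfolding all_3 linear_form_eq by (simp add: sum_UNIV_3 partial_deriv_add partial_deriv_mult partial_deriv_var)
  then show ?thesis ..
qed

lemma linear_form_eq_0_iff: "linear_form a = 0 \<longleftrightarrow> a = (\<lambda>_. 0)"
proof
  assume "linear_form a = 0"
  then have "const (a i) = 0" for i using partial_deriv_linear_form[of i a] by simp
  then show "a = (\<lambda>_. 0)" by auto
qed (simp add: linear_form_eq const_simps)

definition pivot :: "vec3 \<Rightarrow> 3" where "pivot a = (SOME i. a i \<noteq> 0)"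

text \<open>Solving \<open>linear_form a = 0\<close> for one variable gives a ring endomorphism of \<open>S\<close>. It is the identity
  modulo \<open>linear_form a\<close> and kills \<open>linear_form a\<close>, so \<open>S\<close> modulo this form is realised as a subring of
  \<open>S\<close> itself. In this way divisibility modulo a line becomes divisibility in \<open>S\<close>.\<close>

definition eliminate :: "vec3 \<Rightarrow> poly3 \<Rightarrow> poly3" where
  "eliminate a = subst (\<lambda>j. var j - (if j = pivot a then const (1 / a (pivot a)) * linear_form a else 0))"

lemma eliminate_simps: "eliminate a (p + q) = eliminate a p + eliminate a q" "eliminate a (p * q) = eliminate a p * eliminate a q"
  "eliminate a (const c) = const c" "eliminate a 0 = 0" "eliminate a 1 = 1"
  "eliminate a (p - q) = eliminate a p - eliminate a q"
  by (simp_all add: eliminate_def subst_simps)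

lemma eliminate_prod: "eliminate a (prod g I) = (\<Prod>i\<in>I. eliminate a (g i))"
  by (induction I rule: infinite_finite_induct) (auto simp: eliminate_simps)

lemma pivot: "a \<noteq> (\<lambda>_. 0) \<Longrightarrow> a (pivot a) \<noteq> 0"
  unfolding pivot_def by (rule someI_ex) auto

lemma eliminate_linear_form:
  "eliminate a (linear_form b) = linear_form (\<lambda>i. b i - b (pivot a) / a (pivot a) * a i)"
proof -
  have "eliminate a (linear_form b) =
    (\<Sum>j\<in>UNIV. const (b j) * var j - (if j = pivot a then const (b j) * (const (1 / a (pivot a)) * linear_form a) else 0))"
    unfolding eliminate_def linear_form_eq[of b]
    by (simp add: sum_UNIV_3 subst_simps algebra_simps)
  also have "\<dots> = linear_form b - const (b (pivot a)) * (const (1 / a (pivot a)) * linear_form a)"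
    by (simp add: sum_subtractf linear_form_eq[of b])
  also have "\<dots> = linear_form (\<lambda>i. 1 * b i + (- b (pivot a) / a (pivot a)) * a i)"
    unfolding linear_form_add by (simp add: const_simps(4,5) const_simps(2)[symmetric] mult.assoc[symmetric])
  finally show ?thesis by simp
qed

lemma eliminate_self: "a \<noteq> (\<lambda>_. 0) \<Longrightarrow> eliminate a (linear_form a) = 0"
  by (simp add: eliminate_linear_form pivot linear_form_eq_0_iff)

lemma eliminate_cong: "linear_form a dvd eliminate a p - p"
proof (induction p rule: poly3_induct)
  case (var i)
  then show ?case by (simp add: eliminate_def subst_simps)
next
  case (add p q)
  have "eliminate a (p + q) - (p + q) = (eliminate a p - p) + (eliminate a q - q)"
    by (simp add: eliminate_simps)
  then show ?case using add by (simp only: dvd_add)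
next
  case (mult p q)
  have "eliminate a (p * q) - p * q = eliminate a p * (eliminate a q - q) + (eliminate a p - p) * q"
    by (simp add: eliminate_simps algebra_simps)
  then show ?case using mult by (simp only: dvd_add dvd_mult dvd_mult2)
qed (simp add: eliminate_simps)

lemma linear_form_dvd_iff:
  assumes "a \<noteq> (\<lambda>_. 0)" shows "linear_form a dvd p \<longleftrightarrow> eliminate a p = 0"
proof
  assume "linear_form a dvd p"
  then show "eliminate a p = 0" by (auto simp: dvd_def eliminate_simps eliminate_self[OF assms])
next
  assume "eliminate a p = 0"
  then show "linear_form a dvd p" using eliminate_cong[of a p] by simp
qed

lemma prime_elem_linear_form:
  assumes "a \<noteq> (\<lambda>_. 0)" shows "prime_elem (linear_form a)"
  unfolding prime_elem_def using assms
  by (auto simp: linear_form_dvd_iff eliminate_simps linear_form_eq_0_iff)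

lemma linear_form_dvd_linear_form:
  assumes "a \<noteq> (\<lambda>_. 0)" "linear_form a dvd linear_form b" shows "proportional a b"
proof -
  have "(\<lambda>i. b i - b (pivot a) / a (pivot a) * a i) = (\<lambda>_. 0)"
    using assms unfolding linear_form_dvd_iff[OF assms(1)] eliminate_linear_form linear_form_eq_0_iff
    by blast
  then have "b = (\<lambda>i. b (pivot a) / a (pivot a) * a i)"
    unfolding fun_eq_iff right_minus_eq .
  then show ?thesis unfolding proportional_def by blast
qed

lemma prime_elem_dvd_prodD:
  assumes "prime_elem (p :: poly3)" "p dvd prod g I" "finite I"
  shows "\<exists>i\<in>I. p dvd g i"
  using assms(3,2) by induction (use assms(1) in \<open>auto simp: prime_elem_def\<close>)

text \<open>Associated primes may be repeated among the \<open>L i\<close>, so that powers of different primes can be combined.\<close>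

lemma prod_primes_dvd:
  fixes L :: "'i \<Rightarrow> poly3"
  assumes "finite T" "\<And>i. i \<in> T \<Longrightarrow> prime_elem (L i)" "\<And>i. i \<in> T \<Longrightarrow> \<not> L i dvd P"
    and "P dvd G" "prod L T dvd G" "P \<noteq> 0"
  shows "P * prod L T dvd G"
  using assms(1,2,3,4,5)
proof (induction T arbitrary: G rule: finite_induct)
  case (insert i T)
  obtain p where p: "G = P * p" using insert.prems(3) by auto
  have pr: "prime_elem (L i)" and nd: "\<not> L i dvd P" using insert.prems by auto
  have "L i dvd P * p" using insert.prems(4) insert.hyps p by (auto dest: dvd_mult_left)
  then have "L i dvd p" using pr nd unfolding prime_elem_def by blast
  then obtain p' where p': "p = L i * p'" by (auto simp: dvd_def)
  have Li: "L i \<noteq> 0" using pr by (auto simp: prime_elem_def)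
  have "L i * prod L T dvd L i * (P * p')"
    using insert.prems(4) insert.hyps p p' by (simp add: mult.left_commute)
  then have "prod L T dvd P * p'" using Li by simp
  then have "P * prod L T dvd P * p'"
    using insert.prems by (intro insert.IH) auto
  then show ?case using insert.hyps p p' \<open>P \<noteq> 0\<close> Li by (simp add: mult.left_commute)
qed simp

lemma prod_linear_forms_dvd:
  assumes "finite T" "\<And>a. a \<in> T \<Longrightarrow> a \<noteq> (\<lambda>_. 0)" "\<And>a b. a \<in> T \<Longrightarrow> b \<in> T \<Longrightarrow> a \<noteq> b \<Longrightarrow> \<not> proportional a b"
    and "\<And>a. a \<in> T \<Longrightarrow> linear_form a dvd G"
  shows "prod linear_form T dvd G"
  using assms
proof (induction T rule: finite_induct)
  case (insert a T)
  have "prod linear_form T * prod linear_form {a} dvd G"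
  proof (rule prod_primes_dvd)
    fix i assume i: "i \<in> {a}"
    show "prime_elem (linear_form i)" using prime_elem_linear_form insert.prems i by auto
    show "\<not> linear_form i dvd prod linear_form T"
    proof
      assume "linear_form i dvd prod linear_form T"
      then obtain b where "b \<in> T" "linear_form i dvd linear_form b"
        using prime_elem_dvd_prodD[OF \<open>prime_elem (linear_form i)\<close>] insert.hyps(1) by blast
      then show False using linear_form_dvd_linear_form[of i b] insert i by auto
    qed
  qed (use insert in \<open>auto simp: linear_form_eq_0_iff\<close>)
  then show ?case using insert.hyps by (simp add: mult.commute)
qed simp

section \<open>Logarithmic derivations and their restriction to a line\<close>

text \<open>The value \<open>\<theta>(l\<^sub>a)\<close> of the derivation with coefficients \<open>\<theta>\<close> at the linear form of \<open>a\<close>; its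
  dependence on \<open>a\<close> is linear.\<close>

definition apply_form :: "(3 \<Rightarrow> poly3) \<Rightarrow> vec3 \<Rightarrow> poly3" where
  "apply_form \<theta> a = (\<Sum>i\<in>UNIV. const (a i) * \<theta> i)"

text \<open>The graded module of logarithmic derivations, usually written \<open>D(A)\<close>.\<close>

definition log_der :: "vec3 set \<Rightarrow> 3 family" where
  "log_der A k = {\<theta>. (\<forall>i. homogeneous k (\<theta> i)) \<and> (\<forall>a\<in>A. linear_form a dvd apply_form \<theta> a)}"

definition meet_pt :: "vec3 \<Rightarrow> vec3 \<Rightarrow> vec3 set" where
  "meet_pt h a = {w. \<exists>c. c \<noteq> 0 \<and> w = (\<lambda>i. c * cross h a i)}"

lemma arrangementD:
  assumes "line_arrangement A"
  shows "finite A" "a \<in> A \<Longrightarrow> a \<noteq> (\<lambda>_. 0)" "a \<in> A \<Longrightarrow> b \<in> A \<Longrightarrow> a \<noteq> b \<Longrightarrow> \<not> proportional a b"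
  using assms by (auto simp: line_arrangement_def proportional_def)

text \<open>Two lines meet \<open>h\<close> in the same point exactly if their forms agree on \<open>h\<close> up to a factor, that is,
  if the three lines belong to one pencil.\<close>

lemma meet_pt_eqD:
  assumes h: "h \<noteq> (\<lambda>_. 0)" and eq: "meet_pt h a = meet_pt h b"
  shows "\<exists>c d. c \<noteq> 0 \<and> b = (\<lambda>i. c * a i + d * h i)"
proof -
  have "cross h b \<in> meet_pt h b" unfolding meet_pt_def by (auto intro: exI[of _ 1])
  then obtain c where c: "c \<noteq> 0" "cross h b = (\<lambda>i. c * cross h a i)"
    using eq unfolding meet_pt_def by auto
  have "cross h (\<lambda>i. b i - c * a i) = (\<lambda>_. 0)"
    using c(2) by (simp add: vec3_eq_iff cross_3 algebra_simps)
  then obtain d where "(\<lambda>i. b i - c * a i) = (\<lambda>i. d * h i)"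
    using cross_eq_0[OF h] unfolding proportional_def by blast
  then have "b = (\<lambda>i. c * a i + d * h i)" by (auto simp: fun_eq_iff algebra_simps)
  then show ?thesis using c(1) by blast
qed

lemma meet_pt_eqI:
  assumes "c \<noteq> 0" "b = (\<lambda>i. c * a i + d * h i)" shows "meet_pt h a = meet_pt h b"
proof -
  have x: "cross h b = (\<lambda>i. c * cross h a i)"
    unfolding assms(2) by (simp add: vec3_eq_iff cross_3 algebra_simps)
  show ?thesis
  proof (intro Set.set_eqI iffI)
    fix w assume "w \<in> meet_pt h a"
    then obtain e where "e \<noteq> 0" "w = (\<lambda>i. e * cross h a i)" by (auto simp: meet_pt_def)
    then show "w \<in> meet_pt h b" unfolding meet_pt_def x using assms(1)
      by (intro CollectI exI[of _ "e / c"]) auto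
  next
    fix w assume "w \<in> meet_pt h b"
    then obtain e where "e \<noteq> 0" "w = (\<lambda>i. e * (c * cross h a i))" by (auto simp: meet_pt_def x)
    then show "w \<in> meet_pt h a" unfolding meet_pt_def using assms(1)
      by (intro CollectI exI[of _ "e * c"]) auto
  qed
qed

lemma apply_form_combination:
  "apply_form \<theta> (\<lambda>i. c * a i + d * b i) = const c * apply_form \<theta> a + const d * apply_form \<theta> b"
  by (simp add: apply_form_def sum_UNIV_3 const_simps algebra_simps)

text \<open>\<open>R\<close> chooses one line of \<open>A\<close> through each point in which \<open>h\<close> meets \<open>A\<close>.\<close>

definition transversal :: "vec3 \<Rightarrow> vec3 set \<Rightarrow> vec3 set \<Rightarrow> bool" where
  "transversal h A R \<longleftrightarrow> R \<subseteq> A \<and> inj_on (meet_pt h) R \<and> meet_pt h ` A = meet_pt h ` R"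

lemma transversal_exists: "\<exists>R. transversal h A R"
  using subset_image_inj[of "meet_pt h ` A" "meet_pt h" A] unfolding transversal_def by auto

text \<open>Let \<open>q\<close> be a point of \<open>h\<close>, let \<open>r\<close> be its line in \<open>R\<close> and let \<open>cls r\<close> be the lines of \<open>A\<close> through
  \<open>q\<close>. Their forms are combinations of \<open>l\<^sub>r\<close> and \<open>l\<^sub>h\<close>, so all of them divide the determinant
  \<open>l\<^sub>r \<theta>(l\<^sub>h) - l\<^sub>h \<theta>(l\<^sub>r)\<close>. Modulo \<open>l\<^sub>h\<close> this determinant is \<open>l\<^sub>r \<theta>(l\<^sub>h)\<close>; cancelling the factor \<open>l\<^sub>r\<close> leaves
  the divisor formed by the other lines of \<open>cls r\<close>. For different points these divisors are coprime
  modulo \<open>l\<^sub>h\<close>, and their product is the product over \<open>A - R\<close>.\<close>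

lemma restriction_divisible:
  assumes arr: "line_arrangement (insert h A)" "h \<notin> A" and R: "transversal h A R"
    and \<theta>: "\<And>a. a \<in> A \<Longrightarrow> linear_form a dvd apply_form \<theta> a"
  shows "\<exists>g. linear_form h dvd apply_form \<theta> h - prod linear_form (A - R) * g"
proof -
  define G where "G = apply_form \<theta> h"
  define cls where "cls r = {a \<in> A. meet_pt h a = meet_pt h r}" for r
  have fin: "finite A" using arrangementD(1)[OF arr(1)] by simp
  have RA: "R \<subseteq> A" "inj_on (meet_pt h) R" "meet_pt h ` A = meet_pt h ` R" using R by (auto simp: transversal_def)
  have h0: "h \<noteq> (\<lambda>_. 0)" using arrangementD(2)[OF arr(1), of h] by simp
  have np: "\<not> proportional h a" if "a \<in> A" for a
    using arrangementD(3)[OF arr(1), of h a] that arr(2) by auto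
  have el: "eliminate h (linear_form b) = const c * eliminate h (linear_form a)"
    if "b = (\<lambda>i. c * a i + d * h i)" for a b c d
    unfolding that linear_form_add by (simp add: eliminate_simps eliminate_self[OF h0])
  have el0: "eliminate h (linear_form a) \<noteq> 0" if "a \<in> A" for a
    using linear_form_dvd_iff[OF h0, of "linear_form a"] linear_form_dvd_linear_form[OF h0, of a] np[OF that] by blast
  have el_prime: "prime_elem (eliminate h (linear_form a))" if "a \<in> A" for a
    using el0[OF that] unfolding eliminate_linear_form linear_form_eq_0_iff by (rule prime_elem_linear_form)
  have el_dvd: "meet_pt h a = meet_pt h b" if "eliminate h (linear_form a) dvd eliminate h (linear_form b)" "a \<in> A" "b \<in> A" for a b
  proof -
    define p where "p c = (\<lambda>i. c i - c (pivot h) / h (pivot h) * h i)" for c :: vec3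
    have "proportional (p a) (p b)"
      using that(1) el0[OF that(2)] unfolding eliminate_linear_form linear_form_eq_0_iff p_def
      by (metis linear_form_dvd_linear_form)
    then obtain c where "p b = (\<lambda>i. c * p a i)" unfolding proportional_def by blast
    then have c: "p b i = c * p a i" for i by simp
    have b: "b = (\<lambda>i. c * a i + (b (pivot h) / h (pivot h) - c * a (pivot h) / h (pivot h)) * h i)" (is "_ = (\<lambda>i. _ + ?d * _)")
    proof
      fix i show "b i = c * a i + ?d * h i" using c[of i] unfolding p_def by (simp add: algebra_simps)
    qed
    have "c \<noteq> 0"
    proof
      assume "c = 0"
      then have "b = (\<lambda>i. ?d * h i)" using b by simp
      then show False using np[OF that(3)] unfolding proportional_def by blast
    qed
    then show ?thesis using meet_pt_eqI[OF _ b] by simp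
  qed
  have cls_dvd: "prod (\<lambda>a. eliminate h (linear_form a)) (cls r - {r}) dvd eliminate h G" if r: "r \<in> R" for r
  proof -
    have rA: "r \<in> A" using r RA by auto
    \<comment> \<open>Replacing \<open>r\<close> by another line \<open>a\<close> of the pencil changes this determinant only by a constant factor.\<close>
    define W where "W = linear_form r * G - linear_form h * apply_form \<theta> r"
    have "prod linear_form (cls r) dvd W"
    proof (rule prod_linear_forms_dvd)
      fix a assume a: "a \<in> cls r"
      then obtain c d where cd: "c \<noteq> 0" "a = (\<lambda>i. c * r i + d * h i)"
        using meet_pt_eqD[OF h0, of r a] by (auto simp: cls_def)
      have l: "linear_form a = const c * linear_form r + const d * linear_form h"
        "apply_form \<theta> a = const c * apply_form \<theta> r + const d * G"
        unfolding cd(2) linear_form_add apply_form_combination G_def by auto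
      have "const c * W = linear_form a * G - linear_form h * apply_form \<theta> a"
        unfolding l W_def by (simp add: algebra_simps)
      moreover have "linear_form a dvd apply_form \<theta> a" using \<theta> a by (simp add: cls_def)
      ultimately have "linear_form a dvd const (inverse c) * (const c * W)" by (simp add: dvd_diff)
      moreover have "const (inverse c) * (const c * W) = W"
        using const_inverse[of "inverse c" W] cd(1) by simp
      ultimately show "linear_form a dvd W" by simp
    next
      show "finite (cls r)" using fin by (simp add: cls_def)
    qed (use arrangementD[OF arr(1)] in \<open>auto simp: cls_def\<close>)
    then obtain q where "W = prod linear_form (cls r) * q" by (auto simp: dvd_def)
    then have "eliminate h W = prod (\<lambda>a. eliminate h (linear_form a)) (cls r) * eliminate h q"
      by (simp add: eliminate_simps eliminate_prod)
    moreover have "eliminate h W = eliminate h (linear_form r) * eliminate h G"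
      by (simp add: W_def eliminate_simps eliminate_self[OF h0])
    moreover have "prod (\<lambda>a. eliminate h (linear_form a)) (cls r)
      = eliminate h (linear_form r) * prod (\<lambda>a. eliminate h (linear_form a)) (cls r - {r})"
      using rA fin by (intro prod.remove) (auto simp: cls_def)
    ultimately have "eliminate h (linear_form r) * eliminate h G = eliminate h (linear_form r) *
       (prod (\<lambda>a. eliminate h (linear_form a)) (cls r - {r}) * eliminate h q)" by (simp add: mult.assoc)
    then show ?thesis using el0[OF rA] by simp
  qed
  have disj: "a \<notin> cls r'" if "a \<in> cls r" "r \<in> R" "r' \<in> R" "r \<noteq> r'" for a r r'
    using that RA(2) by (auto simp: cls_def inj_on_def)
  have "(\<Prod>r\<in>T. prod (\<lambda>a. eliminate h (linear_form a)) (cls r - {r})) dvd eliminate h G" if "T \<subseteq> R" for T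
  proof -
    have "finite T" using that RA fin by (meson finite_subset)
    then show ?thesis using that
    proof (induction T rule: finite_induct)
      case (insert r T)
      have "(\<Prod>r\<in>T. prod (\<lambda>a. eliminate h (linear_form a)) (cls r - {r})) *
         prod (\<lambda>a. eliminate h (linear_form a)) (cls r - {r}) dvd eliminate h G"
      proof (rule prod_primes_dvd)
        show "finite (cls r - {r})" using fin by (simp add: cls_def)
        show "prime_elem (eliminate h (linear_form a))" if "a \<in> cls r - {r}" for a
          using el_prime that by (simp add: cls_def)
        show "\<not> eliminate h (linear_form a) dvd (\<Prod>r\<in>T. prod (\<lambda>a. eliminate h (linear_form a)) (cls r - {r}))"
          if a: "a \<in> cls r - {r}" for a
        proof
          have pr: "prime_elem (eliminate h (linear_form a))" using el_prime a by (simp add: cls_def)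
          assume "eliminate h (linear_form a) dvd (\<Prod>r\<in>T. prod (\<lambda>a. eliminate h (linear_form a)) (cls r - {r}))"
          then obtain r' where r': "r' \<in> T" "eliminate h (linear_form a) dvd prod (\<lambda>a. eliminate h (linear_form a)) (cls r' - {r'})"
            using prime_elem_dvd_prodD[OF pr _ insert.hyps(1)] by blast
          moreover have "finite (cls r' - {r'})" using fin by (simp add: cls_def)
          ultimately obtain b where b: "b \<in> cls r'" "eliminate h (linear_form a) dvd eliminate h (linear_form b)"
            using prime_elem_dvd_prodD[OF pr] by blast
          then have "meet_pt h a = meet_pt h b" using el_dvd a by (auto simp: cls_def)
          then have "a \<in> cls r'" using a b by (auto simp: cls_def)
          then show False using disj[of a r r'] a r' insert by auto
        qed
        show "(\<Prod>r\<in>T. prod (\<lambda>a. eliminate h (linear_form a)) (cls r - {r})) dvd eliminate h G"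
          using insert by auto
        show "prod (\<lambda>a. eliminate h (linear_form a)) (cls r - {r}) dvd eliminate h G"
          using cls_dvd insert.prems by auto
        show "(\<Prod>r\<in>T. prod (\<lambda>a. eliminate h (linear_form a)) (cls r - {r})) \<noteq> 0"
          using insert.hyps(1) fin el0 by (auto simp: cls_def)
      qed
      then show ?case using insert.hyps by (simp add: mult.commute)
    qed simp
  qed
  from this[of R] have "(\<Prod>r\<in>R. prod (\<lambda>a. eliminate h (linear_form a)) (cls r - {r})) dvd eliminate h G" by simp
  also have "(\<Prod>r\<in>R. prod (\<lambda>a. eliminate h (linear_form a)) (cls r - {r}))
      = prod (\<lambda>a. eliminate h (linear_form a)) (\<Union>r\<in>R. cls r - {r})"
    using fin RA disj by (intro prod.UNION_disjoint[symmetric]) (auto simp: cls_def finite_subset)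
  also have "(\<Union>r\<in>R. cls r - {r}) = A - R"
  proof (intro Set.set_eqI iffI)
    fix a assume "a \<in> (\<Union>r\<in>R. cls r - {r})"
    then show "a \<in> A - R" using RA by (auto simp: cls_def inj_on_def)
  next
    fix a assume a: "a \<in> A - R"
    then obtain r where "r \<in> R" "meet_pt h a = meet_pt h r" using RA(3) by (metis DiffD1 imageE imageI)
    then show "a \<in> (\<Union>r\<in>R. cls r - {r})" using a by (auto simp: cls_def)
  qed
  finally obtain p where p: "eliminate h G = prod (\<lambda>a. eliminate h (linear_form a)) (A - R) * p" by (auto simp: dvd_def)
  define g where "g = p"
  have dv: "linear_form h dvd eliminate h p - p" for p by (rule eliminate_cong)
  have e1: "linear_form h dvd eliminate h (prod linear_form (A - R)) - prod linear_form (A - R)" by (rule dv)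
  have "G - prod linear_form (A - R) * g = (eliminate h (prod linear_form (A - R)) - prod linear_form (A - R)) * p - (eliminate h G - G)"
    unfolding p by (simp add: g_def eliminate_prod algebra_simps)
  then have "linear_form h dvd G - prod linear_form (A - R) * g"
    using e1 dv[of G] by (metis dvd_diff dvd_mult2)
  then show ?thesis unfolding G_def by blast
qed

text \<open>If the determinant vanishes, Cramer's rule writes \<open>b\<close> as a combination of \<open>a\<close> and \<open>h\<close>, and then \<open>a\<close>
  and \<open>b\<close> meet \<open>h\<close> in the same point.\<close>

lemma det_nonzero:
  assumes h: "h \<noteq> (\<lambda>_. 0)" and a: "\<not> proportional h a" and b: "\<not> proportional h b" and ne: "meet_pt h a \<noteq> meet_pt h b"
  shows "dot h (cross a b) \<noteq> 0"
proof
  assume 0: "dot h (cross a b) = 0"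
  obtain w where w: "dot w (cross h a) \<noteq> 0"
    using dot_nonzero_ex[of "cross h a"] cross_eq_0[OF h] a by (metis (mono_tags, lifting) dot_def mult.commute sum.cong)
  have e: "dot w (cross h a) * b i = - (dot w (cross a b) * h i + dot w (cross b h) * a i)" for i
    using cramer[of h a b w i] 0 by (simp add: algebra_simps eq_neg_iff_add_eq_0)
  have bw: "b = (\<lambda>i. (- dot w (cross b h) / dot w (cross h a)) * a i + (- dot w (cross a b) / dot w (cross h a)) * h i)" (is "_ = (\<lambda>i. ?c * _ + ?d * _)")
  proof
    fix i
    have "b i = - (dot w (cross a b) * h i + dot w (cross b h) * a i) / dot w (cross h a)"
      using e[of i] w by (simp add: field_simps)
    then show "b i = ?c * a i + ?d * h i" by (simp add: add_divide_distrib diff_divide_distrib)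
  qed
  show False
  proof (cases "?c = 0")
    case True
    then have "b = (\<lambda>i. ?d * h i)" using bw by (metis (no_types, lifting) add_0 mult_zero_left)
    then show False using b unfolding proportional_def by blast
  next
    case False
    then show False using meet_pt_eqI[OF False bw] ne by simp
  qed
qed

lemma apply_form_const: "apply_form (\<lambda>i. const (v i) * p) a = const (dot a v) * p"
  by (simp add: apply_form_def sum_UNIV_3 dot_3 const_simps algebra_simps)

text \<open>Up to two lines that meet \<open>h\<close> in different points have a common point away from \<open>h\<close>.\<close>

lemma separating_vector:
  assumes h: "h \<noteq> (\<lambda>_. 0)" and R: "finite R" "card R \<le> 2" "\<And>r. r \<in> R \<Longrightarrow> \<not> proportional h r" "inj_on (meet_pt h) R"
  shows "\<exists>v. dot h v = 1 \<and> (\<forall>r\<in>R. dot r v = 0)"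
proof -
  have "\<exists>v. dot h v \<noteq> 0 \<and> (\<forall>r\<in>R. dot r v = 0)"
  proof -
    consider "card R = 0" | "card R = 1" | "card R = 2" using R(2) by linarith
    then show ?thesis
    proof cases
      case 1
      then show ?thesis using dot_nonzero_ex[OF h] R(1) by auto
    next
      case 2
      then obtain r where r: "R = {r}" by (meson card_1_singletonE)
      obtain w where w: "dot w (cross h r) \<noteq> 0"
        using dot_nonzero_ex[of "cross h r"] cross_eq_0[OF h] R(3)[of r] r by (metis (mono_tags, lifting) dot_def insertI1 mult.commute sum.cong)
      have "dot h (cross r w) = dot w (cross h r)" by (simp add: dot_3 cross_3 algebra_simps)
      then show ?thesis using w r by (intro exI[of _ "cross r w"]) auto
    next
      case 3
      then obtain r s where rs: "R = {r, s}" "r \<noteq> s" by (meson card_2_iff)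
      then have "dot h (cross r s) \<noteq> 0"
        using det_nonzero[OF h] R(3)[of r] R(3)[of s] R(4) by (auto simp: inj_on_def)
      then show ?thesis using rs by (intro exI[of _ "cross r s"]) auto
    qed
  qed
  then obtain v where v: "dot h v \<noteq> 0" "\<forall>r\<in>R. dot r v = 0" by blast
  have "dot a (\<lambda>i. v i / dot h v) = dot a v / dot h v" for a by (simp add: dot_3 add_divide_distrib)
  then show ?thesis using v by (intro exI[of _ "\<lambda>i. v i / dot h v"]) auto
qed

text \<open>The three forms are a basis of the linear forms, so Euler's formula
  \<open>e g = \<Sum>\<^sub>i x\<^sub>i \<partial>\<^sub>i g\<close> can be rewritten in terms of them; the vectors \<open>c1\<close>, \<open>c2\<close>, \<open>c3\<close> are the rows of the
  cofactor matrix.\<close>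

lemma split_by_basis:
  assumes D: "dot h (cross a b) \<noteq> 0" and g: "homogeneous e g" "e \<ge> 1"
  shows "\<exists>g1 g2 g3. homogeneous (e - 1) g1 \<and> homogeneous (e - 1) g2 \<and> homogeneous (e - 1) g3 \<and>
    g = linear_form h * g1 + linear_form a * g2 + linear_form b * g3"
proof -
  define D where "D = dot h (cross a b)"
  define c1 where "c1 = cross a b" define c2 where "c2 = cross b h" define c3 where "c3 = cross h a"
  define u where "u i = const (inverse (of_int e * D)) * partial_deriv i g" for i
  have u: "homogeneous (e - 1) (u i)" for i
    unfolding u_def by (intro homogeneous_const_mult homogeneous_partial_deriv g)
  define g1 where "g1 = (\<Sum>i\<in>UNIV. const (c1 i) * u i)"
  define g2 where "g2 = (\<Sum>i\<in>UNIV. const (c2 i) * u i)"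
  define g3 where "g3 = (\<Sum>i\<in>UNIV. const (c3 i) * u i)"
  have hg: "homogeneous (e - 1) g1" "homogeneous (e - 1) g2" "homogeneous (e - 1) g3"
    unfolding g1_def g2_def g3_def by (intro homogeneous_sum homogeneous_const_mult u)+
  have Dv: "D * (if i = j then 1 else 0) = c1 j * h i + c2 j * a i + c3 j * b i" for i j
  proof -
    have s: "dot (\<lambda>i. if i = j then 1 else 0) v = v j" for v
      by (simp add: dot_def if_distrib[of "\<lambda>x. x * _"] cong: if_cong)
    show ?thesis using cramer[of h a b "\<lambda>i. if i = j then 1 else 0" i] unfolding s D_def c1_def c2_def c3_def by simp
  qed
  have "linear_form h * g1 + linear_form a * g2 + linear_form b * g3
     = (\<Sum>i\<in>UNIV. \<Sum>j\<in>UNIV. const (c1 j * h i + c2 j * a i + c3 j * b i) * (var i * u j))"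
    unfolding linear_form_eq g1_def g2_def g3_def sum_product
    by (simp add: const_simps algebra_simps sum.distrib)
  also have "\<dots> = (\<Sum>i\<in>UNIV. \<Sum>j\<in>UNIV. if j = i then const D * (var i * u j) else 0)"
    unfolding Dv[symmetric] by (intro sum.cong refl) (auto simp: const_simps)
  also have "\<dots> = const D * (\<Sum>i\<in>UNIV. var i * u i)"
    by (simp add: sum_distrib_left)
  also have "(\<Sum>i\<in>UNIV. var i * u i) = const (inverse (of_int e * D)) * (of_int e * g)"
    unfolding euler_formula[OF g(1), symmetric] u_def by (simp add: sum_distrib_left algebra_simps)
  also have "const D * (const (inverse (of_int e * D)) * (of_int e * g)) = const (D * inverse (of_int e * D) * of_int e) * g"
    by (simp add: const_simps const_of_int algebra_simps)
  also have "D * inverse (of_int e * D) * of_int e = 1"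
    using g(2) D by (simp add: D_def field_simps)
  finally have "g = linear_form h * g1 + linear_form a * g2 + linear_form b * g3" by (simp add: const_simps)
  then show ?thesis using hg by blast
qed

text \<open>If \<open>R\<close> has at most two elements, there is a constant vector field \<open>v\<close> that kills the forms of \<open>R\<close>
  and takes the value \<open>1\<close> at \<open>l\<^sub>h\<close>. Its product with \<open>g\<close> and the forms of \<open>A - R\<close> is logarithmic and
  restricts to the desired element. Otherwise the forms of two lines \<open>a\<close>, \<open>b\<close> of \<open>R\<close> and of \<open>h\<close> span all
  linear forms, so that \<open>g\<close> splits modulo \<open>l\<^sub>h\<close> into a multiple of \<open>l\<^sub>a\<close> and one of \<open>l\<^sub>b\<close>, and these
  are handled by \<open>R - {a}\<close> and \<open>R - {b}\<close>. The bound on \<open>e\<close> guarantees a positive degree whenever a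
  splitting is needed.\<close>

lemma restriction_surjective:
  assumes arr: "line_arrangement (insert h A)" "h \<notin> A"
    and R: "R \<subseteq> A" "inj_on (meet_pt h) R" and g: "homogeneous e g" "e \<ge> int (card R) - 2"
  shows "\<exists>\<theta>\<in>log_der A (e + int (card (A - R))). linear_form h dvd prod linear_form (A - R) * g - apply_form \<theta> h"
  using R g
proof (induction "card R" arbitrary: R e g rule: less_induct)
  case less
  have fin: "finite A" using arrangementD(1)[OF arr(1)] by simp
  have finR: "finite R" using less.prems fin by (meson finite_subset)
  have h0: "h \<noteq> (\<lambda>_. 0)" using arrangementD(2)[OF arr(1), of h] by simp
  have np: "\<not> proportional h a" if "a \<in> A" for a
    using arrangementD(3)[OF arr(1), of h a] that arr(2) by auto
  show ?case
  proof (cases "card R \<le> 2")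
    case True
    then obtain v where v: "dot h v = 1" "\<forall>r\<in>R. dot r v = 0"
      using separating_vector[OF h0 finR] np less.prems by blast
    define \<theta> where "\<theta> = (\<lambda>i. const (v i) * (prod linear_form (A - R) * g))"
    have ap: "apply_form \<theta> a = const (dot a v) * (prod linear_form (A - R) * g)" for a
      unfolding \<theta>_def by (rule apply_form_const)
    have "linear_form a dvd apply_form \<theta> a" if "a \<in> A" for a
    proof (cases "a \<in> R")
      case False
      then have "linear_form a dvd prod linear_form (A - R)" using that fin by (intro dvd_prodI) auto
      then show ?thesis unfolding ap by simp
    qed (use v ap in \<open>simp add: const_simps\<close>)
    moreover have "homogeneous (e + int (card (A - R))) (\<theta> i)" for i
      unfolding \<theta>_def
      by (intro homogeneous_const_mult homogeneous_mult'[OF homogeneous_prod less.prems(3)]) auto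
    ultimately show ?thesis
      by (intro bexI[of _ \<theta>]) (auto simp: log_der_def ap v const_simps)
  next
    case False
    then have c3: "card R \<ge> 3" by simp
    then obtain a b where ab: "a \<in> R" "b \<in> R" "a \<noteq> b"
      using card_le_Suc0_iff_eq[OF finR] by fastforce
    have "dot h (cross a b) \<noteq> 0"
      using ab less.prems(1,2) by (intro det_nonzero[OF h0 np np]) (auto simp: inj_on_def)
    then obtain g1 g2 g3 where gs: "homogeneous (e - 1) g1" "homogeneous (e - 1) g2" "homogeneous (e - 1) g3"
      "g = linear_form h * g1 + linear_form a * g2 + linear_form b * g3"
      using split_by_basis[of h a b e g] less.prems(3,4) c3 by force
    have step: "\<exists>\<theta>\<in>log_der A (e + int (card (A - R))). linear_form h dvd prod linear_form (A - R) * (linear_form r * q) - apply_form \<theta> h"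
      if r: "r \<in> R" and q: "homogeneous (e - 1) q" for r q
    proof -
      have c: "card (R - {r}) = card R - 1" using r finR by simp
      have "\<exists>\<theta>\<in>log_der A ((e - 1) + int (card (A - (R - {r})))). linear_form h dvd prod linear_form (A - (R - {r})) * q - apply_form \<theta> h"
        using c c3 less.prems by (intro less.hyps q) (auto intro: inj_on_subset)
      moreover have s: "A - (R - {r}) = insert r (A - R)" using r less.prems(1) by auto
      moreover have "r \<notin> A - R" "finite (A - R)" using r fin by auto
      ultimately show ?thesis by (simp add: algebra_simps)
    qed
    obtain \<theta>2 where t2: "\<theta>2 \<in> log_der A (e + int (card (A - R)))" "linear_form h dvd prod linear_form (A - R) * (linear_form a * g2) - apply_form \<theta>2 h"
      using step ab gs by blast
    obtain \<theta>3 where t3: "\<theta>3 \<in> log_der A (e + int (card (A - R)))" "linear_form h dvd prod linear_form (A - R) * (linear_form b * g3) - apply_form \<theta>3 h"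
      using step ab gs by blast
    have ap: "apply_form (\<theta>2 + \<theta>3) c = apply_form \<theta>2 c + apply_form \<theta>3 c" for c
      by (simp add: apply_form_def algebra_simps sum.distrib)
    have "\<theta>2 + \<theta>3 \<in> log_der A (e + int (card (A - R)))"
      using t2(1) t3(1) by (auto simp: log_der_def ap intro: homogeneous_add)
    moreover have "prod linear_form (A - R) * g - apply_form (\<theta>2 + \<theta>3) h =
       linear_form h * (prod linear_form (A - R) * g1) +
       ((prod linear_form (A - R) * (linear_form a * g2) - apply_form \<theta>2 h) + (prod linear_form (A - R) * (linear_form b * g3) - apply_form \<theta>3 h))"
      unfolding ap gs(4) by (simp add: algebra_simps)
    then have "linear_form h dvd prod linear_form (A - R) * g - apply_form (\<theta>2 + \<theta>3) h"
      using t2(2) t3(2) by (metis dvd_add dvd_triv_left)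
    ultimately show ?thesis by blast
  qed
qed

section \<open>Isomorphisms of subquotients\<close>

text \<open>\<open>\<phi>\<close> induces an isomorphism \<open>L/K \<cong> N/Z\<close> that raises degrees by \<open>s\<close>.\<close>

definition quotient_iso :: "int \<Rightarrow> (('k \<Rightarrow> poly3) \<Rightarrow> ('m \<Rightarrow> poly3)) \<Rightarrow> 'k family \<Rightarrow> 'k family \<Rightarrow> 'm family \<Rightarrow> 'm family \<Rightarrow> bool" where
  "quotient_iso s \<phi> L K N Z \<longleftrightarrow> slinear \<phi> \<and> graded_submodule L \<and> graded_submodule Z \<and>
     (\<forall>k. \<forall>u\<in>L k. \<phi> u \<in> N (k + s)) \<and>
     (\<forall>k. \<forall>v\<in>N (k + s). \<exists>u\<in>L k. v - \<phi> u \<in> Z (k + s)) \<and>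
     (\<forall>k. \<forall>u\<in>L k. \<phi> u \<in> Z (k + s) \<longleftrightarrow> u \<in> K k)"

lemma quotient_isoI:
  assumes "slinear \<phi>" "graded_submodule L" "graded_submodule Z"
    "\<And>k u. u \<in> L k \<Longrightarrow> \<phi> u \<in> N (k + s)"
    "\<And>k v. v \<in> N (k + s) \<Longrightarrow> \<exists>u\<in>L k. v - \<phi> u \<in> Z (k + s)"
    "\<And>k u. u \<in> L k \<Longrightarrow> \<phi> u \<in> Z (k + s) \<longleftrightarrow> u \<in> K k"
  shows "quotient_iso s \<phi> L K N Z"
  using assms by (simp add: quotient_iso_def)

lemma regular_iso:
  assumes "quotient_iso s \<phi> L K N Z"
  shows "regular r L K \<longleftrightarrow> regular (r + s) N Z"
  using assms unfolding quotient_iso_def by (intro regular_transfer[of \<phi>]) auto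

text \<open>The ring \<open>S\<close> as a module over itself; the index type \<open>unit\<close> fits it into the general setting.\<close>

definition polys :: "unit family" where "polys = free UNIV (\<lambda>_. 0)"

definition multiples :: "poly3 \<Rightarrow> unit family" where
  "multiples p k = {v. homogeneous k (v ()) \<and> p dvd v ()}"

lemma polys_iff: "v \<in> polys k \<longleftrightarrow> homogeneous k (v ())"
  by (simp add: polys_def free_def)

lemma gs_polys: "graded_submodule polys"
  unfolding polys_def by (rule gs_free)

lemma gs_multiples: "graded_submodule (multiples p)"
  by (rule graded_submoduleI) (auto simp: multiples_def intro: homogeneous_diff homogeneous_mult' dvd_diff)

lemma slinear_smul: "slinear (\<lambda>v. p \<cdot> v)"
  by (simp add: slinear_def smul_simps) (simp add: smul_def mult.commute)

lemma slinear_id: "slinear (\<lambda>v. v)"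
  by (simp add: slinear_def)

lemma unit_fun_eq: "(v :: unit \<Rightarrow> 'a) = w \<longleftrightarrow> v () = w ()"
  by (simp add: fun_eq_iff)

lemma homogeneous_dvd:
  assumes "homogeneous c p" "homogeneous k q" "p dvd q"
  shows "\<exists>g. homogeneous (k - c) g \<and> q = p * g"
proof -
  obtain g where g: "q = p * g" using assms(3) by (auto simp: dvd_def)
  have "q = hcomp k q" using hcomp_homogeneous[OF assms(2)] by simp
  also have "\<dots> = p * hcomp (k - c) g" unfolding g by (rule hcomp_mult[OF assms(1)])
  finally show ?thesis by (intro exI[of _ "hcomp (k - c) g"]) simp
qed

lemma multiples_iso:
  assumes "homogeneous c p" "p \<noteq> 0"
  shows "quotient_iso c (\<lambda>v. p \<cdot> v) polys (\<lambda>_. {0}) (multiples p) (\<lambda>_. {0})"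
proof (rule quotient_isoI)
  fix k and v :: "unit \<Rightarrow> poly3" assume "v \<in> multiples p (k + c)"
  then obtain g where "homogeneous k g" "v () = p * g"
    using homogeneous_dvd[OF assms(1), of "k + c" "v ()"] by (auto simp: multiples_def)
  then show "\<exists>u\<in>polys k. v - p \<cdot> u \<in> {0}"
    by (intro bexI[of _ "\<lambda>_. g"]) (auto simp: polys_iff unit_fun_eq)
qed (use assms in \<open>auto simp: slinear_smul gs_polys gs_zero multiples_def polys_iff unit_fun_eq
    intro: homogeneous_mult'\<close>)

lemma regular_polys: "r \<ge> 0 \<Longrightarrow> regular r polys (\<lambda>_. {0})"
  unfolding polys_def by (intro regular_free)

lemma regular_multiples:
  assumes "homogeneous c p" "p \<noteq> 0" "r \<ge> c"
  shows "regular r (multiples p) (\<lambda>_. {0})"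
  using regular_iso[OF multiples_iso[OF assms(1,2)], of "r - c"] regular_polys[of "r - c"] assms(3) by simp

section \<open>The effect of a new line on regularity\<close>

lemma slinear_apply_form: "slinear (\<lambda>\<theta>. (\<lambda>_ :: unit. apply_form \<theta> a))"
  by (auto simp: slinear_def apply_form_def fun_eq_iff algebra_simps sum.distrib sum_distrib_left)

lemma apply_form_simps: "apply_form 0 a = 0" "apply_form (u - v) a = apply_form u a - apply_form v a"
  "apply_form (u + v) a = apply_form u a + apply_form v a" "apply_form (p \<cdot> u) a = p * apply_form u a"
  by (auto simp: apply_form_def sum_UNIV_3 algebra_simps)

lemma homogeneous_apply_form: "(\<And>i. homogeneous k (\<theta> i)) \<Longrightarrow> homogeneous k (apply_form \<theta> a)"
  unfolding apply_form_def by (intro homogeneous_sum homogeneous_const_mult)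

lemma gs_log_der: "graded_submodule (log_der A)"
  by (rule graded_submoduleI)
    (auto simp: log_der_def apply_form_simps intro: homogeneous_diff homogeneous_mult' dvd_diff)

lemma log_der_mono: "A \<subseteq> B \<Longrightarrow> log_der B k \<subseteq> log_der A k"
  by (auto simp: log_der_def)

lemma log_der_empty: "log_der {} = free UNIV (\<lambda>_. 0)"
  by (auto simp: log_der_def free_def fun_eq_iff)

text \<open>The preimage in \<open>S\<close> of the restrictions of \<open>D(A)\<close> to the line \<open>h\<close>.\<close>

definition restricted :: "vec3 \<Rightarrow> vec3 set \<Rightarrow> unit family" where
  "restricted h A k = {v. homogeneous k (v ()) \<and> (\<exists>\<theta>\<in>log_der A k. linear_form h dvd v () - apply_form \<theta> h)}"

text \<open>The homogeneous elements of the ideal generated by \<open>b\<close> and \<open>l\<close>.\<close>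

definition multiples_mod :: "poly3 \<Rightarrow> poly3 \<Rightarrow> unit family" where
  "multiples_mod b l k = {v. homogeneous k (v ()) \<and> (\<exists>g. l dvd v () - b * g)}"

text \<open>The isomorphism theorem \<open>(b, l)/(l) \<cong> (b)/(bl)\<close>, where \<open>(b) \<inter> (l) = (bl)\<close> because \<open>l\<close> is
  prime and does not divide \<open>b\<close>. It makes \<open>(b, l)/(l)\<close> a quotient of free modules of rank one.\<close>

lemma multiples_mod_iso:
  assumes b: "homogeneous c b" and l: "homogeneous e l" "prime_elem l" "\<not> l dvd b"
  shows "quotient_iso 0 (\<lambda>v. v) (multiples b) (multiples (b * l)) (multiples_mod b l) (multiples l)"
proof (rule quotient_isoI)
  fix k and v :: "unit \<Rightarrow> poly3" assume v: "v \<in> multiples_mod b l (k + 0)"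
  then obtain g where g: "homogeneous k (v ())" "l dvd v () - b * g" by (auto simp: multiples_mod_def)
  then obtain q where q: "v () - b * g = l * q" by (auto simp: dvd_def)
  have "v () - b * hcomp (k - c) g = hcomp k (v () - b * g)"
    using hcomp_homogeneous[OF g(1)] by (simp add: hcomp_diff hcomp_mult[OF b])
  also have "\<dots> = l * hcomp (k - e) q" unfolding q by (rule hcomp_mult[OF l(1)])
  finally have "v () - b * hcomp (k - c) g = l * hcomp (k - e) q" .
  moreover have "homogeneous k (b * hcomp (k - c) g)"
    by (rule homogeneous_mult'[OF b homogeneous_hcomp]) simp
  moreover have "homogeneous k (v () - b * hcomp (k - c) g)"
    using g(1) \<open>homogeneous k (b * hcomp (k - c) g)\<close> by (rule homogeneous_diff)
  ultimately show "\<exists>u\<in>multiples b k. v - u \<in> multiples l (k + 0)"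
    by (intro bexI[of _ "\<lambda>_. b * hcomp (k - c) g"]) (auto simp: multiples_def)
next
  fix k and u :: "unit \<Rightarrow> poly3" assume "u \<in> multiples b k"
  then obtain g where g: "homogeneous k (u ())" "u () = b * g" by (auto simp: multiples_def dvd_def)
  have "l dvd b * g \<longleftrightarrow> b * l dvd b * g"
  proof
    assume "l dvd b * g"
    then have "l dvd g" using l(2,3) unfolding prime_elem_def by blast
    then show "b * l dvd b * g" by (simp add: mult_dvd_mono)
  qed (metis dvd_mult_right)
  then show "u \<in> multiples l (k + 0) \<longleftrightarrow> u \<in> multiples (b * l) k" using g by (simp add: multiples_def)
next
  fix k and u :: "unit \<Rightarrow> poly3" assume "u \<in> multiples b k"
  then obtain g where "homogeneous k (u ())" "u () = b * g" by (auto simp: multiples_def dvd_def)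
  then show "u \<in> multiples_mod b l (k + 0)" by (auto simp: multiples_mod_def intro!: exI[of _ g])
qed (rule slinear_id gs_multiples)+

text \<open>By definition \<open>D(A \<union> {h})\<close> is the kernel of the restriction of \<open>D(A)\<close> to \<open>h\<close>.\<close>

lemma restriction_iso:
  assumes "h \<noteq> (\<lambda>_. 0)"
  shows "quotient_iso 0 (\<lambda>\<theta> _. apply_form \<theta> h) (log_der A) (log_der (insert h A)) (restricted h A) (multiples (linear_form h))"
proof (rule quotient_isoI)
  fix k and v :: "unit \<Rightarrow> poly3" assume v: "v \<in> restricted h A (k + 0)"
  then obtain \<theta> where \<theta>: "\<theta> \<in> log_der A k" "linear_form h dvd v () - apply_form \<theta> h" "homogeneous k (v ())"
    by (auto simp: restricted_def)
  moreover have "homogeneous k (apply_form \<theta> h)" using \<theta>(1) by (auto simp: log_der_def intro: homogeneous_apply_form)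
  ultimately show "\<exists>u\<in>log_der A k. v - (\<lambda>_. apply_form u h) \<in> multiples (linear_form h) (k + 0)"
    by (intro bexI[of _ \<theta>]) (auto simp: multiples_def intro: homogeneous_diff)
next
  fix k u assume "u \<in> log_der A k"
  then show "(\<lambda>_. apply_form u h) \<in> restricted h A (k + 0)"
    by (auto simp: restricted_def log_der_def intro: homogeneous_apply_form intro!: exI[of _ u])
qed (auto simp: slinear_apply_form gs_log_der gs_multiples multiples_def log_der_def
    intro: homogeneous_apply_form)

lemma gs_multiples_mod: "graded_submodule (multiples_mod b l)"
proof (rule graded_submoduleI)
  fix k u v assume "u \<in> multiples_mod b l k" "v \<in> multiples_mod b l k"
  then obtain g g' where g: "homogeneous k (u ())" "homogeneous k (v ())" "l dvd u () - b * g" "l dvd v () - b * g'"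
    by (auto simp: multiples_mod_def)
  have "(u () - v ()) - b * (g - g') = (u () - b * g) - (v () - b * g')" by (simp add: algebra_simps)
  then have "l dvd (u () - v ()) - b * (g - g')" using g by (simp only: dvd_diff)
  then show "u - v \<in> multiples_mod b l k" using g by (auto simp: multiples_mod_def intro: homogeneous_diff)
next
  fix k p c u assume "u \<in> multiples_mod b l k" and p: "homogeneous c p"
  then obtain g where g: "homogeneous k (u ())" "l dvd u () - b * g" by (auto simp: multiples_mod_def)
  have "p * u () - b * (p * g) = p * (u () - b * g)" by (simp add: algebra_simps)
  then have "l dvd p * u () - b * (p * g)" using g by (simp only: dvd_mult)
  then show "p \<cdot> u \<in> multiples_mod b l (k + c)"
    using homogeneous_mult'[OF p g(1), of "k + c"] by (auto simp: multiples_mod_def)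
qed (auto simp: multiples_mod_def intro: exI[of _ 0])

lemma gs_restricted: "graded_submodule (restricted h A)"
proof (rule graded_submoduleI)
  fix k u v assume "u \<in> restricted h A k" "v \<in> restricted h A k"
  then obtain g g' where g: "homogeneous k (u ())" "homogeneous k (v ())" "g \<in> log_der A k" "g' \<in> log_der A k"
     "linear_form h dvd u () - apply_form g h" "linear_form h dvd v () - apply_form g' h"
    by (auto simp: restricted_def)
  have "(u () - v ()) - apply_form (g - g') h = (u () - apply_form g h) - (v () - apply_form g' h)"
    by (simp add: apply_form_simps)
  then have "linear_form h dvd (u () - v ()) - apply_form (g - g') h" using g by (simp only: dvd_diff)
  then show "u - v \<in> restricted h A k" using g gs_diff[OF gs_log_der g(3,4)]
    by (auto simp: restricted_def intro: homogeneous_diff)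
next
  fix k p c u assume "u \<in> restricted h A k" and p: "homogeneous c p"
  then obtain g where g: "homogeneous k (u ())" "g \<in> log_der A k" "linear_form h dvd u () - apply_form g h"
    by (auto simp: restricted_def)
  have "p * u () - apply_form (p \<cdot> g) h = p * (u () - apply_form g h)" by (simp add: apply_form_simps algebra_simps)
  then have "linear_form h dvd p * u () - apply_form (p \<cdot> g) h" using g by (simp only: dvd_mult)
  then show "p \<cdot> u \<in> restricted h A (k + c)"
    using homogeneous_mult'[OF p g(1), of "k + c"] gs_smul[OF gs_log_der g(2) p] by (auto simp: restricted_def)
qed (auto simp: restricted_def intro!: bexI[of _ 0] simp: apply_form_simps gs_0[OF gs_log_der])

lemma
  assumes arr: "line_arrangement (insert h A)" "h \<notin> A" and R: "transversal h A R"
  shows restricted_subset: "restricted h A k \<subseteq> multiples_mod (prod linear_form (A - R)) (linear_form h) k"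
    and restricted_eq: "k \<ge> int (card A) - 2 \<Longrightarrow>
      restricted h A k = multiples_mod (prod linear_form (A - R)) (linear_form h) k"
proof -
  show sub: "restricted h A k \<subseteq> multiples_mod (prod linear_form (A - R)) (linear_form h) k"
  proof
    fix v assume "v \<in> restricted h A k"
    then obtain \<theta> where \<theta>: "homogeneous k (v ())" "\<theta> \<in> log_der A k" "linear_form h dvd v () - apply_form \<theta> h"
      by (auto simp: restricted_def)
    obtain g where g: "linear_form h dvd apply_form \<theta> h - prod linear_form (A - R) * g"
      using restriction_divisible[OF arr R, of \<theta>] \<theta>(2) by (auto simp: log_der_def)
    have "v () - prod linear_form (A - R) * g = (v () - apply_form \<theta> h) + (apply_form \<theta> h - prod linear_form (A - R) * g)"
      by simp
    then have "linear_form h dvd v () - prod linear_form (A - R) * g" using \<theta>(3) g by (metis dvd_add)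
    then show "v \<in> multiples_mod (prod linear_form (A - R)) (linear_form h) k"
      using \<theta>(1) by (auto simp: multiples_mod_def)
  qed
  assume k: "k \<ge> int (card A) - 2"
  have fin: "finite A" using arrangementD(1)[OF arr(1)] by simp
  have RA: "R \<subseteq> A" "inj_on (meet_pt h) R" using R by (auto simp: transversal_def)
  then have finR: "finite R" using fin by (meson finite_subset)
  define b where "b = prod linear_form (A - R)"
  define c where "c = int (card (A - R))"
  have cc: "c + int (card R) = int (card A)"
    unfolding c_def using RA fin finR by (simp add: card_Diff_subset card_mono)
  have b: "homogeneous c b" unfolding b_def c_def by (intro homogeneous_prod) auto
  show "restricted h A k = multiples_mod (prod linear_form (A - R)) (linear_form h) k"
  proof (rule equalityI[OF sub subsetI])
    fix v assume "v \<in> multiples_mod (prod linear_form (A - R)) (linear_form h) k"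
    then obtain g q where g: "homogeneous k (v ())" "v () - b * g = linear_form h * q"
      by (auto simp: multiples_mod_def b_def dvd_def)
    have "v () - b * hcomp (k - c) g = hcomp k (v () - b * g)"
      using hcomp_homogeneous[OF g(1)] by (simp add: hcomp_diff hcomp_mult[OF b])
    also have "\<dots> = linear_form h * hcomp (k - 1) q" unfolding g(2) by (rule hcomp_mult) simp
    finally have 1: "linear_form h dvd v () - b * hcomp (k - c) g" by simp
    obtain \<theta> where \<theta>: "\<theta>\<in>log_der A (k - c + int (card (A - R)))" "linear_form h dvd b * hcomp (k - c) g - apply_form \<theta> h"
      using restriction_surjective[OF arr RA, of "k - c" "hcomp (k - c) g"] k cc unfolding b_def by auto
    have "v () - apply_form \<theta> h = (v () - b * hcomp (k - c) g) + (b * hcomp (k - c) g - apply_form \<theta> h)" by simp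
    then have "linear_form h dvd v () - apply_form \<theta> h" using 1 \<theta>(2) by (metis dvd_add)
    moreover have "\<theta> \<in> log_der A k" using \<theta>(1) by (simp add: c_def)
    ultimately show "v \<in> restricted h A k" using g(1) by (auto simp: restricted_def)
  qed
qed

lemma multiples_subset_restricted: "multiples (linear_form h) k \<subseteq> restricted h A k"
proof
  fix v assume "v \<in> multiples (linear_form h) k"
  moreover have "0 \<in> log_der A k" by (rule gs_0[OF gs_log_der])
  moreover have "apply_form 0 h = 0" by (rule apply_form_simps)
  ultimately show "v \<in> restricted h A k"
    unfolding restricted_def multiples_def by (metis (mono_tags, lifting) diff_0_right mem_Collect_eq)
qed

lemma complement_not_dvd:
  assumes arr: "line_arrangement (insert h A)" "h \<notin> A" and "T \<subseteq> A"
  shows "\<not> linear_form h dvd prod linear_form T" "prod linear_form T \<noteq> 0" "prime_elem (linear_form h)"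
proof -
  have fin: "finite A" using arrangementD(1)[OF arr(1)] by simp
  show pr: "prime_elem (linear_form h)"
    using arrangementD(2)[OF arr(1), of h] by (intro prime_elem_linear_form) simp
  have fT: "finite T" using fin assms(3) by (rule finite_subset[rotated])
  show "prod linear_form T \<noteq> 0"
    using arrangementD(2)[OF arr(1)] assms(3) fT by (auto simp: linear_form_eq_0_iff)
  show "\<not> linear_form h dvd prod linear_form T"
  proof
    assume "linear_form h dvd prod linear_form T"
    then obtain a where "a \<in> T" "linear_form h dvd linear_form a"
      using prime_elem_dvd_prodD[OF pr _ fT] by blast
    then have "proportional h a" using linear_form_dvd_linear_form arrangementD(2)[OF arr(1), of h] by blast
    then show False using arrangementD(3)[OF arr(1), of h a] \<open>a \<in> T\<close> assms(2,3) by auto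
  qed
qed

text \<open>With \<open>b\<close> and \<open>l\<close> as in the proof, \<open>(b, l)/(l)\<close> has regularity \<open>deg b = card A - card R\<close>. The restrictions of
  \<open>D(A)\<close> agree with it in degrees \<open>k \<ge> card A - 2\<close>, so they form an \<open>r\<close>-regular module. They are
  isomorphic to \<open>D(A)/D(A \<union> {h})\<close>, and \<open>D(A \<union> {h})\<close> is a kernel.\<close>

lemma deletion_regular:
  assumes arr: "line_arrangement (insert h A)" "h \<notin> A" and R: "transversal h A R"
    and r: "r \<ge> int (card A) - int (card R)" "r \<ge> int (card A) - 2"
    and reg: "regular (r + 1) (log_der A) (\<lambda>_. {0})"
  shows "regular (r + 1) (log_der (insert h A)) (\<lambda>_. {0})"
proof -
  define b l where "b = prod linear_form (A - R)" and "l = linear_form h"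
  define c where "c = int (card (A - R))"
  have fin: "finite A" using arrangementD(1)[OF arr(1)] by simp
  have RA: "R \<subseteq> A" using R by (auto simp: transversal_def)
  then have finR: "finite R" using fin by (meson finite_subset)
  have cc: "c + int (card R) = int (card A)"
    unfolding c_def using RA fin finR by (simp add: card_Diff_subset card_mono)
  have b: "homogeneous c b" "b \<noteq> 0" "\<not> l dvd b" and l: "homogeneous 1 l" "prime_elem l"
    using complement_not_dvd[OF arr, of "A - R"] unfolding b_def c_def l_def by (auto intro: homogeneous_prod)
  have l0: "l \<noteq> 0" using l(2) by (auto simp: prime_elem_def)
  have "regular c (multiples b) (multiples (b * l))"
  proof (rule regular_quotient)
    show "regular c (multiples b) (\<lambda>_. {0})" by (rule regular_multiples[OF b(1,2)]) simp
    show "regular (c + 1) (multiples (b * l)) (\<lambda>_. {0})"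
      using b l0 by (intro regular_multiples[OF homogeneous_mult[OF b(1) l(1)]]) auto
  qed (auto simp: gs_multiples gs_zero multiples_def)
  then have "regular c (multiples_mod b l) (multiples l)"
    using regular_iso[OF multiples_mod_iso[OF b(1) l b(3)]] by simp
  then have "regular r (multiples_mod b l) (multiples l)"
    by (rule regular_mono) (use r cc in linarith)
  moreover have "regular (r - 1) (multiples_mod b l) (restricted h A)"
    using restricted_eq[OF arr R] r unfolding b_def l_def
    by (intro regular_finite_length gs_restricted gs_multiples_mod) auto
  ultimately have "regular (r - 1 + 1) (restricted h A) (multiples l)"
    using restricted_subset[OF arr R] multiples_subset_restricted
    by (rule_tac regular_kernel[where L = "multiples_mod b l", OF gs_restricted gs_multiples]) (simp_all add: b_def l_def)
  then have "regular r (log_der A) (log_der (insert h A))"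
    using regular_iso[OF restriction_iso[of h A], of r] arrangementD(2)[OF arr(1), of h] by (simp add: l_def)
  then show ?thesis
    using reg gs_0[OF gs_log_der] log_der_mono[of A "insert h A"]
    by (rule_tac regular_kernel[where L = "log_der A", OF gs_log_der gs_zero]) auto
qed

text \<open>A bound for all arrangements, pencils included, for which \<open>d - 1\<close> is sharp when \<open>d \<ge> 2\<close>: in suitable
  coordinates \<open>D(A)\<close> is then free with exponents \<open>0\<close>, \<open>1\<close>, \<open>d - 1\<close>. In the induction \<open>R\<close> is nonempty as soon as \<open>A\<close>
  is, which keeps \<open>deg b\<close> below \<open>card A\<close>.\<close>

lemma regular_log_der_arrangement:
  assumes "line_arrangement A"
  shows "regular (max 1 (int (card A) - 1)) (log_der A) (\<lambda>_. {0})"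
proof -
  have "finite A" using arrangementD(1)[OF assms] .
  then show ?thesis using assms
  proof (induction A rule: finite_induct)
    case empty
    show ?case unfolding log_der_empty by (rule regular_free) simp
  next
    case (insert h A)
    have arr: "line_arrangement A" using insert.prems by (auto simp: line_arrangement_def)
    obtain R where R: "transversal h A R" using transversal_exists by blast
    have RA: "R \<subseteq> A" "meet_pt h ` A = meet_pt h ` R" using R by (auto simp: transversal_def)
    have c: "card R \<ge> 1" if "card A \<ge> 1"
    proof -
      have "R \<noteq> {}" using RA(2) that by auto
      then show ?thesis using finite_subset[OF RA(1) insert.hyps(1)] by (simp add: Suc_le_eq card_gt_0_iff)
    qed
    define r where "r = max 0 (int (card A) - 1)"
    have "regular (r + 1) (log_der (insert h A)) (\<lambda>_. {0})"
    proof (rule deletion_regular[OF insert.prems insert.hyps(2) R])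
      show "r \<ge> int (card A) - int (card R)" "r \<ge> int (card A) - 2" 
        using c by (cases "card A = 0"; simp add: r_def)+
      show "regular (r + 1) (log_der A) (\<lambda>_. {0})"
        by (rule regular_mono[OF insert.IH[OF arr]]) (simp add: r_def)
    qed
    then show ?case using insert.hyps by (simp add: r_def max_def zero_fun_def split: if_splits)
  qed
qed

text \<open>Remove an arbitrary line \<open>h\<close>. As \<open>A\<close> is not a pencil, the other lines meet \<open>h\<close> in at least two
  points, so \<open>deg b\<close> is at most \<open>card B - 2\<close>. This is one better than in general, and one such step suffices:
  for the other lines the bound for arbitrary arrangements is already good enough.\<close>

lemma regular_log_der_not_pencil:
  assumes arr: "line_arrangement A" and np: "\<not> pencil A" and d: "card A \<ge> 3"
  shows "regular (int (card A) - 2) (log_der A) (\<lambda>_. {0})"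
proof -
  obtain h B where A: "A = insert h B" "h \<notin> B" using d by (metis card.empty not_numeral_le_zero ex_in_conv mk_disjoint_insert)
  have fin: "finite B" using arrangementD(1)[OF arr] A by simp
  have cA: "card A = Suc (card B)" using A fin by simp
  have arrB: "line_arrangement B" using arr unfolding A by (auto simp: line_arrangement_def)
  have h0: "h \<noteq> (\<lambda>_. 0)" using arrangementD(2)[OF arr, of h] A by simp
  obtain R where R: "transversal h B R" using transversal_exists by blast
  have RA: "R \<subseteq> B" "meet_pt h ` B = meet_pt h ` R" using R by (auto simp: transversal_def)
  have finR: "finite R" using RA fin by (meson finite_subset)
  have "card R \<ge> 2"
  proof (rule ccontr)
    assume "\<not> card R \<ge> 2"
    then have c: "card R \<le> 1" by simp
    have "B \<noteq> {}" using d cA by auto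
    then have "R \<noteq> {}" using RA(2) by auto
    then obtain r where r: "r \<in> R" by blast
    have rB: "r \<in> B" using r RA by auto
    have all: "meet_pt h a = meet_pt h r" if "a \<in> B" for a
    proof -
      have "meet_pt h a \<in> meet_pt h ` R" using that RA(2) by blast
      then obtain s where s: "s \<in> R" "meet_pt h a = meet_pt h s" by blast
      have "s = r" using c r s(1) card_le_Suc0_iff_eq[OF finR] by auto
      then show ?thesis using s by simp
    qed
    have x0: "cross h r \<noteq> (\<lambda>_. 0)"
      using cross_eq_0[OF h0] arrangementD(3)[OF arr, of h r] A rB by auto
    have "meet_pt h r \<in> proj_plane" unfolding proj_plane_def meet_pt_def using x0 by blast
    moreover have "lines_through A (meet_pt h r) = A"
    proof -
      have "(\<Sum>i\<in>UNIV. a i * v i) = 0" if a: "a \<in> A" and v: "v \<in> meet_pt h r" for a v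
      proof -
        obtain c where c: "v = (\<lambda>i. c * cross h r i)" using v by (auto simp: meet_pt_def)
        have "dot a (cross h r) = 0"
        proof (cases "a = h")
          case False
          then have "meet_pt h r = meet_pt h a" using a A all by auto
          then obtain e d where ed: "a = (\<lambda>i. e * r i + d * h i)" using meet_pt_eqD[OF h0] by blast
          have "dot a (cross h r) = e * dot r (cross h r) + d * dot h (cross h r)"
            unfolding ed by (simp add: dot_3 algebra_simps)
          then show ?thesis by simp
        qed simp
        then have "dot a v = 0" unfolding c by (simp add: dot_3 algebra_simps flip: distrib_left)
        then show ?thesis by (simp add: dot_def)
      qed
      then show ?thesis by (auto simp: lines_through_def)
    qed
    ultimately show False using np unfolding pencil_def by blast
  qed
  define r where "r = int (card B) - 2"
  have "regular (r + 1) (log_der (insert h B)) (\<lambda>_. {0})"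
  proof (rule deletion_regular[OF arr[unfolded A(1)] A(2) R])
    show "r \<ge> int (card B) - int (card R)" "r \<ge> int (card B) - 2" using \<open>card R \<ge> 2\<close> by (auto simp: r_def)
    show "regular (r + 1) (log_der B) (\<lambda>_. {0})"
      using regular_log_der_arrangement[OF arrB] cA d by (simp add: r_def max_def split: if_splits)
  qed
  then show ?thesis unfolding A(1)[symmetric] by (simp add: r_def cA)
qed

section \<open>Codimension of linear subspaces\<close>

definition lincomb :: "nat \<Rightarrow> (nat \<Rightarrow> complex) \<Rightarrow> (nat \<Rightarrow> 'k \<Rightarrow> poly3) \<Rightarrow> ('k \<Rightarrow> poly3)" where
  "lincomb n c b = (\<Sum>i<n. const (c i) \<cdot> b i)"

text \<open>\<open>b 0, \<dots>, b (n - 1)\<close> represent a basis of \<open>V/W\<close>. A relation in place of a dimension function makes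
  finiteness part of every statement.\<close>

definition has_codim :: "('k \<Rightarrow> poly3) set \<Rightarrow> ('k \<Rightarrow> poly3) set \<Rightarrow> nat \<Rightarrow> bool" where
  "has_codim V W n \<longleftrightarrow> (\<exists>b. (\<forall>i<n. b i \<in> V) \<and> (\<forall>v\<in>V. \<exists>c. v - lincomb n c b \<in> W) \<and>
     (\<forall>c. lincomb n c b \<in> W \<longrightarrow> (\<forall>i<n. c i = 0)))"

definition subspace :: "('k \<Rightarrow> poly3) set \<Rightarrow> bool" where
  "subspace V \<longleftrightarrow> 0 \<in> V \<and> (\<forall>u\<in>V. \<forall>v\<in>V. u - v \<in> V) \<and> (\<forall>c. \<forall>v\<in>V. const c \<cdot> v \<in> V)"

lemma gs_subspace: "graded_submodule N \<Longrightarrow> subspace (N k)"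
  using gs_smul[of N _ k 0 "const _" k] by (auto simp: subspace_def gs_0 gs_diff)

lemma
  assumes "subspace V"
  shows subspace_0: "0 \<in> V"
    and subspace_diff: "u \<in> V \<Longrightarrow> v \<in> V \<Longrightarrow> u - v \<in> V"
    and subspace_add: "u \<in> V \<Longrightarrow> v \<in> V \<Longrightarrow> u + v \<in> V"
    and subspace_scale: "u \<in> V \<Longrightarrow> const c \<cdot> u \<in> V"
proof -
  show 0: "0 \<in> V" and d: "\<And>u v. u \<in> V \<Longrightarrow> v \<in> V \<Longrightarrow> u - v \<in> V"
    and "u \<in> V \<Longrightarrow> const c \<cdot> u \<in> V"
    using assms by (auto simp: subspace_def)
  show "u + v \<in> V" if "u \<in> V" "v \<in> V" using d[OF that(1) d[OF 0 that(2)]] by simp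
qed

lemma subspace_sum:
  assumes "subspace V" "\<And>i. i \<in> I \<Longrightarrow> g i \<in> V"
  shows "sum g I \<in> V"
  using assms(2) by (induction I rule: infinite_finite_induct) (auto intro: subspace_0 subspace_add assms(1))

lemma subspace_lincomb: "subspace V \<Longrightarrow> (\<And>i. i < n \<Longrightarrow> b i \<in> V) \<Longrightarrow> lincomb n c b \<in> V"
  unfolding lincomb_def by (intro subspace_sum subspace_scale) auto

lemma slinear_sum: "slinear \<phi> \<Longrightarrow> \<phi> (sum g I) = (\<Sum>i\<in>I. \<phi> (g i))"
  by (induction I rule: infinite_finite_induct) (auto simp: slinear_simps)

lemma slinear_lincomb: "slinear \<phi> \<Longrightarrow> \<phi> (lincomb n c b) = lincomb n c (\<lambda>i. \<phi> (b i))"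
  by (simp only: lincomb_def slinear_sum slinear_simps(2))

lemma lincomb_add:
  "lincomb (m + n) c (\<lambda>i. if i < m then b i else b' (i - m)) = lincomb m c b + lincomb n (\<lambda>i. c (i + m)) b'"
proof -
  define B where "B = (\<lambda>i. if i < m then b i else b' (i - m))"
  have "{..<m + n} = {..<m} \<union> {m..<m + n}" by auto
  then have "lincomb (m + n) c B = (\<Sum>i<m. const (c i) \<cdot> B i) + (\<Sum>i\<in>{m..<m + n}. const (c i) \<cdot> B i)"
    unfolding lincomb_def by (simp only: sum.union_disjoint finite_lessThan finite_atLeastLessThan ivl_disj_int)
  also have "(\<Sum>i\<in>{m..<m + n}. const (c i) \<cdot> B i) = (\<Sum>i<n. const (c (i + m)) \<cdot> B (i + m))"
    using sum.shift_bounds_nat_ivl[of "\<lambda>i. const (c i) \<cdot> B i" 0 m n]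
    by (simp only: lessThan_atLeast0 add.commute add_0)
  also have "\<dots> = lincomb n (\<lambda>i. c (i + m)) b'" unfolding lincomb_def by (intro sum.cong refl) (simp add: B_def)
  also have "(\<Sum>i<m. const (c i) \<cdot> B i) = lincomb m c b" unfolding lincomb_def by (intro sum.cong refl) (simp add: B_def)
  finally show ?thesis by (simp only: B_def)
qed

lemma lincomb_cong: "(\<And>i. i < n \<Longrightarrow> c i = c' i) \<Longrightarrow> (\<And>i. i < n \<Longrightarrow> b i = b' i) \<Longrightarrow> lincomb n c b = lincomb n c' b'"
  by (simp add: lincomb_def)

lemma has_codim_add:
  assumes sub: "subspace K" "subspace Z" "K \<subseteq> L" "Z \<subseteq> K" "subspace L"
    and m: "has_codim L K m" and n: "has_codim K Z n"
  shows "has_codim L Z (m + n)"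
proof -
  obtain b where b: "\<And>i. i < m \<Longrightarrow> b i \<in> L" "\<And>v. v \<in> L \<Longrightarrow> \<exists>c. v - lincomb m c b \<in> K"
    "\<And>c. lincomb m c b \<in> K \<Longrightarrow> \<forall>i<m. c i = 0" using m by (auto simp: has_codim_def)
  obtain b' where b': "\<And>i. i < n \<Longrightarrow> b' i \<in> K" "\<And>v. v \<in> K \<Longrightarrow> \<exists>c. v - lincomb n c b' \<in> Z"
    "\<And>c. lincomb n c b' \<in> Z \<Longrightarrow> \<forall>i<n. c i = 0" using n by (auto simp: has_codim_def)
  define B where "B = (\<lambda>i. if i < m then b i else b' (i - m))"
  have lc: "lincomb (m + n) c B = lincomb m c b + lincomb n (\<lambda>i. c (i + m)) b'" for c
    unfolding B_def by (rule lincomb_add)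
  show ?thesis unfolding has_codim_def
  proof (intro exI[of _ B] conjI allI ballI impI)
    show "B i \<in> L" if "i < m + n" for i using that b(1) b'(1)[of "i - m"] sub(3) by (auto simp: B_def)
    show "\<exists>c. v - lincomb (m + n) c B \<in> Z" if v: "v \<in> L" for v
    proof -
      obtain c where c: "v - lincomb m c b \<in> K" using b(2)[OF v] by blast
      obtain c' where c': "v - lincomb m c b - lincomb n c' b' \<in> Z" using b'(2)[OF c] by blast
      have "lincomb (m + n) (\<lambda>i. if i < m then c i else c' (i - m)) B = lincomb m c b + lincomb n c' b'"
        unfolding lc by (intro arg_cong2[where f = "(+)"] lincomb_cong) auto
      then show ?thesis using c' by (intro exI[of _ "\<lambda>i. if i < m then c i else c' (i - m)"]) (simp add: diff_diff_eq)
    qed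
    show "c i = 0" if c: "lincomb (m + n) c B \<in> Z" and i: "i < m + n" for c i
    proof -
      have k: "lincomb n (\<lambda>i. c (i + m)) b' \<in> K" by (rule subspace_lincomb[OF sub(1) b'(1)])
      have "lincomb (m + n) c B - lincomb n (\<lambda>i. c (i + m)) b' \<in> K"
        using c sub k by (intro subspace_diff) auto
      then have m0: "\<forall>i<m. c i = 0" using b(3) by (simp add: lc)
      then have "lincomb m c b = 0" by (simp add: lincomb_def const_simps smul_simps)
      then have n0: "\<forall>i<n. c (i + m) = 0" using b'(3)[of "\<lambda>i. c (i + m)"] c by (simp add: lc)
      show "c i = 0"
      proof (cases "i < m")
        case False
        then have "c ((i - m) + m) = 0" using n0 i by (metis less_diff_conv2 linorder_not_le add.commute)
        then show ?thesis using False by simp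
      qed (use m0 in simp)
    qed
  qed
qed

lemma has_codim_iso:
  assumes iso: "quotient_iso s \<phi> L K N Z" and gN: "graded_submodule N" and ZN: "\<And>k. Z k \<subseteq> N k"
    and kl: "k' = k + s"
  shows "has_codim (L k) (K k) n \<longleftrightarrow> has_codim (N k') (Z k') n"
proof -
  have lin: "slinear \<phi>" and gs: "graded_submodule L" "graded_submodule Z"
    and into: "\<And>u. u \<in> L k \<Longrightarrow> \<phi> u \<in> N k'"
    and onto: "\<And>v. v \<in> N k' \<Longrightarrow> \<exists>u\<in>L k. v - \<phi> u \<in> Z k'"
    and ker: "\<And>u. u \<in> L k \<Longrightarrow> \<phi> u \<in> Z k' \<longleftrightarrow> u \<in> K k"
    using iso by (auto simp: quotient_iso_def kl)
  have L: "subspace (L k)" and Z: "subspace (Z k')" and N: "subspace (N k')"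
    using gs gN by (auto intro: gs_subspace)
  show ?thesis
  proof
    assume "has_codim (L k) (K k) n"
    then obtain b where b: "\<And>i. i < n \<Longrightarrow> b i \<in> L k" "\<And>v. v \<in> L k \<Longrightarrow> \<exists>c. v - lincomb n c b \<in> K k"
      "\<And>c. lincomb n c b \<in> K k \<Longrightarrow> \<forall>i<n. c i = 0" by (auto simp: has_codim_def)
    have lL: "lincomb n c b \<in> L k" for c by (rule subspace_lincomb[OF L b(1)])
    show "has_codim (N k') (Z k') n" unfolding has_codim_def
    proof (intro exI[of _ "\<lambda>i. \<phi> (b i)"] conjI allI ballI impI)
      show "\<phi> (b i) \<in> N k'" if "i < n" for i using into b(1) that by blast
      show "\<exists>c. v - lincomb n c (\<lambda>i. \<phi> (b i)) \<in> Z k'" if v: "v \<in> N k'" for v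
      proof -
        obtain u where u: "u \<in> L k" "v - \<phi> u \<in> Z k'" using onto[OF v] by blast
        obtain c where "u - lincomb n c b \<in> K k" using b(2)[OF u(1)] by blast
        then have "\<phi> (u - lincomb n c b) \<in> Z k'" using ker[OF subspace_diff[OF L u(1) lL]] by blast
        then have "(v - \<phi> u) + \<phi> (u - lincomb n c b) \<in> Z k'" using subspace_add[OF Z u(2)] by blast
        then show ?thesis by (auto simp: slinear_simps[OF lin] slinear_lincomb[OF lin])
      qed
      show "c i = 0" if "lincomb n c (\<lambda>i. \<phi> (b i)) \<in> Z k'" "i < n" for c i
        using that ker[OF lL] b(3) by (simp add: slinear_lincomb[OF lin, symmetric])
    qed
  next
    assume "has_codim (N k') (Z k') n"
    then obtain b where b: "\<And>i. i < n \<Longrightarrow> b i \<in> N k'" "\<And>v. v \<in> N k' \<Longrightarrow> \<exists>c. v - lincomb n c b \<in> Z k'"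
      "\<And>c. lincomb n c b \<in> Z k' \<Longrightarrow> \<forall>i<n. c i = 0" by (auto simp: has_codim_def)
    have "\<forall>i. \<exists>u. i < n \<longrightarrow> u \<in> L k \<and> b i - \<phi> u \<in> Z k'" using onto b(1) by blast
    then obtain a where a: "\<And>i. i < n \<Longrightarrow> a i \<in> L k" "\<And>i. i < n \<Longrightarrow> b i - \<phi> (a i) \<in> Z k'" by metis
    have lL: "lincomb n c a \<in> L k" for c by (rule subspace_lincomb[OF L a(1)])
    have df: "lincomb n c b - \<phi> (lincomb n c a) \<in> Z k'" for c
    proof -
      have "lincomb n c (\<lambda>i. b i - \<phi> (a i)) \<in> Z k'" by (rule subspace_lincomb[OF Z a(2)])
      moreover have "lincomb n c (\<lambda>i. b i - \<phi> (a i)) = lincomb n c b - lincomb n c (\<lambda>i. \<phi> (a i))"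
        by (simp only: lincomb_def smul_simps sum_subtractf)
      ultimately show ?thesis by (simp only: slinear_lincomb[OF lin])
    qed
    show "has_codim (L k) (K k) n" unfolding has_codim_def
    proof (intro exI[of _ a] conjI allI ballI impI)
      show "\<exists>c. v - lincomb n c a \<in> K k" if v: "v \<in> L k" for v
      proof -
        obtain c where "\<phi> v - lincomb n c b \<in> Z k'" using b(2)[OF into[OF v]] by blast
        then have "(\<phi> v - lincomb n c b) + (lincomb n c b - \<phi> (lincomb n c a)) \<in> Z k'"
          using df subspace_add[OF Z] by blast
        then have "\<phi> (v - lincomb n c a) \<in> Z k'" by (simp add: slinear_simps[OF lin])
        then show ?thesis using ker[OF subspace_diff[OF L v lL]] by blast
      qed
      show "c i = 0" if c: "lincomb n c a \<in> K k" and i: "i < n" for c i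
      proof -
        have "\<phi> (lincomb n c a) \<in> Z k'" using ker[OF lL] c by blast
        then have "(lincomb n c b - \<phi> (lincomb n c a)) + \<phi> (lincomb n c a) \<in> Z k'"
          using df subspace_add[OF Z] by blast
        then have "lincomb n c b \<in> Z k'" by simp
        then show ?thesis using b(3) i by blast
      qed
    qed (use a in auto)
  qed
qed

interpretation pv: vector_space "\<lambda>c (v :: 'k \<Rightarrow> poly3). const c \<cdot> v"
  by unfold_locales (auto simp: smul_simps const_simps)

lemma lincomb_unit: "j < n \<Longrightarrow> lincomb n (\<lambda>i. if i = j then 1 else 0) a = a j"
proof -
  assume "j < n"
  have "lincomb n (\<lambda>i. if i = j then 1 else 0) a = (\<Sum>i<n. if i = j then a i else 0)"
    unfolding lincomb_def by (intro sum.cong) (auto simp: smul_simps const_simps)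
  then show ?thesis using \<open>j < n\<close> by simp
qed

text \<open>The exchange lemma modulo \<open>Z\<close>. Each \<open>a j\<close> is replaced by the linear combination of the \<open>b i\<close> to which it is congruent;
  the replacements are independent in the ambient space, where the exchange lemma
  for vector spaces applies.\<close>

lemma independent_le_spanning:
  assumes Z: "subspace Z"
    and span: "\<And>j. j < m \<Longrightarrow> \<exists>c. a j - lincomb n c b \<in> Z"
    and ind: "\<And>c. lincomb m c a \<in> Z \<Longrightarrow> \<forall>i<m. c i = 0"
  shows "m \<le> n"
proof -
  have "\<forall>j. \<exists>c. j < m \<longrightarrow> a j - lincomb n c b \<in> Z" using span by blast
  then obtain M where M: "\<And>j. j < m \<Longrightarrow> a j - lincomb n (M j) b \<in> Z" by metis
  define a' where "a' j = lincomb n (M j) b" for j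
  have df: "lincomb m c a - lincomb m c a' \<in> Z" for c
  proof -
    have "lincomb m c (\<lambda>i. a i - a' i) \<in> Z" unfolding a'_def by (rule subspace_lincomb[OF Z M])
    then show ?thesis by (simp add: lincomb_def smul_simps sum_subtractf)
  qed
  have ind': "\<forall>i<m. c i = 0" if "lincomb m c a' = 0" for c using df[of c] ind that by simp
  have inj: "inj_on a' {..<m}"
  proof (rule inj_onI)
    fix i j assume ij: "i \<in> {..<m}" "j \<in> {..<m}" "a' i = a' j"
    show "i = j"
    proof (rule ccontr)
      assume ne: "i \<noteq> j"
      have "lincomb m (\<lambda>k. (if k = i then 1 else 0) - (if k = j then 1 else 0)) a' =
        lincomb m (\<lambda>k. if k = i then 1 else 0) a' - lincomb m (\<lambda>k. if k = j then 1 else 0) a'"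
        by (simp only: lincomb_def const_simps(6) smul_simps(9) sum_subtractf)
      also have "\<dots> = 0" using ij by (simp add: lincomb_unit)
      finally have "\<forall>k<m. ((if k = i then 1 else 0) - (if k = j then 1 else 0 :: complex)) = 0" by (rule ind')
      then show False using ij(1) ne by auto
    qed
  qed
  have "pv.independent (a' ` {..<m})"
  proof
    assume "pv.dependent (a' ` {..<m})"
    then obtain u where u: "\<exists>v\<in>a' ` {..<m}. u v \<noteq> 0" "(\<Sum>v\<in>a' ` {..<m}. const (u v) \<cdot> v) = 0"
      by (auto simp: pv.dependent_finite)
    have "(\<Sum>v\<in>a' ` {..<m}. const (u v) \<cdot> v) = lincomb m (\<lambda>i. u (a' i)) a'"
      unfolding lincomb_def by (subst sum.reindex[OF inj]) simp
    then show False using ind' u by auto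
  qed
  moreover have "a' ` {..<m} \<subseteq> pv.span (b ` {..<n})"
    unfolding a'_def lincomb_def by (intro image_subsetI pv.span_sum pv.span_scale pv.span_base) auto
  ultimately have "card (a' ` {..<m}) \<le> card (b ` {..<n})"
    using pv.independent_span_bound[of "b ` {..<n}"] by auto
  also have "\<dots> \<le> n" using card_image_le[of "{..<n}" b] by simp
  finally show ?thesis using card_image[OF inj] by simp
qed

lemma has_codim_le:
  assumes "subspace Z" "Z \<subseteq> W" "has_codim V Z n" "has_codim V W m" shows "m \<le> n"
proof -
  obtain b where b: "\<And>i. i < m \<Longrightarrow> b i \<in> V" "\<And>c. lincomb m c b \<in> W \<Longrightarrow> \<forall>i<m. c i = 0"
    using assms(4) unfolding has_codim_def by blast
  obtain b' where b': "\<And>v. v \<in> V \<Longrightarrow> \<exists>c. v - lincomb n c b' \<in> Z"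
    using assms(3) unfolding has_codim_def by blast
  show ?thesis using independent_le_spanning[OF assms(1), of m b n b'] b b' assms(2) by blast
qed

lemma has_codim_unique:
  assumes "subspace W" "has_codim V W n" "has_codim V W m" shows "n = m"
  using has_codim_le[OF assms(1) order_refl assms(2,3)] has_codim_le[OF assms(1) order_refl assms(3,2)] by simp

text \<open>A nonzero element of \<open>W\<close> could be added to a basis of \<open>V/W\<close> to give \<open>n + 1\<close> independent elements of \<open>V\<close>.\<close>

lemma has_codim_full:
  assumes W: "subspace W" "W \<subseteq> V" and n: "has_codim V W n" "has_codim V {0} n"
  shows "W = {0}"
proof (rule ccontr)
  assume "W \<noteq> {0}"
  then obtain w where w: "w \<in> W" "w \<noteq> 0" using subspace_0[OF W(1)] by blast
  obtain b where b: "\<And>i. i < n \<Longrightarrow> b i \<in> V" "\<And>c. lincomb n c b \<in> W \<Longrightarrow> \<forall>i<n. c i = 0"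
    using n(1) unfolding has_codim_def by blast
  obtain b' where b': "\<And>v. v \<in> V \<Longrightarrow> \<exists>c. v - lincomb n c b' \<in> {0}"
    using n(2) unfolding has_codim_def by blast
  have s0: "subspace {0 :: 'a \<Rightarrow> poly3}" by (auto simp: subspace_def smul_simps)
  define B where "B = (\<lambda>i. if i < n then b i else w)"
  have "Suc n \<le> n"
  proof (rule independent_le_spanning[OF s0])
    show "\<exists>c. B j - lincomb n c b' \<in> {0}" if "j < Suc n" for j
      using b' b(1) w(1) W(2) by (auto simp: B_def)
    fix c assume "lincomb (Suc n) c B \<in> {0}"
    then have e: "lincomb n c b = (- 1) \<cdot> const (c n) \<cdot> w"
      by (simp add: lincomb_def B_def smul_simps eq_neg_iff_add_eq_0)
    have "const (- c n) \<cdot> w \<in> W" by (rule subspace_scale[OF W(1) w(1)])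
    then have "\<forall>i<n. c i = 0" using b(2)[of c] unfolding e by (simp add: smul_simps const_simps)
    moreover have "c n = 0"
    proof (rule ccontr)
      assume c0: "c n \<noteq> 0"
      have "const (c n) \<cdot> w = 0" using e \<open>\<forall>i<n. c i = 0\<close> by (simp add: lincomb_def const_simps smul_simps)
      moreover have "const (inverse (c n)) \<cdot> const (c n) \<cdot> w = w" using c0 by simp
      ultimately show False using w(2) by (simp add: smul_simps)
    qed
    ultimately show "\<forall>i<Suc n. c i = 0" by (simp add: less_Suc_eq)
  qed
  then show False by simp
qed

text \<open>A family in \<open>V\<close> that is independent modulo \<open>W\<close> and has the largest possible length spans \<open>V\<close>
  modulo \<open>W\<close>.\<close>

lemma has_codim_exists:
  assumes sub: "subspace V" "subspace W" "subspace Z" "Z \<subseteq> W" "V \<subseteq> U" and n: "has_codim U Z n"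
  shows "\<exists>m. has_codim V W m"
proof -
  define good where "good m \<longleftrightarrow> (\<exists>b. (\<forall>i<m. b i \<in> V) \<and> (\<forall>c. lincomb m c b \<in> W \<longrightarrow> (\<forall>i<m. c i = 0)))" for m
  obtain b' where b': "\<And>v. v \<in> V \<Longrightarrow> \<exists>c. v - lincomb n c b' \<in> Z"
    using n sub(5) unfolding has_codim_def by blast
  have bound: "m \<le> n" if g: "good m" for m
  proof -
    obtain b where b: "\<forall>i<m. b i \<in> V" "\<forall>c. lincomb m c b \<in> W \<longrightarrow> (\<forall>i<m. c i = 0)"
      using g unfolding good_def by blast
    show ?thesis using independent_le_spanning[OF sub(3), of m b n b'] b b' sub(4) by blast
  qed
  have "good 0" by (simp add: good_def)
  then obtain m where m: "good m" "\<And>k. good k \<Longrightarrow> k \<le> m"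
    using bound by (metis (no_types, lifting) GreatestI_nat Greatest_le_nat)
  obtain b where b: "\<forall>i<m. b i \<in> V" "\<forall>c. lincomb m c b \<in> W \<longrightarrow> (\<forall>i<m. c i = 0)"
    using m(1) unfolding good_def by blast
  have "\<exists>c. v - lincomb m c b \<in> W" if v: "v \<in> V" for v
  proof (rule ccontr)
    assume no: "\<nexists>c. v - lincomb m c b \<in> W"
    define B where "B = (\<lambda>i. if i < m then b i else v)"
    have lc: "lincomb (Suc m) c B = lincomb m c b + const (c m) \<cdot> v" for c
      by (simp add: lincomb_def B_def)
    have "good (Suc m)" unfolding good_def
    proof (intro exI[of _ B] conjI allI impI)
      show "B i \<in> V" if "i < Suc m" for i using that b(1) v by (auto simp: B_def)
      fix c i assume c: "lincomb (Suc m) c B \<in> W" and i: "i < Suc m"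
      have cm: "c m = 0"
      proof (rule ccontr)
        assume c0: "c m \<noteq> 0"
        have "const (inverse (c m)) \<cdot> lincomb (Suc m) c B \<in> W" using subspace_scale[OF sub(2) c] .
        also have "const (inverse (c m)) \<cdot> lincomb (Suc m) c B = v - lincomb m (\<lambda>i. - inverse (c m) * c i) b"
        proof -
          have "const (inverse (c m)) \<cdot> lincomb m c b = - lincomb m (\<lambda>i. - inverse (c m) * c i) b"
            unfolding lincomb_def pv.scale_sum_right sum_negf[symmetric]
            by (intro sum.cong refl) (simp add: smul_simps const_simps)
          moreover have "const (inverse (c m)) \<cdot> const (c m) \<cdot> v = v"
            using c0 by (simp add: smul_simps const_simps(4) flip: const_simps(2))
          ultimately show ?thesis by (simp add: lc smul_simps(1))
        qed
        finally show False using no by blast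
      qed
      then have "lincomb m c b \<in> W" using c by (simp add: lc const_simps smul_simps)
      then show "c i = 0" using b(2) cm i by (auto simp: less_Suc_eq)
    qed
    then show False using m(2)[of "Suc m"] by simp
  qed
  then show ?thesis using b unfolding has_codim_def by blast
qed

lemma has_codim_0_iff: "subspace W \<Longrightarrow> V \<subseteq> W \<Longrightarrow> has_codim V W 0"
  by (auto simp: has_codim_def lincomb_def)

section \<open>Hilbert functions of free modules\<close>

text \<open>The dimension of the space of forms of degree \<open>k\<close> in three variables.\<close>

definition binom2 :: "int \<Rightarrow> nat" where "binom2 k = (if k < 0 then 0 else nat ((k + 1) * (k + 2) div 2))"

text \<open>The polynomial \<open>(k + 1) (k + 2)\<close> gives the right value also for \<open>k = -1\<close> and \<open>k = -2\<close>, which are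
  needed in the extreme cases of later counts.\<close>

lemma binom2: "k \<ge> -2 \<Longrightarrow> 2 * int (binom2 k) = (k + 1) * (k + 2)"
proof -
  assume k: "k \<ge> -2"
  show ?thesis
  proof (cases "k < 0")
    case True
    then have "k = -1 \<or> k = -2" using k by auto
    then show ?thesis by (auto simp: binom2_def)
  next
    case False
    have "even ((k + 1) * (k + 2))" by simp
    then show ?thesis using False by (simp add: binom2_def)
  qed
qed

lemma card_monomials: "card {m. mon_degree m = k} = binom2 (int k)" "finite {m. mon_degree m = k}"
proof -
  define S where "S = Sigma {..k} (\<lambda>i. {..k - i})"
  define g :: "nat \<times> nat \<Rightarrow> mon3" where "g = (\<lambda>(i, j). mterm 0 i + mterm 1 j + mterm 2 (k - i - j))"
  have g: "mcoeff (g (i, j)) 0 = i" "mcoeff (g (i, j)) 1 = j" "mcoeff (g (i, j)) 2 = k - i - j" for i j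
    by (simp_all add: g_def lookup_add lookup_single when_def)
  have img: "g ` S = {m. mon_degree m = k}"
  proof (rule Set.set_eqI, rule iffI)
    fix m assume "m \<in> g ` S"
    then show "m \<in> {m. mon_degree m = k}" by (auto simp: S_def g_def)
  next
    fix m assume "m \<in> {m. mon_degree m = k}"
    then have d: "mcoeff m 0 + mcoeff m 1 + mcoeff m 2 = k" by (simp add: mon_degree_def sum_UNIV_3)
    have "\<forall>i. mcoeff m i = mcoeff (g (mcoeff m 0, mcoeff m 1)) i"
      unfolding all_3 g using d by auto
    then have "m = g (mcoeff m 0, mcoeff m 1)" by (intro poly_mapping_eqI) blast
    moreover have "(mcoeff m 0, mcoeff m 1) \<in> S" using d by (auto simp: S_def)
    ultimately show "m \<in> g ` S" by blast
  qed
  have "inj_on g S"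
    by (rule inj_on_inverseI[of _ "\<lambda>m. (mcoeff m 0, mcoeff m 1)"]) (auto simp: g split: prod.splits)
  then have "card {m. mon_degree m = k} = card S" using img card_image by metis
  also have "card S = (\<Sum>i\<le>k. k - i + 1)" unfolding S_def by simp
  also have "\<dots> = (\<Sum>i\<le>k. i + 1)"
    using sum.nat_diff_reindex[of "\<lambda>i. i + 1" "Suc k"] by (simp add: lessThan_Suc_atMost)
  also have "\<dots> = binom2 (int k)"
  proof -
    have "2 * (\<Sum>i\<le>k. i + 1) = (k + 1) * (k + 2)" by (induction k) auto
    then have "int (2 * (\<Sum>i\<le>k. i + 1)) = int ((k + 1) * (k + 2))" by (rule arg_cong)
    then have "2 * int (\<Sum>i\<le>k. i + 1) = (int k + 1) * (int k + 2)"
      by (simp only: of_nat_mult of_nat_numeral of_nat_add of_nat_1)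
    then show ?thesis using binom2[of "int k"] by linarith
  qed
  finally show "card {m. mon_degree m = k} = binom2 (int k)" .
  have "finite S" by (simp add: S_def)
  then show "finite {m. mon_degree m = k}" unfolding img[symmetric] by (rule finite_imageI)
qed

lemma has_codim_polys: "has_codim (polys k) {0} (binom2 k)"
proof (cases "k < 0")
  case True
  then have "polys k = {0}" using homogeneous_neg[OF _ True] by (auto simp: polys_iff unit_fun_eq)
  then show ?thesis using True by (auto simp: has_codim_def binom2_def lincomb_def)
next
  case False
  define n where "n = binom2 k"
  have M: "finite {m. mon_degree m = nat k}" "card {m. mon_degree m = nat k} = n"
    using card_monomials[of "nat k"] False by (simp_all add: n_def)
  obtain e where e: "bij_betw e {..<n} {m. mon_degree m = nat k}"
    using ex_bij_betw_nat_finite[OF M(1)] unfolding M(2) lessThan_atLeast0 by blast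
  define b where "b i = (\<lambda>_ :: unit. mterm (e i) (1 :: complex))" for i
  have lc: "lincomb n c b () = (\<Sum>i<n. mterm (e i) (c i))" for c
  proof -
    have "lincomb n c b () = (\<Sum>i<n. const (c i) * b i ())"
      unfolding lincomb_def by (induction n) simp_all
    then show ?thesis by (simp add: b_def const_mult_mono)
  qed
  have deg: "mon_degree (e i) = nat k" if "i < n" for i using e that by (auto simp: bij_betw_def)
  have inj: "inj_on e {..<n}" using e by (simp add: bij_betw_def)
  show ?thesis unfolding has_codim_def n_def[symmetric]
  proof (intro exI[of _ b] conjI allI ballI impI)
    show "b i \<in> polys k" if "i < n" for i
      using deg[OF that] False by (auto simp: polys_iff b_def homogeneous_def)
    show "\<exists>c. v - lincomb n c b \<in> {0}" if v: "v \<in> polys k" for v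
    proof (intro exI[of _ "\<lambda>i. mcoeff (v ()) (e i)"])
      have h: "homogeneous k (v ())" using v by (simp add: polys_iff)
      have "v () = (\<Sum>m\<in>{m. mon_degree m = nat k}. mterm m (mcoeff (v ()) m))"
        using M(1) h by (intro poly_as_sum) (auto simp: homogeneous_def)
      also have "\<dots> = (\<Sum>i<n. mterm (e i) (mcoeff (v ()) (e i)))"
        by (rule sum.reindex_bij_betw[OF e, symmetric])
      finally show "v - lincomb n (\<lambda>i. mcoeff (v ()) (e i)) b \<in> {0}" by (simp add: unit_fun_eq lc)
    qed
    show "c i = 0" if "lincomb n c b \<in> {0}" "i < n" for c i
    proof -
      have "0 = mcoeff (\<Sum>j<n. mterm (e j) (c j)) (e i)" using that(1) lc[of c] by simp
      also have "\<dots> = (\<Sum>j<n. if j = i then c j else 0)"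
        unfolding lookup_sum using inj that(2)
        by (intro sum.cong) (auto simp: lookup_single when_def inj_on_def)
      also have "\<dots> = c i" using that(2) by simp
      finally show ?thesis by simp
    qed
  qed
qed

lemma has_codim_free:
  assumes "finite I" shows "has_codim (free I a k) {0} (\<Sum>j\<in>I. binom2 (k - a j))"
  using assms
proof (induction I rule: finite_induct)
  case empty
  then show ?case by (auto simp: has_codim_def free_def lincomb_def fun_eq_iff)
next
  case (insert x I)
  have iso: "quotient_iso (- a x) (\<lambda>v _. v x) (free (insert x I) a) (free I a) polys (\<lambda>_. {0})"
  proof (rule quotient_isoI)
    show "slinear (\<lambda>v _. v x)" by (auto simp: slinear_def fun_eq_iff)
    fix k and v :: "unit \<Rightarrow> poly3" assume "v \<in> polys (k + - a x)"
    then show "\<exists>u\<in>free (insert x I) a k. v - (\<lambda>_. u x) \<in> {0}"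
      by (intro bexI[of _ "\<lambda>j. if j = x then v () else 0"]) (auto simp: polys_iff unit_fun_eq free_def)
  qed (use insert.hyps in \<open>auto simp: gs_free gs_zero free_def polys_iff unit_fun_eq\<close>)
  have "has_codim (free (insert x I) a k) (free I a k) (binom2 (k - a x))"
    using has_codim_iso[OF iso gs_polys, of "k - a x" k] has_codim_polys gs_0[OF gs_polys] by auto
  then have "has_codim (free (insert x I) a k) {0} (binom2 (k - a x) + (\<Sum>j\<in>I. binom2 (k - a j)))"
  proof (rule has_codim_add[rotated 5])
    show "has_codim (free I a k) {0} (\<Sum>j\<in>I. binom2 (k - a j))"
      using insert.IH by (simp add: zero_fun_def)
    show "subspace {0 :: 'a \<Rightarrow> poly3}" by (auto simp: subspace_def smul_simps)
    show "free I a k \<subseteq> free (insert x I) a k" by (auto simp: free_def)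
    show "{0} \<subseteq> free I a k" using gs_0[OF gs_free] by auto
  qed (rule gs_subspace gs_free)+
  then show ?case using insert.hyps by (simp add: zero_fun_def)
qed

lemma has_codim_free3: "has_codim (free (UNIV :: 3 set) (\<lambda>_. 0) k) {0} (3 * binom2 k)"
proof -
  have "has_codim (free (UNIV :: 3 set) (\<lambda>_. 0) k) {0} (\<Sum>j\<in>(UNIV :: 3 set). binom2 (k - 0))"
    by (rule has_codim_free) simp
  then show ?thesis by simp
qed

lemma has_codim_diff:
  assumes sub: "subspace V" "subspace W" "W \<subseteq> V" and n: "has_codim V {0} n" and m: "has_codim W {0} m"
  shows "m \<le> n" "has_codim V W (n - m)"
proof -
  have s0: "subspace {0}" by (auto simp: subspace_def smul_simps)
  obtain q where q: "has_codim V W q"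
    using has_codim_exists[OF sub(1,2) s0 _ order_refl n] subspace_0[OF sub(2)] by blast
  have "has_codim V {0} (q + m)"
    using has_codim_add[OF sub(2) s0 sub(3) _ sub(1) q m] subspace_0[OF sub(2)] by blast
  then have "n = q + m" using has_codim_unique[OF s0 n] by blast
  then show "m \<le> n" "has_codim V W (n - m)" using q by auto
qed

section \<open>The dimension of a quotient\<close>

definition lift :: "poly3 set \<Rightarrow> (unit \<Rightarrow> poly3) set" where "lift V = {v. v () \<in> V}"

lemma lincomb_apply: "lincomb n c b x = (\<Sum>i<n. const (c i) * b i x)"
  unfolding lincomb_def by (induction n) simp_all

text \<open>Uniqueness of coordinates is equivalent to independence, as \<open>0 \<in> V\<close> has only trivial
  coordinates; restricting coordinate functions to \<open>{..<n}\<close> does not change linear combinations.\<close>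

lemma quotient_dim_eq:
  assumes V: "subspace (lift V)" and W: "subspace (lift W)" and n: "has_codim (lift V) (lift W) n"
  shows "quotient_dim V W = n"
proof -
  define Q where "Q n \<longleftrightarrow> (\<exists>b. (\<forall>i<n. b i \<in> V) \<and>
     (\<forall>v\<in>V. \<exists>!c. c \<in> {..<n} \<rightarrow>\<^sub>E UNIV \<and> v - (\<Sum>i<n. scale (c i) (b i)) \<in> W))" for n :: nat
  have V0: "0 \<in> V" using subspace_0[OF V] by (simp add: lift_def)
  have W0: "0 \<in> W" using subspace_0[OF W] by (simp add: lift_def)
  have Wd: "u - v \<in> W" if "u \<in> W" "v \<in> W" for u v
    using subspace_diff[OF W, of "\<lambda>_. u" "\<lambda>_. v"] that by (simp add: lift_def)
  have Wm: "- u \<in> W" if "u \<in> W" for u using Wd[OF W0 that] by simp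
  have "Q n \<longleftrightarrow> has_codim (lift V) (lift W) n" for n
  proof
    assume "Q n"
    then obtain b where "(\<forall>i<n. b i \<in> V) \<and>
      (\<forall>v\<in>V. \<exists>!c. c \<in> {..<n} \<rightarrow>\<^sub>E UNIV \<and> v - (\<Sum>i<n. scale (c i) (b i)) \<in> W)"
      unfolding Q_def by (elim exE)
    then have b: "\<And>i. i < n \<Longrightarrow> b i \<in> V"
      "\<And>v. v \<in> V \<Longrightarrow> \<exists>!c. c \<in> {..<n} \<rightarrow>\<^sub>E UNIV \<and> v - (\<Sum>i<n. scale (c i) (b i)) \<in> W"
      by simp_all
    show "has_codim (lift V) (lift W) n" unfolding has_codim_def
    proof (intro exI[of _ "\<lambda>i _. b i"] conjI allI ballI impI)
      show "(\<lambda>_. b i) \<in> lift V" if "i < n" for i using b(1) that by (simp add: lift_def)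
      show "\<exists>c. v - lincomb n c (\<lambda>i _. b i) \<in> lift W" if "v \<in> lift V" for v
        using b(2)[of "v ()"] that by (auto simp: lift_def lincomb_apply scale_eq)
      show "c i = 0" if c: "lincomb n c (\<lambda>i _. b i) \<in> lift W" and i: "i < n" for c i
      proof -
        define c0 where "c0 = restrict (\<lambda>_. 0 :: complex) {..<n}"
        define c1 where "c1 = restrict c {..<n}"
        have "0 - (\<Sum>i<n. scale (c0 i) (b i)) \<in> W" using W0 by (simp add: c0_def scale_eq const_simps)
        moreover have "0 - (\<Sum>i<n. scale (c1 i) (b i)) \<in> W"
          using c Wm by (simp add: c1_def scale_eq lift_def lincomb_apply)
        moreover have "c0 \<in> {..<n} \<rightarrow>\<^sub>E UNIV" "c1 \<in> {..<n} \<rightarrow>\<^sub>E UNIV" by (auto simp: c0_def c1_def)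
        ultimately have "c0 = c1" using b(2)[OF V0] by blast
        then show ?thesis using i by (metis c0_def c1_def lessThan_iff restrict_apply')
      qed
    qed
  next
    assume "has_codim (lift V) (lift W) n"
    then obtain b where b: "\<And>i. i < n \<Longrightarrow> b i \<in> lift V" "\<And>v. v \<in> lift V \<Longrightarrow> \<exists>c. v - lincomb n c b \<in> lift W"
      "\<And>c. lincomb n c b \<in> lift W \<Longrightarrow> \<forall>i<n. c i = 0" by (auto simp: has_codim_def)
    show "Q n" unfolding Q_def
    proof (intro exI[of _ "\<lambda>i. b i ()"] conjI allI ballI impI)
      show "b i () \<in> V" if "i < n" for i using b(1) that by (simp add: lift_def)
      fix v assume v: "v \<in> V"
      obtain c where c: "(\<lambda>_. v) - lincomb n c b \<in> lift W" using b(2)[of "\<lambda>_. v"] v by (auto simp: lift_def)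
      show "\<exists>!c. c \<in> {..<n} \<rightarrow>\<^sub>E UNIV \<and> v - (\<Sum>i<n. scale (c i) (b i ())) \<in> W"
      proof (rule ex1I)
        show "restrict c {..<n} \<in> {..<n} \<rightarrow>\<^sub>E UNIV \<and> v - (\<Sum>i<n. scale (restrict c {..<n} i) (b i ())) \<in> W"
          using c by (auto simp: lift_def lincomb_apply scale_eq)
        fix e assume e: "e \<in> {..<n} \<rightarrow>\<^sub>E UNIV \<and> v - (\<Sum>i<n. scale (e i) (b i ())) \<in> W"
        have "v - (\<Sum>i<n. const (c i) * b i ()) \<in> W" using c by (simp add: lift_def lincomb_apply)
        moreover have "v - (\<Sum>i<n. const (e i) * b i ()) \<in> W" using e by (simp add: scale_eq)
        ultimately have "(v - (\<Sum>i<n. const (c i) * b i ())) - (v - (\<Sum>i<n. const (e i) * b i ())) \<in> W"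
          by (rule Wd)
        then have "lincomb n (\<lambda>i. e i - c i) b \<in> lift W"
          by (simp add: lift_def lincomb_apply const_simps left_diff_distrib sum_subtractf)
        then have "\<forall>i<n. e i - c i = 0" by (rule b(3))
        moreover have "e i = undefined" if "\<not> i < n" for i using e that by (auto simp: PiE_def extensional_def)
        ultimately show "e = restrict c {..<n}" by (intro ext) (simp add: restrict_def)
      qed
    qed
  qed
  then have "Q m \<longleftrightarrow> m = n" for m using n has_codim_unique[OF W] by auto
  then show ?thesis unfolding quotient_dim_def Q_def[symmetric] by simp
qed

section \<open>The total Tjurina number of an arrangement with one more line\<close>

lemma point_eq_meet:
  assumes P: "P \<in> proj_plane" and ab: "a \<in> lines_through A P" "b \<in> lines_through A P"
    and np: "a \<noteq> (\<lambda>_. 0)" "\<not> proportional a b"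
  shows "P = meet_pt a b"
proof -
  obtain v where v: "P = {w. \<exists>c. c \<noteq> 0 \<and> w = (\<lambda>i. c * v i)}" "v \<noteq> (\<lambda>_. 0)" using P by (auto simp: proj_plane_def)
  have vP: "v \<in> P" unfolding v by (auto intro: exI[of _ 1])
  have "dot a v = 0" "dot b v = 0" using ab vP by (auto simp: lines_through_def dot_def)
  then have "cross v (cross a b) = (\<lambda>_. 0)" by (rule cross_cross)
  then obtain e where e: "cross a b = (\<lambda>i. e * v i)" using cross_eq_0[OF v(2)] by (auto simp: proportional_def)
  have e0: "e \<noteq> 0" using e cross_eq_0[OF np(1), of b] np(2) by auto
  show ?thesis
  proof (rule Set.set_eqI, rule iffI)
    fix w assume "w \<in> P"
    then obtain c where "c \<noteq> 0" "w = (\<lambda>i. c * v i)" using v(1) by auto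
    then show "w \<in> meet_pt a b" unfolding meet_pt_def e using e0 by (intro CollectI exI[of _ "c / e"]) auto
  next
    fix w assume "w \<in> meet_pt a b"
    then obtain c where "c \<noteq> 0" "w = (\<lambda>i. c * (e * v i))" unfolding meet_pt_def e by auto
    then show "w \<in> P" unfolding v(1) using e0 by (intro CollectI exI[of _ "c * e"]) auto
  qed
qed

lemma meet_pt_proj_plane:
  assumes "a \<noteq> (\<lambda>_. 0)" "\<not> proportional a b" shows "meet_pt a b \<in> proj_plane"
  unfolding proj_plane_def meet_pt_def using cross_eq_0[OF assms(1), of b] assms(2) by blast

lemma lines_through_meet:
  "a \<in> A \<Longrightarrow> a \<in> lines_through A (meet_pt a b)" "b \<in> A \<Longrightarrow> b \<in> lines_through A (meet_pt a b)"
proof -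
  have *: "(\<Sum>i\<in>UNIV. x i * (c * cross a b i)) = c * dot x (cross a b)" for x c
    by (simp add: dot_def sum_distrib_left algebra_simps)
  show "a \<in> A \<Longrightarrow> a \<in> lines_through A (meet_pt a b)" "b \<in> A \<Longrightarrow> b \<in> lines_through A (meet_pt a b)"
    by (auto simp: lines_through_def meet_pt_def *)
qed

lemma finite_lines_through: "finite A \<Longrightarrow> finite (lines_through A P)"
  by (simp add: lines_through_def)

lemma finite_multiple_points:
  assumes arr: "line_arrangement A"
  shows "finite {P \<in> proj_plane. multiplicity_at A P \<ge> 2}"
proof (rule finite_subset)
  show "finite ((\<lambda>(a, b). meet_pt a b) ` (A \<times> A))" using arrangementD(1)[OF arr] by simp
  show "{P \<in> proj_plane. multiplicity_at A P \<ge> 2} \<subseteq> (\<lambda>(a, b). meet_pt a b) ` (A \<times> A)"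
  proof
    fix P assume P: "P \<in> {P \<in> proj_plane. multiplicity_at A P \<ge> 2}"
    then have "\<not> card (lines_through A P) \<le> Suc 0" by (simp add: multiplicity_at_def)
    then obtain a b where ab: "a \<in> lines_through A P" "b \<in> lines_through A P" "a \<noteq> b"
      using card_le_Suc0_iff_eq[OF finite_lines_through[OF arrangementD(1)[OF arr]]] by blast
    then have "a \<in> A" "b \<in> A" by (auto simp: lines_through_def)
    then have "P = meet_pt a b"
      using P ab arrangementD[OF arr] by (intro point_eq_meet) auto
    then show "P \<in> (\<lambda>(a, b). meet_pt a b) ` (A \<times> A)" using \<open>a \<in> A\<close> \<open>b \<in> A\<close> by auto
  qed
qed

text \<open>In the natural numbers \<open>(m - 1)\<^sup>2 = 0\<close> also for \<open>m = 0\<close>, so points of multiplicity at most \<open>1\<close>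
  contribute nothing.\<close>

lemma total_tjurina_superset:
  assumes "finite T" "T \<subseteq> proj_plane" "{P \<in> proj_plane. multiplicity_at A P \<ge> 2} \<subseteq> T"
  shows "total_tjurina A = (\<Sum>P\<in>T. (multiplicity_at A P - 1)\<^sup>2)"
  unfolding total_tjurina_def
proof (rule sum.mono_neutral_left[OF assms(1)])
  show "\<forall>P\<in>T - {P \<in> proj_plane. 2 \<le> multiplicity_at A P}. (multiplicity_at A P - 1)\<^sup>2 = 0"
    using assms(2) by (auto simp: not_le)
qed (rule assms(3))

text \<open>Only points of \<open>h\<close> matter. At such a point the multiplicity rises from \<open>m\<close> to \<open>m + 1\<close>, and if
  \<open>m \<ge> 1\<close> the contribution grows by \<open>m\<^sup>2 - (m - 1)\<^sup>2 = 2m - 1\<close>. There are \<open>card R\<close> points with \<open>m \<ge> 1\<close>, and each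
  line of \<open>A\<close> passes through exactly one of them.\<close>

lemma total_tjurina_insert:
  assumes arr: "line_arrangement (insert h A)" "h \<notin> A" and R: "transversal h A R"
  shows "int (total_tjurina (insert h A)) = int (total_tjurina A) + 2 * int (card A) - int (card R)"
proof -
  have fin: "finite A" using arrangementD(1)[OF arr(1)] by simp
  have h0: "h \<noteq> (\<lambda>_. 0)" using arrangementD(2)[OF arr(1), of h] by simp
  have np: "\<not> proportional h a" if "a \<in> A" for a
    using arrangementD(3)[OF arr(1), of h a] that arr(2) by auto
  define Q where "Q = meet_pt h ` A"
  have cQ: "card Q = card R" using R card_image unfolding Q_def transversal_def by metis
  define T where "T = {P \<in> proj_plane. multiplicity_at (insert h A) P \<ge> 2} \<union> Q"
  have QP: "Q \<subseteq> proj_plane" unfolding Q_def using meet_pt_proj_plane[OF h0 np] by auto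
  have T: "finite T" "T \<subseteq> proj_plane" using finite_multiple_points[OF arr(1)] fin QP by (auto simp: T_def Q_def)
  have mono: "lines_through A P \<subseteq> lines_through (insert h A) P" for P by (auto simp: lines_through_def)
  have "multiplicity_at A P \<le> multiplicity_at (insert h A) P" for P
    unfolding multiplicity_at_def using fin by (intro card_mono mono finite_lines_through) simp
  then have sub: "{P \<in> proj_plane. multiplicity_at A P \<ge> 2} \<subseteq> T" unfolding T_def using le_trans by blast
  have Qchar: "P \<in> Q \<longleftrightarrow> h \<in> lines_through (insert h A) P \<and> multiplicity_at A P \<ge> 1" if P: "P \<in> T" for P
  proof
    assume "P \<in> Q"
    then obtain a where a: "a \<in> A" "P = meet_pt h a" by (auto simp: Q_def)
    then have "a \<in> lines_through A P" using lines_through_meet by blast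
    then show "h \<in> lines_through (insert h A) P \<and> multiplicity_at A P \<ge> 1"
      using a lines_through_meet(1)[of h "insert h A" a] finite_lines_through[OF fin, of P]
      unfolding multiplicity_at_def by (metis One_nat_def Suc_leI card_gt_0_iff empty_iff insertI1)
  next
    assume *: "h \<in> lines_through (insert h A) P \<and> multiplicity_at A P \<ge> 1"
    then obtain a where a: "a \<in> lines_through A P" unfolding multiplicity_at_def
      by (metis all_not_in_conv card.empty not_one_le_zero)
    then have aA: "a \<in> A" by (simp add: lines_through_def)
    then have "P = meet_pt h a" using * a mono P T(2) np[OF aA] h0 by (intro point_eq_meet[of P h "insert h A" a]) auto
    then show "P \<in> Q" using aA by (simp add: Q_def)
  qed
  have step: "int ((multiplicity_at (insert h A) P - 1)\<^sup>2) = int ((multiplicity_at A P - 1)\<^sup>2)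
      + (if P \<in> Q then 2 * int (multiplicity_at A P) - 1 else 0)" if P: "P \<in> T" for P
  proof (cases "h \<in> lines_through (insert h A) P")
    case True
    then have "lines_through (insert h A) P = insert h (lines_through A P)" by (auto simp: lines_through_def)
    moreover have "h \<notin> lines_through A P" using arr(2) by (simp add: lines_through_def)
    ultimately have m: "multiplicity_at (insert h A) P = Suc (multiplicity_at A P)"
      unfolding multiplicity_at_def using finite_lines_through[OF fin] by simp
    show ?thesis
    proof (cases "multiplicity_at A P")
      case 0
      then show ?thesis using Qchar[OF P] m by simp
    next
      case (Suc n)
      then show ?thesis using Qchar[OF P] m True by (simp add: power2_eq_square algebra_simps)
    qed
  next
    case False
    then have "lines_through (insert h A) P = lines_through A P" by (auto simp: lines_through_def)
    then show ?thesis using Qchar[OF P] False by (simp add: multiplicity_at_def)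
  qed
  have "int (total_tjurina (insert h A)) = (\<Sum>P\<in>T. int ((multiplicity_at (insert h A) P - 1)\<^sup>2))"
    using total_tjurina_superset[OF T, of "insert h A"] by (simp add: T_def)
  also have "\<dots> = (\<Sum>P\<in>T. int ((multiplicity_at A P - 1)\<^sup>2)) + (\<Sum>P\<in>T. if P \<in> Q then 2 * int (multiplicity_at A P) - 1 else 0)"
    unfolding sum.distrib[symmetric] by (intro sum.cong refl step)
  also have "(\<Sum>P\<in>T. int ((multiplicity_at A P - 1)\<^sup>2)) = int (total_tjurina A)"
    using total_tjurina_superset[OF T sub] by simp
  also have "(\<Sum>P\<in>T. if P \<in> Q then 2 * int (multiplicity_at A P) - 1 else 0) = (\<Sum>P\<in>Q. 2 * int (multiplicity_at A P) - 1)"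
    using T(1) by (subst sum.inter_restrict[symmetric]) (auto simp: T_def intro: sum.cong)
  also have "\<dots> = 2 * int (\<Sum>P\<in>Q. multiplicity_at A P) - int (card Q)"
    by (simp add: sum_subtractf sum_distrib_left)
  also have "(\<Sum>P\<in>Q. multiplicity_at A P) = card A"
  proof -
    have "multiplicity_at A P = (\<Sum>a\<in>{a. a \<in> A \<and> meet_pt h a = P}. 1)" if P: "P \<in> Q" for P
    proof -
      have "lines_through A P = {a. a \<in> A \<and> meet_pt h a = P}"
      proof (rule Set.set_eqI, rule iffI)
        fix a assume a: "a \<in> lines_through A P"
        then have aA: "a \<in> A" by (simp add: lines_through_def)
        have "h \<in> lines_through (insert h A) P" using P Qchar unfolding T_def by blast
        then have "P = meet_pt h a" using a mono P QP np[OF aA] h0 by (intro point_eq_meet[of P h "insert h A" a]) auto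
        then show "a \<in> {a. a \<in> A \<and> meet_pt h a = P}" using aA by simp
      next
        fix a assume "a \<in> {a. a \<in> A \<and> meet_pt h a = P}"
        then show "a \<in> lines_through A P" using lines_through_meet(2)[of a A h] by auto
      qed
      then show ?thesis by (simp add: multiplicity_at_def)
    qed
    then have "(\<Sum>P\<in>Q. multiplicity_at A P) = (\<Sum>P\<in>meet_pt h ` A. \<Sum>a\<in>{a. a \<in> A \<and> meet_pt h a = P}. 1)"
      unfolding Q_def by (intro sum.cong refl) (simp add: Q_def)
    also have "\<dots> = (\<Sum>a\<in>A. 1)" by (rule sum.image_gen[OF fin, symmetric])
    finally show ?thesis by simp
  qed
  finally show ?thesis using cQ by simp
qed

lemma total_tjurina_empty: "total_tjurina {} = 0"
  by (simp add: total_tjurina_def multiplicity_at_def lines_through_def)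

text \<open>In a generic arrangement all points of \<open>h\<close> have at most one further line, so \<open>card R = card A\<close>
  in every step and \<open>total_tjurina_insert\<close> sums up.\<close>

lemma total_tjurina_generic:
  assumes "line_arrangement A" "generic_arrangement A"
  shows "2 * int (total_tjurina A) = int (card A) * (int (card A) - 1)"
proof -
  have "finite A" using arrangementD(1)[OF assms(1)] .
  then show ?thesis using assms
  proof (induction A rule: finite_induct)
    case (insert h A)
    have arr: "line_arrangement A" using insert.prems by (auto simp: line_arrangement_def)
    have mono: "lines_through A P \<subseteq> lines_through (insert h A) P" for P by (auto simp: lines_through_def)
    have fin: "finite (lines_through (insert h A) P)" for P using insert.hyps(1) by (simp add: finite_lines_through)
    have "multiplicity_at A P \<le> multiplicity_at (insert h A) P" for P
      unfolding multiplicity_at_def by (intro card_mono mono fin)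
    then have gen: "generic_arrangement A" using insert.prems(2) unfolding generic_arrangement_def using le_trans by blast
    obtain R where R: "transversal h A R" using transversal_exists by blast
    have h0: "h \<noteq> (\<lambda>_. 0)" using arrangementD(2)[OF insert.prems(1), of h] by simp
    have "inj_on (meet_pt h) A"
    proof (rule inj_onI, rule ccontr)
      fix a b assume ab: "a \<in> A" "b \<in> A" "meet_pt h a = meet_pt h b" "a \<noteq> b"
      define P where "P = meet_pt h a"
      have "\<not> proportional h a" using arrangementD(3)[OF insert.prems(1), of h a] ab(1) insert.hyps(2) by auto
      then have "P \<in> proj_plane" unfolding P_def by (rule meet_pt_proj_plane[OF h0])
      have "{h, a, b} \<subseteq> lines_through (insert h A) P"
        using lines_through_meet(1)[of h "insert h A" a] lines_through_meet(2)[of a "insert h A" h]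
          lines_through_meet(2)[of b "insert h A" h] ab unfolding P_def by (metis empty_subsetI insertCI insert_subset)
      then have "card {h, a, b} \<le> multiplicity_at (insert h A) P"
        unfolding multiplicity_at_def by (intro card_mono fin)
      moreover have "h \<noteq> a" "h \<noteq> b" using ab insert.hyps(2) by blast+
      then have "card {h, a, b} = 3" using ab(4) by (simp add: card_insert_if)
      ultimately show False using insert.prems(2) \<open>P \<in> proj_plane\<close> unfolding generic_arrangement_def by fastforce
    qed
    then have "card R = card A" using R card_image unfolding transversal_def by metis
    then have "int (total_tjurina (insert h A)) = int (total_tjurina A) + int (card A)"
      using total_tjurina_insert[OF insert.prems(1) insert.hyps(2) R] by simp
    then show ?case using insert.IH[OF arr gen] insert.hyps by (simp add: algebra_simps)
  qed (simp add: total_tjurina_empty)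
qed

section \<open>The Hilbert function of the logarithmic derivations\<close>

lemma has_codim_multiples:
  assumes "homogeneous c p" "p \<noteq> 0"
  shows "has_codim (multiples p k) {0} (binom2 (k - c))"
  using has_codim_iso[OF multiples_iso[OF assms] gs_multiples, where k = "k - c" and k' = k]
    has_codim_polys[of "k - c"] gs_0[OF gs_multiples] by auto

text \<open>In these degrees \<open>D(A)/D(A \<union> {h})\<close> is isomorphic to \<open>(b)/(bl)\<close>, whose Hilbert function is a
  difference of two binomial coefficients.\<close>

lemma deletion_codim:
  assumes arr: "line_arrangement (insert h A)" "h \<notin> A" and R: "transversal h A R"
    and k: "k \<ge> int (card A) - 2" "k \<ge> -1"
  shows "\<exists>n. has_codim (log_der A k) (log_der (insert h A) k) n \<and> int n = k + 1 - int (card A) + int (card R)"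
proof -
  define b l where "b = prod linear_form (A - R)" and "l = linear_form h"
  define c where "c = int (card (A - R))"
  have fin: "finite A" using arrangementD(1)[OF arr(1)] by simp
  have RA: "R \<subseteq> A" using R by (auto simp: transversal_def)
  then have finR: "finite R" using fin by (meson finite_subset)
  have cc: "c + int (card R) = int (card A)"
    unfolding c_def using RA fin finR by (simp add: card_Diff_subset card_mono)
  have "card R \<ge> 1" if "card A \<ge> 1"
  proof -
    have "R \<noteq> {}" using R that by (auto simp: transversal_def)
    then show ?thesis using finR by (simp add: Suc_le_eq card_gt_0_iff)
  qed
  \<comment> \<open>The quadratic formula for the dimension is applied in degrees \<open>k - c\<close> and \<open>k - c - 1\<close>; it is valid from \<open>-2\<close> on.\<close>
  then have kc: "k - c \<ge> -1" using cc k by (cases "card A = 0") auto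
  have b: "homogeneous c b" "b \<noteq> 0" "\<not> l dvd b" and l: "homogeneous 1 l" "prime_elem l"
    using complement_not_dvd[OF arr, of "A - R"] unfolding b_def c_def l_def by (auto intro: homogeneous_prod)
  have l0: "l \<noteq> 0" using l(2) by (auto simp: prime_elem_def)
  define n where "n = binom2 (k - c) - binom2 (k - (c + 1))"
  have sub: "multiples (b * l) k \<subseteq> multiples b k" by (auto simp: multiples_def)
  have bl: "b * l \<noteq> 0" using b(2) l0 by simp
  have d: "binom2 (k - (c + 1)) \<le> binom2 (k - c)" "has_codim (multiples b k) (multiples (b * l) k) n"
    unfolding n_def
    using has_codim_diff[OF gs_subspace[OF gs_multiples] gs_subspace[OF gs_multiples] sub
        has_codim_multiples[OF b(1,2)] has_codim_multiples[OF homogeneous_mult[OF b(1) l(1)] bl]] .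
  have "multiples l k \<subseteq> multiples_mod b l k" for k
    using multiples_subset_restricted[of h k A] restricted_subset[OF arr R, of k] unfolding b_def l_def by blast
  then have "has_codim (multiples_mod b l k) (multiples l k) n"
    using has_codim_iso[OF multiples_mod_iso[OF b(1) l b(3)] gs_multiples_mod] d(2) by simp
  then have "has_codim (restricted h A k) (multiples l k) n"
    using restricted_eq[OF arr R k(1)] by (simp add: b_def l_def)
  then have h: "has_codim (log_der A k) (log_der (insert h A) k) n"
    using has_codim_iso[OF restriction_iso[of h A] gs_restricted multiples_subset_restricted, of k k]
      arrangementD(2)[OF arr(1), of h] by (simp add: l_def)
  have "2 * int n = (k - c + 1) * (k - c + 2) - (k - c) * (k - c + 1)"
    using binom2[of "k - c"] binom2[of "k - (c + 1)"] kc d(1) by (simp add: n_def algebra_simps)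
  then have "int n = k + 1 - c" by (simp add: algebra_simps)
  then show ?thesis using h cc by (intro exI[of _ n]) simp
qed

text \<open>Adding a line to \<open>A\<close> changes the codimension by \<open>k + 1 - card A + card R\<close> and the Tjurina number by
  \<open>2 card A - card R\<close>, so that \<open>card R\<close> cancels in the sum of the two.\<close>

lemma codim_log_der:
  assumes "line_arrangement A" "k \<ge> int (card A) - 3" "k \<ge> -1"
  shows "\<exists>n. has_codim (free UNIV (\<lambda>_. 0) k) (log_der A k) n \<and>
    2 * int n = 2 * int (card A) * (k + 1) + int (card A) * (int (card A) - 1) - 2 * int (total_tjurina A)"
proof -
  have "finite A" using arrangementD(1)[OF assms(1)] .
  then show ?thesis using assms
  proof (induction A rule: finite_induct)
    case empty
    have "has_codim (log_der {} k) (log_der {} k) 0" by (rule has_codim_0_iff[OF gs_subspace[OF gs_log_der] order_refl])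
    then show ?case by (intro exI[of _ 0]) (auto simp: log_der_empty total_tjurina_empty)
  next
    case (insert h A)
    have arr: "line_arrangement A" using insert.prems by (auto simp: line_arrangement_def)
    obtain R where R: "transversal h A R" using transversal_exists by blast
    have c: "int (card (insert h A)) = int (card A) + 1" using insert.hyps by simp
    obtain n where n: "has_codim (free UNIV (\<lambda>_. 0) k) (log_der A k) n"
      "2 * int n = 2 * int (card A) * (k + 1) + int (card A) * (int (card A) - 1) - 2 * int (total_tjurina A)"
      using insert.IH[OF arr] insert.prems c by auto
    obtain m where m: "has_codim (log_der A k) (log_der (insert h A) k) m" "int m = k + 1 - int (card A) + int (card R)"
      using deletion_codim[OF insert.prems(1) insert.hyps(2) R, of k] insert.prems c by auto
    have "has_codim (free UNIV (\<lambda>_. 0) k) (log_der (insert h A) k) (n + m)"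
      using has_codim_add[OF gs_subspace[OF gs_log_der] gs_subspace[OF gs_log_der] _ _ gs_subspace[OF gs_free] n(1) m(1)]
        log_der_mono[of A "insert h A" k] log_der_mono[of "{}" A k] by (auto simp: log_der_empty)
    then show ?case using n(2) m(2) total_tjurina_insert[OF insert.prems(1) insert.hyps(2) R]
      by (intro exI[of _ "n + m"]) (simp add: c algebra_simps)
  qed
qed

section \<open>Jacobian syzygies and the Milnor algebra\<close>

lemma const_fun_eq_0: "(\<lambda>_ :: unit. p) = 0 \<longleftrightarrow> p = (0 :: poly3)"
proof
  assume "(\<lambda>_ :: unit. p) = 0"
  from fun_cong[OF this, of "()"] show "p = 0" by simp
next
  assume "p = 0"
  then show "(\<lambda>_ :: unit. p) = 0" by (intro ext) simp
qed

definition act :: "(3 \<Rightarrow> poly3) \<Rightarrow> poly3 \<Rightarrow> poly3" where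
  "act \<theta> p = (\<Sum>i\<in>UNIV. \<theta> i * partial_deriv i p)"

definition syzygies :: "poly3 \<Rightarrow> 3 family" where
  "syzygies f k = {\<theta>. (\<forall>i. homogeneous k (\<theta> i)) \<and> act \<theta> f = 0}"

definition euler_multiples :: "3 family" where
  "euler_multiples k = {\<theta>. \<exists>p. homogeneous (k - 1) p \<and> \<theta> = p \<cdot> var}"

lemma act_mult: "act \<theta> (p * q) = p * act \<theta> q + act \<theta> p * q"
  by (simp add: act_def sum_UNIV_3 partial_deriv_mult algebra_simps)

lemma act_linear_form: "act \<theta> (linear_form a) = apply_form \<theta> a"
  by (simp add: act_def apply_form_def partial_deriv_linear_form mult.commute)

lemma act_simps: "act 0 f = 0" "act (u - v) f = act u f - act v f"
  "act (u + v) f = act u f + act v f" "act (p \<cdot> u) f = p * act u f"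
  by (auto simp: act_def sum_UNIV_3 algebra_simps)

lemma slinear_act: "slinear (\<lambda>\<theta>. (\<lambda>_ :: unit. act \<theta> f))"
  by (auto simp: slinear_def act_simps fun_eq_iff)

lemma homogeneous_act:
  assumes "\<And>i. homogeneous k (\<theta> i)" "homogeneous d f" shows "homogeneous (k + d - 1) (act \<theta> f)"
  unfolding act_def using assms(1)
  by (intro homogeneous_sum homogeneous_mult'[OF _ homogeneous_partial_deriv[OF assms(2)]]) auto

lemma act_euler: "homogeneous d f \<Longrightarrow> act var f = of_int d * f"
  unfolding act_def by (rule euler_formula)

lemma gs_syzygies: "graded_submodule (syzygies f)"
  by (rule graded_submoduleI) (auto simp: syzygies_def act_simps intro: homogeneous_diff homogeneous_mult')

lemma gs_euler_multiples: "graded_submodule euler_multiples"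
proof (rule graded_submoduleI)
  show "0 \<in> euler_multiples k" for k
    by (auto simp: euler_multiples_def smul_simps intro!: exI[of _ 0])
  fix k u v assume "u \<in> euler_multiples k" "v \<in> euler_multiples k"
  then obtain p q where "homogeneous (k - 1) p" "homogeneous (k - 1) q" "u = p \<cdot> var" "v = q \<cdot> var"
    by (auto simp: euler_multiples_def)
  then show "u - v \<in> euler_multiples k"
    unfolding euler_multiples_def by (intro CollectI exI[of _ "p - q"]) (simp add: homogeneous_diff smul_simps)
next
  fix k p c u assume "u \<in> euler_multiples k" "homogeneous c p"
  then obtain q where "homogeneous (k - 1) q" "u = q \<cdot> var" by (auto simp: euler_multiples_def)
  then show "p \<cdot> u \<in> euler_multiples (k + c)" using \<open>homogeneous c p\<close>
    unfolding euler_multiples_def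
    by (intro CollectI exI[of _ "p * q"] conjI) (auto simp: smul_simps intro!: homogeneous_mult'[of c p "k - 1" q])
qed

lemma smul_var_eq_0: "p \<cdot> var = 0 \<longleftrightarrow> p = 0"
proof
  assume "p \<cdot> var = 0"
  then have "p * var 0 = 0" by (metis smul_apply zero_fun_apply)
  moreover have "var 0 \<noteq> 0"
  proof
    assume "var 0 = 0"
    then have "partial_deriv 0 (var 0) = 0" by simp
    then show False by (simp add: partial_deriv_var)
  qed
  ultimately show "p = 0" by simp
qed (simp add: smul_simps)

lemma euler_iso: "quotient_iso 1 (\<lambda>v. v () \<cdot> var) polys (\<lambda>_. {0}) euler_multiples (\<lambda>_. {0})"
proof (rule quotient_isoI)
  show "slinear (\<lambda>v. v () \<cdot> var)" by (auto simp: slinear_def smul_simps)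
  fix k and v assume "v \<in> euler_multiples (k + 1)"
  then obtain p where "homogeneous k p" "v = p \<cdot> var" by (auto simp: euler_multiples_def)
  then show "\<exists>u\<in>polys k. v - u () \<cdot> var \<in> {0}"
    by (intro bexI[of _ "\<lambda>_. p"]) (auto simp: polys_iff)
next
  fix k and u :: "unit \<Rightarrow> poly3" assume "u \<in> polys k"
  then show "u () \<cdot> var \<in> euler_multiples (k + 1)" by (auto simp: polys_iff euler_multiples_def)
  show "u () \<cdot> var \<in> {0} \<longleftrightarrow> u \<in> {0}" by (auto simp: smul_var_eq_0 unit_fun_eq)
qed (rule gs_polys gs_zero)+

definition jacobian :: "poly3 \<Rightarrow> unit family" where
  "jacobian f k = {v. homogeneous k (v ()) \<and> v () \<in> jacobian_ideal f}"

interpretation poly3_module: module "(*) :: poly3 \<Rightarrow> poly3 \<Rightarrow> poly3"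
  by unfold_locales (auto simp: algebra_simps)

lemma jacobian_ideal_iff: "p \<in> jacobian_ideal f \<longleftrightarrow> (\<exists>\<theta>. p = act \<theta> f)"
proof -
  have "range (\<lambda>i. partial_deriv i f) = {partial_deriv 0 f, partial_deriv 1 f, partial_deriv 2 f}"
    by (auto simp: UNIV_3)
  then have "p \<in> jacobian_ideal f \<longleftrightarrow> (\<exists>a b c. p = a * partial_deriv 0 f + b * partial_deriv 1 f + c * partial_deriv 2 f)"
    by (simp add: jacobian_ideal_def ideal_gen_def poly3_module.span_breakdown_eq algebra_simps)
  also have "\<dots> \<longleftrightarrow> (\<exists>\<theta>. p = act \<theta> f)"
  proof
    assume "\<exists>a b c. p = a * partial_deriv 0 f + b * partial_deriv 1 f + c * partial_deriv 2 f"
    then obtain a b c where "p = a * partial_deriv 0 f + b * partial_deriv 1 f + c * partial_deriv 2 f" by blast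
    then show "\<exists>\<theta>. p = act \<theta> f"
      by (intro exI[of _ "\<lambda>i. if i = 0 then a else if i = 1 then b else c"]) (simp add: act_def sum_UNIV_3)
  qed (auto simp: act_def sum_UNIV_3)
  finally show ?thesis .
qed

lemma gs_jacobian: "graded_submodule (jacobian f)"
proof (rule graded_submoduleI)
  fix k u v assume "u \<in> jacobian f k" "v \<in> jacobian f k"
  then obtain \<theta> \<eta> where "homogeneous k (u ())" "homogeneous k (v ())" "u () = act \<theta> f" "v () = act \<eta> f"
    by (auto simp: jacobian_def jacobian_ideal_iff)
  then have "homogeneous k ((u - v) ())" "(u - v) () = act (\<theta> - \<eta>) f"
    by (simp_all add: homogeneous_diff act_simps)
  then show "u - v \<in> jacobian f k" unfolding jacobian_def jacobian_ideal_iff by blast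
next
  fix k p c u assume "u \<in> jacobian f k" and p: "homogeneous c p"
  then obtain \<theta> where "homogeneous k (u ())" "u () = act \<theta> f"
    by (auto simp: jacobian_def jacobian_ideal_iff)
  then show "p \<cdot> u \<in> jacobian f (k + c)" using homogeneous_mult'[OF p, of k "u ()" "k + c"]
    by (auto simp: jacobian_def jacobian_ideal_iff intro!: exI[of _ "p \<cdot> \<theta>"] simp: act_simps)
qed (auto simp: jacobian_def jacobian_ideal_iff act_simps intro!: exI[of _ 0])

text \<open>The Jacobian ideal is the image of \<open>\<theta> \<mapsto> \<theta>(f)\<close>, which raises degrees by \<open>d - 1\<close>. A homogeneous
  element of the ideal is the image of a homogeneous component.\<close>

lemma jacobian_iso:
  assumes f: "homogeneous d f"
  shows "quotient_iso (d - 1) (\<lambda>\<theta> _. act \<theta> f) (free UNIV (\<lambda>_. 0)) (syzygies f) (jacobian f) (\<lambda>_. {0})"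
proof (rule quotient_isoI)
  fix k and v assume "v \<in> jacobian f (k + (d - 1))"
  then obtain \<theta> where t: "homogeneous (k + (d - 1)) (v ())" "v () = act \<theta> f"
    by (auto simp: jacobian_def jacobian_ideal_iff)
  have "v () = hcomp (k + (d - 1)) (act \<theta> f)" using hcomp_homogeneous[OF t(1)] t(2) by simp
  also have "\<dots> = act (\<lambda>i. hcomp k (\<theta> i)) f"
    unfolding act_def hcomp_sum
  proof (intro sum.cong refl)
    fix i
    show "hcomp (k + (d - 1)) (\<theta> i * partial_deriv i f) = hcomp k (\<theta> i) * partial_deriv i f"
      using hcomp_mult[OF homogeneous_partial_deriv[OF f], of "k + (d - 1)" i "\<theta> i"]
      by (simp only: mult.commute add_diff_cancel_right')
  qed
  finally show "\<exists>u\<in>free UNIV (\<lambda>_. 0) k. v - (\<lambda>_. act u f) \<in> {0}"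
    by (intro bexI[of _ "\<lambda>i. hcomp k (\<theta> i)"]) (auto simp: free_def unit_fun_eq)
next
  fix k and u :: "3 \<Rightarrow> poly3" assume u: "u \<in> free UNIV (\<lambda>_. 0) k"
  then show "(\<lambda>_. act u f) \<in> jacobian f (k + (d - 1))"
    using homogeneous_act[of k u d f] f by (auto simp: jacobian_def jacobian_ideal_iff free_def algebra_simps)
  show "(\<lambda>_ :: unit. act u f) \<in> {0} \<longleftrightarrow> u \<in> syzygies f k" 
    unfolding singleton_iff const_fun_eq_0 using u by (simp add: syzygies_def free_def)
qed (rule slinear_act gs_free gs_zero)+

locale arrangement =
  fixes A :: "vec3 set" and d :: nat and f :: poly3
  assumes arr: "line_arrangement A" and card_A: "card A = d" and d_pos: "d \<ge> 1" and f_def: "f = defining_poly A"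
begin

lemma fin: "finite A" using arrangementD(1)[OF arr] .

lemma f_prod: "f = prod linear_form A" by (simp add: f_def defining_poly_def)

lemma homogeneous_f: "homogeneous (int d) f"
  unfolding f_prod card_A[symmetric] by (intro homogeneous_prod) auto

lemma f_nonzero: "f \<noteq> 0"
  unfolding f_prod using arrangementD(2)[OF arr] fin by (auto simp: linear_form_eq_0_iff)

lemma f_remove: "a \<in> A \<Longrightarrow> f = linear_form a * prod linear_form (A - {a})"
  unfolding f_prod by (rule prod.remove[OF fin])

text \<open>If \<open>\<theta>(f) = 0\<close>, the product rule for \<open>f = l\<^sub>a q\<close> shows that \<open>l\<^sub>a\<close> divides \<open>\<theta>(l\<^sub>a) q\<close>, and \<open>l\<^sub>a\<close> is
  prime to \<open>q\<close>.\<close>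

lemma syzygies_subset: "syzygies f k \<subseteq> log_der A k"
proof
  fix \<theta> assume t: "\<theta> \<in> syzygies f k"
  have "linear_form a dvd apply_form \<theta> a" if a: "a \<in> A" for a
  proof -
    have "linear_form a * act \<theta> (prod linear_form (A - {a})) + apply_form \<theta> a * prod linear_form (A - {a}) = 0"
      using t f_remove[OF a] by (simp add: syzygies_def act_mult act_linear_form)
    then have "apply_form \<theta> a * prod linear_form (A - {a}) = linear_form a * - act \<theta> (prod linear_form (A - {a}))"
      by (simp add: eq_neg_iff_add_eq_0 add.commute)
    then have "linear_form a dvd apply_form \<theta> a * prod linear_form (A - {a})" by simp
    moreover have "insert a (A - {a}) = A" using a by auto
    then have "\<not> linear_form a dvd prod linear_form (A - {a})" "prime_elem (linear_form a)"
      using complement_not_dvd[of a "A - {a}" "A - {a}"] arr by auto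
    ultimately show ?thesis unfolding prime_elem_def by blast
  qed
  then show "\<theta> \<in> log_der A k" using t by (simp add: syzygies_def log_der_def)
qed

lemma f_dvd_act:
  assumes "\<And>a. a \<in> A \<Longrightarrow> linear_form a dvd apply_form \<theta> a" shows "f dvd act \<theta> f"
proof -
  have "prod linear_form T dvd act \<theta> (prod linear_form T)" if "T \<subseteq> A" for T
  proof -
    have "finite T" using that fin by (rule finite_subset)
    then show ?thesis using that
    proof (induction T rule: finite_induct)
      case (insert a T)
      have "act \<theta> (linear_form a * prod linear_form T) =
        linear_form a * act \<theta> (prod linear_form T) + apply_form \<theta> a * prod linear_form T"
        by (simp add: act_mult act_linear_form)
      moreover have "linear_form a * prod linear_form T dvd linear_form a * act \<theta> (prod linear_form T)"
        using insert by (intro mult_dvd_mono) auto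
      moreover have "linear_form a * prod linear_form T dvd apply_form \<theta> a * prod linear_form T"
        using insert assms by (intro mult_dvd_mono) auto
      ultimately show ?case using insert.hyps by (simp add: dvd_add)
    qed (simp add: act_def)
  qed
  from this[of A] show ?thesis unfolding f_prod by simp
qed

lemma euler_in_log_der: "euler_multiples k \<subseteq> log_der A k"
proof
  fix \<theta> assume "\<theta> \<in> euler_multiples k"
  then obtain p where p: "homogeneous (k - 1) p" "\<theta> = p \<cdot> var" by (auto simp: euler_multiples_def)
  have "apply_form \<theta> a = p * linear_form a" for a
    unfolding p(2) apply_form_simps by (simp add: apply_form_def linear_form_eq)
  moreover have "homogeneous k (\<theta> i)" for i
    unfolding p(2) smul_apply by (rule homogeneous_mult'[OF p(1) homogeneous_var]) simp
  ultimately show "\<theta> \<in> log_der A k" by (simp add: log_der_def)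
qed

lemma act_euler_f: "act (p \<cdot> var) f = 0 \<longleftrightarrow> p = 0"
proof -
  have "act (p \<cdot> var) f = p * (const (of_int (int d)) * f)"
    by (simp add: act_simps act_euler[OF homogeneous_f] const_of_nat)
  then show ?thesis using f_nonzero d_pos by simp
qed

text \<open>If \<open>\<theta>(f) = f g\<close>, subtract \<open>g/d\<close> times the Euler derivation, which maps \<open>f\<close> to \<open>d f\<close>.\<close>

lemma log_der_split:
  assumes t: "\<theta> \<in> log_der A k" shows "\<exists>p. homogeneous (k - 1) p \<and> \<theta> - p \<cdot> var \<in> syzygies f k"
proof -
  have h: "homogeneous (k + int d - 1) (act \<theta> f)"
    using t homogeneous_f by (intro homogeneous_act) (auto simp: log_der_def)
  obtain g where g: "homogeneous (k + int d - 1 - int d) g" "act \<theta> f = f * g"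
    using homogeneous_dvd[OF homogeneous_f h] f_dvd_act[of \<theta>] t by (auto simp: log_der_def)
  define p where "p = const (1 / of_nat d) * g"
  have p: "homogeneous (k - 1) p" unfolding p_def using g(1) by (intro homogeneous_const_mult) simp
  have c: "const (1 / of_nat d) * of_nat d = 1"
    using d_pos by (simp add: const_simps(4) flip: const_of_nat const_simps(2))
  have "act (p \<cdot> var) f = (const (1 / of_nat d) * of_nat d) * (f * g)"
    unfolding act_simps(4) act_euler[OF homogeneous_f] p_def of_int_of_nat_eq by (simp only: ac_simps)
  also have "\<dots> = f * g" unfolding c by simp
  finally have "act (\<theta> - p \<cdot> var) f = 0" by (simp add: act_simps(2) g(2))
  moreover have "homogeneous k ((\<theta> - p \<cdot> var) i)" for i
    using t homogeneous_mult'[OF p homogeneous_var, of k i] by (auto simp: log_der_def intro: homogeneous_diff)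
  ultimately show ?thesis using p by (auto simp: syzygies_def)
qed

text \<open>The decomposition of \<open>D(A)\<close> into syzygies and multiples of the Euler derivation, read as an
  isomorphism of the first summand with the quotient by the second. The next lemma exchanges the summands.\<close>

lemma syzygies_iso: "quotient_iso 0 (\<lambda>v. v) (syzygies f) (\<lambda>_. {0}) (log_der A) euler_multiples"
proof (rule quotient_isoI)
  fix k v assume "v \<in> log_der A (k + 0)"
  then obtain p where "homogeneous (k - 1) p" "v - p \<cdot> var \<in> syzygies f k" using log_der_split by auto
  then show "\<exists>u\<in>syzygies f k. v - u \<in> euler_multiples (k + 0)"
    by (intro bexI[of _ "v - p \<cdot> var"]) (auto simp: euler_multiples_def)
next
  fix k u assume u: "u \<in> syzygies f k"
  show "u \<in> euler_multiples (k + 0) \<longleftrightarrow> u \<in> {0}"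
  proof
    assume "u \<in> euler_multiples (k + 0)"
    then obtain p where "u = p \<cdot> var" by (auto simp: euler_multiples_def)
    then show "u \<in> {0}" using u act_euler_f[of p] by (simp add: syzygies_def smul_simps)
  qed (simp add: gs_0[OF gs_euler_multiples])
qed (use syzygies_subset in \<open>auto simp: slinear_id gs_syzygies gs_euler_multiples\<close>)

lemma euler_quotient_iso: "quotient_iso 0 (\<lambda>v. v) euler_multiples (\<lambda>_. {0}) (log_der A) (syzygies f)"
proof (rule quotient_isoI)
  fix k v assume "v \<in> log_der A (k + 0)"
  then obtain p where "homogeneous (k - 1) p" "v - p \<cdot> var \<in> syzygies f k" using log_der_split by auto
  then show "\<exists>u\<in>euler_multiples k. v - u \<in> syzygies f (k + 0)"
    by (intro bexI[of _ "p \<cdot> var"]) (auto simp: euler_multiples_def)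
next
  fix k u assume u: "u \<in> euler_multiples k"
  then obtain p where p: "u = p \<cdot> var" by (auto simp: euler_multiples_def)
  show "u \<in> syzygies f (k + 0) \<longleftrightarrow> u \<in> {0}"
  proof
    assume "u \<in> syzygies f (k + 0)"
    then show "u \<in> {0}" using act_euler_f[of p] by (simp add: p syzygies_def smul_simps)
  qed (simp add: gs_0[OF gs_syzygies])
qed (use euler_in_log_der in \<open>auto simp: slinear_id gs_syzygies gs_euler_multiples\<close>)

lemma regular_syzygies:
  assumes "regular r (log_der A) (\<lambda>_. {0})" "r \<ge> 0"
  shows "regular r (syzygies f) (\<lambda>_. {0})"
proof -
  have "regular (r + 1) euler_multiples (\<lambda>_. {0})"
    using regular_iso[OF euler_iso, of r] regular_polys[OF assms(2)] by simp
  then have "regular r (log_der A) euler_multiples"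
    using assms(1) euler_in_log_der gs_0[OF gs_euler_multiples]
    by (rule_tac regular_quotient[OF gs_euler_multiples gs_log_der _ _ _ _ gs_zero]) auto
  then show ?thesis using regular_iso[OF syzygies_iso, of r] by simp
qed

lemma syzygies_free: "syzygies f k \<subseteq> free UNIV (\<lambda>_. 0) k"
  by (auto simp: syzygies_def free_def)

text \<open>The two exact sequences \<open>0 \<rightarrow> syz(f) \<rightarrow> S\<^sup>3 \<rightarrow> J(d - 1) \<rightarrow> 0\<close> and \<open>0 \<rightarrow> J \<rightarrow> S \<rightarrow> S/J \<rightarrow> 0\<close>.\<close>

lemma regular_milnor:
  assumes "regular (r + 1) (syzygies f) (\<lambda>_. {0})" "r \<ge> 0" "r + int d \<ge> 2"
  shows "regular (r + int d - 2) polys (jacobian f)"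
proof -
  have "regular r (free UNIV (\<lambda>_. 0)) (syzygies f)"
    using assms regular_free[of UNIV "\<lambda>_. 0" r] syzygies_free gs_0[OF gs_syzygies]
    by (rule_tac regular_quotient[OF gs_syzygies gs_free _ _ _ _ gs_zero]) auto
  then have "regular (r + int d - 2 + 1) (jacobian f) (\<lambda>_. {0})"
    using regular_iso[OF jacobian_iso[OF homogeneous_f], of r] by (simp add: algebra_simps)
  moreover have "regular (r + int d - 2) polys (\<lambda>_. {0})"
    using assms(3) by (intro regular_polys) simp
  ultimately show ?thesis
    using gs_0[OF gs_jacobian]
    by (rule_tac regular_quotient[OF gs_jacobian gs_polys _ _ _ _ gs_zero]) (auto simp: jacobian_def polys_iff)
qed

text \<open>The codimension of \<open>D(A)\<close> plus the dimension of the multiples of the Euler derivation.\<close>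

lemma codim_syzygies:
  assumes "k \<ge> int d - 3" "k \<ge> -1"
  shows "\<exists>n. has_codim (free UNIV (\<lambda>_. 0) k) (syzygies f k) n \<and>
    2 * int n = (k + int d) * (k + int d + 1) - 2 * int (total_tjurina A)"
proof -
  obtain n where n: "has_codim (free UNIV (\<lambda>_. 0) k) (log_der A k) n"
    "2 * int n = 2 * int d * (k + 1) + int d * (int d - 1) - 2 * int (total_tjurina A)"
    using codim_log_der[OF arr, of k] assms card_A by auto
  have "has_codim (euler_multiples k) {0} (binom2 (k - 1))"
    using has_codim_iso[OF euler_iso gs_euler_multiples, where k = "k - 1" and k' = k] has_codim_polys[of "k - 1"]
      gs_0[OF gs_euler_multiples] by auto
  then have "has_codim (log_der A k) (syzygies f k) (binom2 (k - 1))"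
    using has_codim_iso[OF euler_quotient_iso gs_log_der syzygies_subset, where k = k and k' = k] by simp
  then have "has_codim (free UNIV (\<lambda>_. 0) k) (syzygies f k) (n + binom2 (k - 1))"
    using has_codim_add[OF gs_subspace[OF gs_log_der] gs_subspace[OF gs_syzygies] _ syzygies_subset gs_subspace[OF gs_free] n(1)]
      log_der_mono[of "{}" A k] by (auto simp: log_der_empty)
  moreover have "2 * int (n + binom2 (k - 1)) = (k + int d) * (k + int d + 1) - 2 * int (total_tjurina A)"
    using n(2) binom2[of "k - 1"] assms by (simp add: algebra_simps)
  ultimately show ?thesis by blast
qed

text \<open>\<open>J\<close> in degree \<open>K = k + d - 1\<close> is \<open>S\<^sub>k\<^sup>3\<close> modulo the syzygies of degree \<open>k\<close>.\<close>

lemma milnor_dim_eq: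
  assumes n: "has_codim (free UNIV (\<lambda>_. 0) k) (syzygies f k) n" and K: "int K = k + int d - 1"
  shows "n \<le> binom2 (int K)" "milnor_dim f K = binom2 (int K) - n"
proof -
  have J: "has_codim (jacobian f (int K)) {0} n"
    using has_codim_iso[OF jacobian_iso[OF homogeneous_f] gs_jacobian, where k = k and k' = "int K"] n K
      gs_0[OF gs_jacobian] by auto
  have sub: "jacobian f (int K) \<subseteq> polys (int K)" by (auto simp: jacobian_def polys_iff)
  have c: "n \<le> binom2 (int K)" "has_codim (polys (int K)) (jacobian f (int K)) (binom2 (int K) - n)"
    using has_codim_diff[OF gs_subspace[OF gs_polys] gs_subspace[OF gs_jacobian] sub has_codim_polys J] by auto
  have l: "lift (graded_piece K) = polys (int K)" "lift (jacobian_ideal f \<inter> graded_piece K) = jacobian f (int K)"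
    by (auto simp: lift_def graded_piece_def polys_iff jacobian_def)
  show "n \<le> binom2 (int K)" by (rule c)
  show "milnor_dim f K = binom2 (int K) - n"
    unfolding milnor_dim_def
    using gs_subspace[OF gs_polys] gs_subspace[OF gs_jacobian] c(2) by (intro quotient_dim_eq) (simp_all only: l)
qed

lemma milnor_dim_stable:
  assumes "int K \<ge> 2 * int d - 4" "int K \<ge> int d - 2"
  shows "milnor_dim f K = total_tjurina A"
proof -
  define k where "k = int K - int d + 1"
  obtain n where n: "has_codim (free UNIV (\<lambda>_. 0) k) (syzygies f k) n"
    "2 * int n = (k + int d) * (k + int d + 1) - 2 * int (total_tjurina A)"
    using codim_syzygies[of k] assms by (auto simp: k_def)
  have K: "int K = k + int d - 1" by (simp add: k_def)
  have "2 * int (binom2 (int K)) = (k + int d) * (k + int d + 1)"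
  proof -
    have e: "int K + 1 = k + int d" "int K + 2 = k + int d + 1" using K by auto
    have b: "2 * int (binom2 (int K)) = (int K + 1) * (int K + 2)" by (rule binom2) simp
    show ?thesis unfolding b unfolding e ..
  qed
  then have "int n = int (binom2 (int K)) - int (total_tjurina A)" using n(2) by simp
  then show ?thesis using milnor_dim_eq[OF n(1) K] by simp
qed

lemma st_le:
  assumes "d \<ge> 2" shows "st A \<le> 2 * d - 4"
  unfolding st_def f_def[symmetric]
proof (rule Least_le, intro allI impI)
  fix k assume "2 * d - 4 \<le> k"
  then show "milnor_dim f k = total_tjurina A" using assms by (intro milnor_dim_stable) auto
qed

end

section \<open>Generators of regular modules\<close>

lemma mcoeff_var_mult [simp]: "mcoeff (var i * p) 0 = 0"
  by (simp add: mcoeff_mult_0 mcoeff_0_homogeneous[OF homogeneous_var])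

text \<open>Vanishing of \<open>H\<^sub>0\<close>: in degrees above \<open>s\<close> the module \<open>N/Z\<close> is \<open>(x, y, z)\<close> times the next lower piece.\<close>

lemma regular_generated:
  assumes reg: "regular s N Z" and N: "graded_submodule N" and Z: "graded_submodule Z"
    and v: "v \<in> N k" "k > s"
  shows "\<exists>b0\<in>N (k - 1). \<exists>b1\<in>N (k - 1). \<exists>b2\<in>N (k - 1). v - (var 0 \<cdot> b0 + var 1 \<cdot> b1 + var 2 \<cdot> b2) \<in> Z k"
proof -
  define c :: "'a chain" where "c = (\<lambda>t. if t = (False, False, False) then v else 0)"
  have deg: "in_degree 0 c" unfolding in_degree_def all_bool3 by (simp add: c_def)
  have "c \<in> chains N k"
  proof (rule chainsI)
    fix t show "c t \<in> N (k - int (wt t))" using v gs_0[OF N] by (auto simp: c_def)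
  qed
  moreover have "koszul c \<in> chains Z k" unfolding koszul_degree_0[OF deg] by (rule chains_0[OF Z])
  ultimately obtain b where b: "b \<in> chains N k" "c - koszul b \<in> chains Z k"
    using reg v(2) deg unfolding regular_def by force
  have "v - (var 0 \<cdot> b (True, False, False) + var 1 \<cdot> b (False, True, False) + var 2 \<cdot> b (False, False, True)) \<in> Z k"
    using chainsD[OF b(2), of k "(False, False, False)"] by (simp add: koszul_def c_def neg_if_def)
  moreover have "b (True, False, False) \<in> N (k - 1)" "b (False, True, False) \<in> N (k - 1)" "b (False, False, True) \<in> N (k - 1)"
    by (auto intro: chainsD[OF b(1)])
  ultimately show ?thesis by blast
qed

text \<open>A basis vector \<open>e\<^sub>j\<close> of degree above \<open>s\<close> would be congruent modulo \<open>K\<close> to a vector with entries in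
  \<open>(x, y, z)\<close>; the difference lies in \<open>K\<close> and has the constant term \<open>1\<close> at position \<open>j\<close>.\<close>

lemma generator_degree_bound:
  assumes reg: "regular s (free I a) K" and K: "graded_submodule K"
    and min: "\<And>k v j. v \<in> K k \<Longrightarrow> mcoeff (v j) 0 = 0" and j: "j \<in> I"
  shows "a j \<le> s"
proof (rule ccontr)
  assume "\<not> a j \<le> s"
  define e :: "'a \<Rightarrow> poly3" where "e = (\<lambda>i. if i = j then 1 else 0)"
  have "e \<in> free I a (a j)" using j by (auto simp: e_def free_def)
  then obtain b0 b1 b2 where "e - (var 0 \<cdot> b0 + var 1 \<cdot> b1 + var 2 \<cdot> b2) \<in> K (a j)"
    using regular_generated[OF reg gs_free K] \<open>\<not> a j \<le> s\<close> by force
  from min[OF this, of j] show False by (simp add: e_def lookup_minus lookup_add lookup_one)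
qed

section \<open>Maps between graded free modules\<close>

definition mat_map :: "poly3 mat \<Rightarrow> (nat \<Rightarrow> poly3) \<Rightarrow> (nat \<Rightarrow> poly3)" where
  "mat_map M v = (\<lambda>i. if i < dim_row M then \<Sum>j<dim_col M. M $$ (i, j) * v j else 0)"

text \<open>Vectors of a fixed length correspond to functions that vanish from that length on. All maps are studied on
  functions, where vectors of different lengths share one type.\<close>

definition of_vec :: "poly3 vec \<Rightarrow> nat \<Rightarrow> poly3" where
  "of_vec v = (\<lambda>j. if j < dim_vec v then v $ j else 0)"

definition supported :: "nat \<Rightarrow> (nat \<Rightarrow> poly3) set" where
  "supported n = {v. \<forall>j\<ge>n. v j = 0}"

lemma slinear_mat_map: "slinear (mat_map M)"
  unfolding slinear_def
proof (intro conjI allI ext)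
  fix u v p i
  show "mat_map M (u + v) i = (mat_map M u + mat_map M v) i"
    by (simp add: mat_map_def distrib_left sum.distrib)
  show "mat_map M (p \<cdot> u) i = (p \<cdot> mat_map M u) i"
  proof -
    have "(\<Sum>j<dim_col M. M $$ (i, j) * (p * u j)) = p * (\<Sum>j<dim_col M. M $$ (i, j) * u j)"
      unfolding sum_distrib_left by (intro sum.cong refl mult.left_commute)
    then show ?thesis unfolding mat_map_def smul_apply by (auto simp del: mult_eq_0_iff)
  qed
qed

lemma of_vec_supported: "v \<in> carrier_vec n \<Longrightarrow> of_vec v \<in> supported n"
  by (auto simp: of_vec_def supported_def)

lemma of_vec_vec: "v \<in> supported n \<Longrightarrow> of_vec (vec n v) = v"
  by (auto simp: of_vec_def supported_def fun_eq_iff)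

lemma vec_of_vec: "v \<in> carrier_vec n \<Longrightarrow> vec n (of_vec v) = v"
  by (auto simp: of_vec_def)

lemma of_vec_inj: "v \<in> carrier_vec n \<Longrightarrow> w \<in> carrier_vec n \<Longrightarrow> of_vec v = of_vec w \<Longrightarrow> v = w"
  using vec_of_vec by metis

lemma of_vec_mult:
  assumes "M \<in> carrier_mat n m" "w \<in> carrier_vec m"
  shows "of_vec (M *\<^sub>v w) = mat_map M (of_vec w)"
  using assms by (auto simp: of_vec_def mat_map_def fun_eq_iff scalar_prod_def lessThan_atLeast0)

lemma free_supported: "v \<in> free {..<n} a k \<Longrightarrow> v \<in> supported n"
  by (auto simp: free_def supported_def)

lemma of_vec_zero: "of_vec (0\<^sub>v n) = 0"
  by (auto simp: of_vec_def fun_eq_iff)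

lemma mat_kernel_iff:
  assumes "M \<in> carrier_mat n m" "v \<in> carrier_vec m"
  shows "v \<in> mat_kernel M \<longleftrightarrow> mat_map M (of_vec v) = 0"
proof -
  have "M *\<^sub>v v = 0\<^sub>v n \<longleftrightarrow> of_vec (M *\<^sub>v v) = of_vec (0\<^sub>v n)"
    using of_vec_inj[of "M *\<^sub>v v" n "0\<^sub>v n"] assms by auto
  then show ?thesis using assms by (auto simp: mat_kernel_def of_vec_mult of_vec_zero)
qed

text \<open>The degrees that make the matrix a map of degree \<open>0\<close> from the free module with shifts \<open>b\<close> to the one
  with shifts \<open>a\<close>.\<close>

definition homogeneous_mat :: "poly3 mat \<Rightarrow> (nat \<Rightarrow> int) \<Rightarrow> (nat \<Rightarrow> int) \<Rightarrow> bool" where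
  "homogeneous_mat M a b \<longleftrightarrow> (\<forall>i<dim_row M. \<forall>j<dim_col M. homogeneous (b j - a i) (M $$ (i, j)))"

definition vcomp :: "nat \<Rightarrow> (nat \<Rightarrow> int) \<Rightarrow> int \<Rightarrow> (nat \<Rightarrow> poly3) \<Rightarrow> (nat \<Rightarrow> poly3)" where
  "vcomp n a k v = (\<lambda>j. if j < n then hcomp (k - a j) (v j) else 0)"

lemma vcomp_free: "vcomp n a k v \<in> free {..<n} a k"
  by (auto simp: vcomp_def free_def)

lemma hcomp_same: "homogeneous k p \<Longrightarrow> hcomp k p = p"
  by (simp add: hcomp_homogeneous)

lemma vcomp_id: "v \<in> free {..<n} a k \<Longrightarrow> vcomp n a k v = v"
  by (auto simp: vcomp_def free_def fun_eq_iff hcomp_same)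

lemma mat_map_vcomp:
  assumes "M \<in> carrier_mat n m" "homogeneous_mat M a b"
  shows "mat_map M (vcomp m b k v) = vcomp n a k (mat_map M v)"
proof
  fix i
  show "mat_map M (vcomp m b k v) i = vcomp n a k (mat_map M v) i"
  proof (cases "i < n")
    case True
    have "M $$ (i, j) * vcomp m b k v j = hcomp (k - a i) (M $$ (i, j) * v j)" if "j < m" for j
    proof -
      have "homogeneous (b j - a i) (M $$ (i, j))" using assms that True by (auto simp: homogeneous_mat_def)
      from hcomp_mult[OF this, of "k - a i" "v j"] show ?thesis using that by (simp add: vcomp_def)
    qed
    then show ?thesis using True assms(1) by (simp add: mat_map_def vcomp_def hcomp_sum)
  qed (use assms(1) in \<open>simp add: mat_map_def vcomp_def\<close>)
qed

lemma mat_map_free: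
  assumes "M \<in> carrier_mat n m" "homogeneous_mat M a b" "u \<in> free {..<m} b k"
  shows "mat_map M u \<in> free {..<n} a k"
  using mat_map_vcomp[OF assms(1,2), of k u] vcomp_id[OF assms(3)] vcomp_free by metis

lemma vcomp_0 [simp]: "vcomp n a k 0 = 0"
  by (auto simp: vcomp_def fun_eq_iff)

text \<open>Every vector is the sum of finitely many of its homogeneous components, so exactness need only be known
  for homogeneous vectors.\<close>

lemma supported_sum_vcomp:
  assumes "v \<in> supported n"
  obtains T where "finite T" "v = (\<Sum>k\<in>T. vcomp n a k v)"
proof
  define D where "D j = (\<lambda>m. int (mon_degree m)) ` keys (v j)" for j
  define T where "T = (\<Union>j<n. (\<lambda>e. e + a j) ` D j)"
  show T: "finite T" by (simp add: T_def D_def)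
  show "v = (\<Sum>k\<in>T. vcomp n a k v)"
  proof
    fix j
    have ap: "(\<Sum>k\<in>T. vcomp n a k v) j = (\<Sum>k\<in>T. vcomp n a k v j)"
      using T by (induction T rule: finite_induct) auto
    show "v j = (\<Sum>k\<in>T. vcomp n a k v) j"
    proof (cases "j < n")
      case True
      have "v j = (\<Sum>e\<in>(\<lambda>k. k - a j) ` T. hcomp e (v j))"
        using T True by (intro poly_as_sum_hcomp) (force simp: T_def D_def)+
      also have "\<dots> = (\<Sum>k\<in>T. hcomp (k - a j) (v j))"
        by (subst sum.reindex) (auto simp: inj_on_def)
      finally show ?thesis unfolding ap using True by (simp add: vcomp_def)
    qed (use assms ap in \<open>simp add: vcomp_def supported_def\<close>)
  qed
qed

definition kernel_family :: "poly3 mat \<Rightarrow> (nat \<Rightarrow> int) \<Rightarrow> nat family" where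
  "kernel_family M b k = {u \<in> free {..<dim_col M} b k. mat_map M u = 0}"

lemma gs_kernel_family: "graded_submodule (kernel_family M b)"
proof (rule graded_submoduleI)
  fix k p c u assume "u \<in> kernel_family M b k" "homogeneous c p"
  then show "p \<cdot> u \<in> kernel_family M b (k + c)"
    by (auto simp: kernel_family_def slinear_simps[OF slinear_mat_map] smul_simps(4) intro: gs_smul[OF gs_free])
qed (auto simp: kernel_family_def slinear_simps[OF slinear_mat_map] gs_0[OF gs_free] gs_diff[OF gs_free])

lemma kernel_family_free: "M \<in> carrier_mat n m \<Longrightarrow> kernel_family M b k \<subseteq> free {..<m} b k"
  by (auto simp: kernel_family_def)

lemma mat_map_iso:
  assumes M: "M \<in> carrier_mat n m" "homogeneous_mat M a b"
    and K: "\<And>k. K k = mat_map M ` free {..<m} b k"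
  shows "quotient_iso 0 (mat_map M) (free {..<m} b) (kernel_family M b) K (\<lambda>_. {0})"
proof (rule quotient_isoI)
  fix k v assume "v \<in> K (k + 0)"
  then obtain u where u: "u \<in> free {..<m} b k" "v = mat_map M u" using K by auto
  then show "\<exists>u\<in>free {..<m} b k. v - mat_map M u \<in> {0}" by (intro bexI[of _ u]) auto
qed (use M K in \<open>auto simp: slinear_mat_map gs_free gs_zero kernel_family_def\<close>)

section \<open>The shifts of a minimal resolution\<close>

definition ideal_family :: "poly3 set \<Rightarrow> unit family" where
  "ideal_family I k = {v. homogeneous k (v ()) \<and> v () \<in> I}"

lemma scalar_prod_of_vec: "g \<in> carrier_vec n \<Longrightarrow> v \<in> carrier_vec n \<Longrightarrow> g \<bullet> v = (\<Sum>j<n. g $ j * of_vec v j)"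
  by (simp add: scalar_prod_def of_vec_def lessThan_atLeast0)

text \<open>Let \<open>K i\<close> be the kernel of the map that starts at \<open>F\<^sub>i\<close>, where for \<open>i = 0\<close> this is the map onto
  \<open>S/I\<close>. By induction \<open>F\<^sub>i/K i\<close> is \<open>(r + i)\<close>-regular. By minimality \<open>K i\<close> has entries in \<open>(x, y, z)\<close>, so the shifts
  of \<open>F\<^sub>i\<close> are at most \<open>r + i\<close> and \<open>F\<^sub>i\<close> is \<open>(r + i + 1)\<close>-regular. Hence so is the kernel \<open>K i\<close>,
  which is isomorphic to \<open>F\<^bsub>i+1\<^esub>/K (i + 1)\<close>.\<close>

lemma resolution_shift_bound:
  assumes res: "minimal_graded_free_resolution I n a g D"
    and reg: "regular r polys (ideal_family I)" and gsI: "graded_submodule (ideal_family I)"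
    and graded: "\<And>p k. p \<in> I \<Longrightarrow> hcomp k p \<in> I"
    and j: "j < n i"
  shows "a i j \<le> r + int i"
proof -
  have g: "g \<in> carrier_vec (n 0)" and D: "\<And>i. D i \<in> carrier_mat (n i) (n (Suc i))"
    and gh: "\<And>j. j < n 0 \<Longrightarrow> homogeneous (a 0 j) (g $ j)"
    and Dh: "\<And>i k j. k < n i \<Longrightarrow> j < n (Suc i) \<Longrightarrow> homogeneous (a (Suc i) j - a i k) (D i $$ (k, j))"
    and surj: "\<And>s. \<exists>v\<in>carrier_vec (n 0). s - g \<bullet> v \<in> I"
    and ker0: "{v \<in> carrier_vec (n 0). g \<bullet> v \<in> I} = (\<lambda>w. D 0 *\<^sub>v w) ` carrier_vec (n 1)"
    and ker: "\<And>i. mat_kernel (D i) = (\<lambda>w. D (Suc i) *\<^sub>v w) ` carrier_vec (n (Suc (Suc i)))"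
    and min: "\<And>i k j. k < n i \<Longrightarrow> j < n (Suc i) \<Longrightarrow> mcoeff (D i $$ (k, j)) 0 = 0"
    using res unfolding minimal_graded_free_resolution_def by auto
  have Dhm: "homogeneous_mat (D i) (a i) (a (Suc i))" for i
    using D[of i] Dh unfolding homogeneous_mat_def by auto
  define F where "F i = free {..<n i} (a i)" for i
  define gm where "gm v = (\<lambda>_ :: unit. \<Sum>j<n 0. g $ j * v j)" for v :: "nat \<Rightarrow> poly3"
  define K where "K i = (case i of 0 \<Rightarrow> (\<lambda>k. {v \<in> F 0 k. gm v () \<in> I}) | Suc i' \<Rightarrow> kernel_family (D i') (a i))" for i
  have gm_lin: "slinear gm"
    unfolding slinear_def
  proof (intro conjI allI ext)
    fix u v p i
    show "gm (u + v) i = (gm u + gm v) i" by (simp add: gm_def distrib_left sum.distrib)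
    show "gm (p \<cdot> u) i = (p \<cdot> gm u) i"
      unfolding gm_def smul_apply sum_distrib_left by (intro sum.cong refl mult.left_commute)
  qed
  have gmF: "homogeneous k (gm v ())" if "v \<in> F 0 k" for v k
    unfolding gm_def using that gh by (intro homogeneous_sum homogeneous_mult'[of "a 0 _" _ "k - a 0 _"]) (auto simp: F_def free_def)
  have iso0: "quotient_iso 0 gm (F 0) (K 0) polys (ideal_family I)"
  proof (rule quotient_isoI)
    fix k v assume "v \<in> polys (k + 0)"
    then have h: "homogeneous k (v ())" by (simp add: polys_iff)
    obtain w where w: "w \<in> carrier_vec (n 0)" "v () - g \<bullet> w \<in> I" using surj by blast
    define u where "u = vcomp (n 0) (a 0) k (of_vec w)"
    have u: "u \<in> F 0 k" unfolding u_def F_def by (rule vcomp_free)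
    have "hcomp k (g \<bullet> w) = gm u ()"
      unfolding gm_def scalar_prod_of_vec[OF g w(1)] hcomp_sum
      by (intro sum.cong refl) (simp add: u_def vcomp_def hcomp_mult[OF gh])
    then have "hcomp k (v () - g \<bullet> w) = v () - gm u ()"
      using hcomp_homogeneous[OF h] by (simp add: hcomp_diff)
    then have "v () - gm u () \<in> I" using graded[OF w(2)] by metis
    then show "\<exists>u\<in>F 0 k. v - gm u \<in> ideal_family I (k + 0)"
      using u h gmF[OF u] by (intro bexI[of _ u]) (auto simp: ideal_family_def intro: homogeneous_diff)
  next
    fix k u assume "u \<in> F 0 k"
    then show "gm u \<in> polys (k + 0)" "gm u \<in> ideal_family I (k + 0) \<longleftrightarrow> u \<in> K 0 k"
      using gmF by (auto simp: polys_iff ideal_family_def K_def)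
  qed (auto simp: gm_lin F_def gs_free gsI)
  have lift: "\<exists>u\<in>F (Suc i) k. v = mat_map (D i) u" if "v \<in> F i k" "v = mat_map (D i) w" for v w i k
  proof
    show "vcomp (n (Suc i)) (a (Suc i)) k w \<in> F (Suc i) k" unfolding F_def by (rule vcomp_free)
    show "v = mat_map (D i) (vcomp (n (Suc i)) (a (Suc i)) k w)"
      using mat_map_vcomp[OF D Dhm, of i k w] vcomp_id[of v "n i" "a i" k] that by (simp add: F_def)
  qed
  have K_image: "K i k = mat_map (D i) ` F (Suc i) k" for i k
  proof (rule Set.set_eqI, rule iffI)
    fix v assume v: "v \<in> K i k"
    then have vF: "v \<in> F i k" by (cases i) (use D[of "i - 1"] in \<open>auto simp: K_def kernel_family_def F_def\<close>)
    then have vs: "of_vec (vec (n i) v) = v" by (intro of_vec_vec free_supported[of v "n i" "a i" k]) (simp add: F_def)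
    have "\<exists>w\<in>carrier_vec (n (Suc i)). vec (n i) v = D i *\<^sub>v w"
    proof (cases i)
      case 0
      have "g \<bullet> vec (n 0) v \<in> I" using v vs by (simp add: 0 scalar_prod_of_vec[OF g] K_def gm_def)
      then have "vec (n 0) v \<in> (\<lambda>w. D 0 *\<^sub>v w) ` carrier_vec (n 1)" using ker0 by auto
      then show ?thesis using 0 by auto
    next
      case (Suc i')
      have "vec (n i) v \<in> mat_kernel (D i')"
        using v vs mat_kernel_iff[OF D, of "vec (n i) v" i'] by (auto simp: Suc K_def kernel_family_def)
      then show ?thesis using ker[of i'] Suc by auto
    qed
    then obtain w where w: "w \<in> carrier_vec (n (Suc i))" "vec (n i) v = D i *\<^sub>v w" by blast
    then have "v = mat_map (D i) (of_vec w)" using vs of_vec_mult[OF D w(1)] by metis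
    then show "v \<in> mat_map (D i) ` F (Suc i) k" using lift[OF vF] by blast
  next
    fix v assume "v \<in> mat_map (D i) ` F (Suc i) k"
    then obtain u where u: "u \<in> F (Suc i) k" "v = mat_map (D i) u" by blast
    have us: "of_vec (vec (n (Suc i)) u) = u" using u(1) by (intro of_vec_vec free_supported) (auto simp: F_def)
    define w where "w = D i *\<^sub>v vec (n (Suc i)) u"
    have w: "w \<in> carrier_vec (n i)" "of_vec w = v"
      unfolding w_def using D[of i] of_vec_mult[OF D, of "vec (n (Suc i)) u" i] us u(2) by auto
    have vF: "v \<in> F i k" using mat_map_free[OF D Dhm] u by (simp add: F_def)
    show "v \<in> K i k"
    proof (cases i)
      case 0
      have "w \<in> {v \<in> carrier_vec (n 0). g \<bullet> v \<in> I}" unfolding ker0 by (simp add: w_def 0)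
      then have "w \<in> carrier_vec (n 0)" "g \<bullet> w \<in> I" by auto
      then show ?thesis using vF w by (simp add: 0 K_def gm_def scalar_prod_of_vec[OF g])
    next
      case (Suc i')
      have "w \<in> mat_kernel (D i')" unfolding ker by (simp add: w_def Suc)
      then have "mat_map (D i') v = 0" using mat_kernel_iff[OF D, of w i'] w Suc by simp
      then show ?thesis using vF D[of i'] by (simp add: Suc K_def kernel_family_def F_def)
    qed
  qed
  have gsK: "graded_submodule (K i)" for i
  proof (cases i)
    case 0
    have m: "u \<in> K 0 k \<longleftrightarrow> u \<in> F 0 k \<and> gm u \<in> ideal_family I k" for u k
      using gmF by (auto simp: K_def ideal_family_def)
    show ?thesis unfolding 0
      by (intro graded_submoduleI)
        (auto simp: m slinear_simps[OF gm_lin] F_def gs_0[OF gs_free] gs_diff[OF gs_free] gs_0[OF gsI] gs_diff[OF gsI]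
          intro: gs_smul[OF gs_free] gs_smul[OF gsI])
  qed (simp add: K_def gs_kernel_family)
  have Kmin: "mcoeff (v j) 0 = 0" if vK: "v \<in> K i k" for i k v j
  proof -
    obtain u where "v = mat_map (D i) u" using vK K_image by auto
    then show ?thesis using D[of i] min by (auto simp: mat_map_def lookup_sum mcoeff_mult_0)
  qed
  have "regular (r + int i) (F i) (K i)" for i
  proof (induction i)
    case 0
    then show ?case using regular_iso[OF iso0, of r] reg by simp
  next
    case (Suc i)
    have "\<forall>j<n i. a i j \<le> r + int i"
      using generator_degree_bound[OF Suc[unfolded F_def] gsK] Kmin by blast
    then have "regular (r + int i + 1) (F i) (\<lambda>_. {0})" unfolding F_def by (intro regular_free) auto
    then have "regular (r + int i + 1) (K i) (\<lambda>_. {0})"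
    proof (rule regular_kernel[OF gsK gs_zero _ _ _ Suc, rotated 2])
      show "{0} \<subseteq> K i k" for k by (simp add: gs_0[OF gsK])
      show "K i k \<subseteq> F i k" for k unfolding K_image F_def using mat_map_free[OF D Dhm] by blast
    qed
    then show ?case
      using regular_iso[OF mat_map_iso[OF D Dhm], of "K i" i "r + int i + 1"] K_image
      by (simp add: F_def K_def algebra_simps)
  qed
  from generator_degree_bound[OF this[of i, unfolded F_def] gsK] show ?thesis using j Kmin by blast
qed

section \<open>Finite and minimal systems of generators\<close>

text \<open>A generator is a pair of a degree and an element of that degree, since the zero vector has no degree
  of its own.\<close>

definition generates :: "nat family \<Rightarrow> (int \<times> (nat \<Rightarrow> poly3)) set \<Rightarrow> bool" where
  "generates K G \<longleftrightarrow> (\<forall>p\<in>G. snd p \<in> K (fst p)) \<and>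
     (\<forall>k. \<forall>v\<in>K k. \<exists>u. (\<forall>p\<in>G. homogeneous (k - fst p) (u p)) \<and> v = (\<Sum>p\<in>G. u p \<cdot> snd p))"

lemma finite_basis:
  fixes K :: "nat family"
  assumes K: "graded_submodule K" and sub: "K k \<subseteq> free {..<n} a k"
  shows "\<exists>B. finite B \<and> B \<subseteq> K k \<and> (\<forall>v\<in>K k. \<exists>c. v = (\<Sum>b\<in>B. const (c b) \<cdot> b))"
proof -
  have s0: "subspace {0 :: nat \<Rightarrow> poly3}" by (auto simp: subspace_def smul_simps)
  have "has_codim (free {..<n} a k) {0} (\<Sum>j<n. binom2 (k - a j))"
    by (rule has_codim_free) simp
  then obtain m where "has_codim (K k) {0} m"
    using has_codim_exists[OF gs_subspace[OF K] s0 s0 order_refl sub] by blast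
  then obtain b where b: "\<And>i. i < m \<Longrightarrow> b i \<in> K k" "\<And>v. v \<in> K k \<Longrightarrow> \<exists>c. v - lincomb m c b \<in> {0}"
    unfolding has_codim_def by blast
  have "\<exists>c. v = (\<Sum>x\<in>b ` {..<m}. const (c x) \<cdot> x)" if v: "v \<in> K k" for v
  proof -
    obtain c where "v = lincomb m c b" using b(2)[OF v] by auto
    then have "v \<in> pv.span (b ` {..<m})"
      unfolding lincomb_def by (auto intro!: pv.span_sum pv.span_scale intro: pv.span_base)
    then show ?thesis by (auto simp: pv.span_finite)
  qed
  then show ?thesis using b(1) by (intro exI[of _ "b ` {..<m}"]) auto
qed

text \<open>An \<open>s\<close>-regular submodule of a free module is generated by its pieces of degree at most \<open>s\<close>. These are
  finite-dimensional, and they vanish in negative degrees. Regularity thus replaces Hilbert's basis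
  theorem.\<close>

lemma finite_generators:
  assumes K: "graded_submodule K" and sub: "\<And>k. K k \<subseteq> free {..<n} a k" and a: "\<And>j. j < n \<Longrightarrow> 0 \<le> a j"
    and reg: "regular s K (\<lambda>_. {0})"
  shows "\<exists>G. finite G \<and> generates K G \<and> (\<forall>p\<in>G. 0 \<le> fst p \<and> fst p \<le> s)"
proof -
  have "\<forall>k. \<exists>B. finite B \<and> B \<subseteq> K k \<and> (\<forall>v\<in>K k. \<exists>c. v = (\<Sum>b\<in>B. const (c b) \<cdot> b))"
    using finite_basis[OF K sub] by blast
  from choice[OF this] obtain B where "\<forall>k. finite (B k) \<and> B k \<subseteq> K k \<and>
    (\<forall>v\<in>K k. \<exists>c. v = (\<Sum>b\<in>B k. const (c b) \<cdot> b))" by blast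
  then have B: "\<And>k. finite (B k)" "\<And>k. B k \<subseteq> K k"
    "\<And>k v. v \<in> K k \<Longrightarrow> \<exists>c. v = (\<Sum>b\<in>B k. const (c b) \<cdot> b)" by blast+
  define G where "G = (\<Union>k\<in>{0..s}. Pair k ` B k)"
  have fin: "finite G" unfolding G_def using B(1) by auto
  define ok where "ok k v \<longleftrightarrow> (\<exists>u. (\<forall>p\<in>G. homogeneous (k - fst p) (u p)) \<and> v = (\<Sum>p\<in>G. u p \<cdot> snd p))" for k v
  have low: "ok k v" if v: "v \<in> K k" and k: "k \<le> s" for k v
  proof (cases "k < 0")
    case True
    have "v = 0"
    proof
      fix j
      have "v \<in> free {..<n} a k" using v sub by blast
      then show "v j = 0 j" using a[of j] True by (cases "j < n") (auto simp: free_def intro: homogeneous_neg)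
    qed
    then show ?thesis unfolding ok_def by (intro exI[of _ "\<lambda>_. 0"]) (simp add: smul_simps)
  next
    case False
    obtain c where c: "v = (\<Sum>b\<in>B k. const (c b) \<cdot> b)" using B(3)[OF v] by blast
    define u where "u p = (if fst p = k then const (c (snd p)) else 0)" for p :: "int \<times> (nat \<Rightarrow> poly3)"
    have "Pair k ` B k \<subseteq> G" unfolding G_def using False k by (intro UN_upper) auto
    then have "(\<Sum>p\<in>G. u p \<cdot> snd p) = (\<Sum>p\<in>Pair k ` B k. u p \<cdot> snd p)"
      by (intro sum.mono_neutral_right[OF fin]) (auto simp: G_def u_def smul_simps)
    also have "\<dots> = v" unfolding c by (subst sum.reindex) (auto simp: inj_on_def u_def)
    finally have "v = (\<Sum>p\<in>G. u p \<cdot> snd p)" by simp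
    then show ?thesis unfolding ok_def by (intro exI[of _ u]) (auto simp: u_def)
  qed
  have high: "ok k v" if "v \<in> K k" "k = s + int m" for k v m
    using that
  proof (induction m arbitrary: k v)
    case 0
    then show ?case using low by simp
  next
    case (Suc m)
    obtain b0 b1 b2 where b: "b0 \<in> K (k - 1)" "b1 \<in> K (k - 1)" "b2 \<in> K (k - 1)"
      "v - (var 0 \<cdot> b0 + var 1 \<cdot> b1 + var 2 \<cdot> b2) \<in> {0}"
      using regular_generated[OF reg K gs_zero Suc.prems(1)] Suc.prems(2) by auto
    have "ok (k - 1) b0" "ok (k - 1) b1" "ok (k - 1) b2" using Suc b by auto
    then obtain u0 u1 u2 where u: "\<forall>p\<in>G. homogeneous (k - 1 - fst p) (u0 p)" "\<forall>p\<in>G. homogeneous (k - 1 - fst p) (u1 p)"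
      "\<forall>p\<in>G. homogeneous (k - 1 - fst p) (u2 p)"
      "b0 = (\<Sum>p\<in>G. u0 p \<cdot> snd p)" "b1 = (\<Sum>p\<in>G. u1 p \<cdot> snd p)" "b2 = (\<Sum>p\<in>G. u2 p \<cdot> snd p)"
      unfolding ok_def by blast
    define u where "u p = var 0 * u0 p + var 1 * u1 p + var 2 * u2 p" for p
    have sc: "x \<cdot> (\<Sum>p\<in>G. w p \<cdot> snd p) = (\<Sum>p\<in>G. (x * w p) \<cdot> snd p)" for x w
      using slinear_sum[OF slinear_smul[of x], of "\<lambda>p. w p \<cdot> snd p" G] by (simp only: smul_simps(6))
    have "v = (\<Sum>p\<in>G. u p \<cdot> snd p)"
      using b(4) unfolding u(4,5,6) sc u_def by (simp add: smul_simps(8) sum.distrib)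
    moreover have "homogeneous (k - fst p) (u p)" if "p \<in> G" for p
      unfolding u_def using u(1,2,3) that
      by (intro homogeneous_add homogeneous_mult'[of 1 _ "k - 1 - fst p"]) auto
    ultimately show ?case unfolding ok_def by blast
  qed
  have "ok k v" if "v \<in> K k" for k v
    using low[OF that] high[OF that, of "nat (k - s)"] by (cases "k \<le> s") auto
  moreover have "snd p \<in> K (fst p)" if "p \<in> G" for p 
    using that subsetD[OF B(2)] by (auto simp: G_def)
  ultimately have "generates K G" unfolding generates_def ok_def by blast
  then show ?thesis using fin by (intro exI[of _ G]) (auto simp: G_def)
qed

text \<open>Choose as few generators as possible. If a relation had a nonzero constant coefficient \<open>e\<close> at the
  generator \<open>q\<close>, its component in the degree of \<open>q\<close> would express \<open>q\<close> by the others, and \<open>q\<close> could be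
  removed.\<close>

lemma minimal_generators:
  assumes K: "graded_submodule K" and sub: "\<And>k. K k \<subseteq> free {..<n} a k" and a: "\<And>j. j < n \<Longrightarrow> 0 \<le> a j"
    and reg: "regular s K (\<lambda>_. {0})"
  obtains G where "finite G" "generates K G" "\<And>p. p \<in> G \<Longrightarrow> 0 \<le> fst p \<and> fst p \<le> s"
    "\<And>u p. (\<Sum>p\<in>G. u p \<cdot> snd p) = 0 \<Longrightarrow> p \<in> G \<Longrightarrow> mcoeff (u p) 0 = 0"
proof -
  define P where "P G \<longleftrightarrow> finite G \<and> generates K G \<and> (\<forall>p\<in>G. 0 \<le> fst p \<and> fst p \<le> s)" for G
  obtain G0 where "P G0" using finite_generators[OF assms] unfolding P_def by blast
  then obtain G where G: "P G" "\<And>H. P H \<Longrightarrow> card G \<le> card H"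
    using ex_has_least_nat[of P G0 card] by blast
  have fin: "finite G" and gen: "generates K G" and deg: "\<forall>p\<in>G. 0 \<le> fst p \<and> fst p \<le> s" using G(1) by (auto simp: P_def)
  have mem: "\<And>p. p \<in> G \<Longrightarrow> snd p \<in> K (fst p)"
    and span: "\<And>k v. v \<in> K k \<Longrightarrow> \<exists>u. (\<forall>p\<in>G. homogeneous (k - fst p) (u p)) \<and> v = (\<Sum>p\<in>G. u p \<cdot> snd p)"
    using gen unfolding generates_def by blast+
  have "mcoeff (u q) 0 = 0" if u: "(\<Sum>p\<in>G. u p \<cdot> snd p) = 0" and q: "q \<in> G" for u q
  proof (rule ccontr)
    assume nz: "mcoeff (u q) 0 \<noteq> 0"
    define w where "w p = hcomp (fst q - fst p) (u p)" for p
    have ap: "(\<Sum>p\<in>G. x p \<cdot> snd p) i = (\<Sum>p\<in>G. x p * snd p i)" for x i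
      using fin by (induction G rule: finite_induct) auto
    have w0: "(\<Sum>p\<in>G. w p \<cdot> snd p) = 0"
    proof
      fix i
      show "(\<Sum>p\<in>G. w p \<cdot> snd p) i = 0 i"
      proof (cases "i < n")
        case True
        have "w p * snd p i = hcomp (fst q - a i) (u p * snd p i)" if "p \<in> G" for p
        proof -
          have "homogeneous (fst p - a i) (snd p i)" using mem[OF that] sub True by (auto simp: free_def)
          from hcomp_mult[OF this, of "fst q - a i" "u p"] show ?thesis by (simp add: w_def mult.commute)
        qed
        then have "(\<Sum>p\<in>G. w p * snd p i) = hcomp (fst q - a i) (\<Sum>p\<in>G. u p * snd p i)"
          unfolding hcomp_sum by (rule sum.cong[OF refl])
        also have "(\<Sum>p\<in>G. u p * snd p i) = 0" using u ap[of u i] by simp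
        finally show ?thesis unfolding ap by simp
      next
        case False
        have "snd p i = 0" if "p \<in> G" for p using mem[OF that] sub False by (auto simp: free_def)
        then show ?thesis unfolding ap by simp
      qed
    qed
    define e where "e = mcoeff (u q) 0"
    have wq: "w q = const e"
      using homogeneous_0_const[of "w q"] by (simp add: w_def e_def mcoeff_hcomp)
    have hw: "homogeneous (fst q - fst p) (w p)" for p by (simp add: w_def)
    have "P (G - {q})" unfolding P_def
    proof (intro conjI)
      show "generates K (G - {q})" unfolding generates_def
      proof (intro conjI allI ballI)
        fix k v assume v: "v \<in> K k"
        obtain x where x: "\<forall>p\<in>G. homogeneous (k - fst p) (x p)" "v = (\<Sum>p\<in>G. x p \<cdot> snd p)" using span[OF v] by blast
        \<comment> \<open>Subtracting the multiple of the relation \<open>w\<close> that cancels the coefficient at \<open>q\<close>.\<close>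
        define y where "y p = x p - x q * (const (inverse e) * w p)" for p
        have yq: "y q = 0" unfolding y_def wq using nz const_inverse[of "inverse e" 1]
          by (simp add: e_def flip: const_simps(2))
        have "homogeneous (k - fst p) (y p)" if "p \<in> G" for p
          unfolding y_def using x(1) that q
          by (intro homogeneous_diff homogeneous_mult'[of "k - fst q" "x q" "fst q - fst p"] homogeneous_const_mult hw) auto
        moreover have "v = (\<Sum>p\<in>G - {q}. y p \<cdot> snd p)"
        proof -
          have "(\<Sum>p\<in>G. (x q * (const (inverse e) * w p)) \<cdot> snd p) = (x q * const (inverse e)) \<cdot> (\<Sum>p\<in>G. w p \<cdot> snd p)"
            using slinear_sum[OF slinear_smul[of "x q * const (inverse e)"], of "\<lambda>p. w p \<cdot> snd p" G]
            by (simp only: smul_simps(6) mult.assoc)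
          then have z: "(\<Sum>p\<in>G. (x q * (const (inverse e) * w p)) \<cdot> snd p) = 0" by (simp only: w0 smul_simps(4))
          have "(\<Sum>p\<in>G. y p \<cdot> snd p) = (\<Sum>p\<in>G. x p \<cdot> snd p) - (\<Sum>p\<in>G. (x q * (const (inverse e) * w p)) \<cdot> snd p)"
            unfolding y_def by (simp only: smul_simps(9) sum_subtractf)
          then have "(\<Sum>p\<in>G. y p \<cdot> snd p) = v" unfolding z x(2)[symmetric] by simp
          then show ?thesis using sum.remove[OF fin q, of "\<lambda>p. y p \<cdot> snd p"] by (simp add: yq smul_simps(5))
        qed
        ultimately show "\<exists>u. (\<forall>p\<in>G - {q}. homogeneous (k - fst p) (u p)) \<and> v = (\<Sum>p\<in>G - {q}. u p \<cdot> snd p)" by blast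
      qed (use mem in auto)
    qed (use fin deg in auto)
    then have "card G \<le> card (G - {q})" by (rule G(2))
    then show False using fin q by (metis card_Diff1_less not_le)
  qed
  then show ?thesis using that fin gen deg by blast
qed

section \<open>Existence of minimal resolutions\<close>

text \<open>The invariant of the construction: \<open>K\<close> is the kernel that is to be covered next, a submodule of
  the free module with shifts \<open>a\<close>, inside \<open>(x, y, z)\<close> times that module and \<open>s\<close>-regular.\<close>

definition stage :: "int \<Rightarrow> nat \<Rightarrow> (nat \<Rightarrow> int) \<Rightarrow> nat family \<Rightarrow> bool" where
  "stage s n a K \<longleftrightarrow> graded_submodule K \<and> (\<forall>k. K k \<subseteq> free {..<n} a k) \<and> (\<forall>j<n. 0 \<le> a j) \<and>
     regular s K (\<lambda>_. {0}) \<and> (\<forall>k. \<forall>v\<in>K k. \<forall>j. mcoeff (v j) 0 = 0)"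

text \<open>\<open>M\<close> maps a free module onto \<open>K\<close> with kernel \<open>L\<close>, which is one step of a minimal resolution.\<close>

definition covers :: "nat \<Rightarrow> (nat \<Rightarrow> int) \<Rightarrow> nat family \<Rightarrow> poly3 mat \<Rightarrow> nat \<Rightarrow> (nat \<Rightarrow> int) \<Rightarrow> nat family \<Rightarrow> bool" where
  "covers n a K M m b L \<longleftrightarrow> M \<in> carrier_mat n m \<and> homogeneous_mat M a b \<and>
     (\<forall>i<n. \<forall>j<m. mcoeff (M $$ (i, j)) 0 = 0) \<and>
     (\<forall>k. K k = mat_map M ` free {..<m} b k) \<and> L = kernel_family M b"

text \<open>The columns of \<open>M\<close> are minimal generators of \<open>K\<close>. Their degrees are at most \<open>s\<close>, so the free
  module on them is \<open>(s + 1)\<close>-regular, and hence so is the kernel \<open>L\<close>.\<close>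

lemma stage_step:
  assumes st: "stage s n a K"
  shows "\<exists>M m b L. covers n a K M m b L \<and> stage (s + 1) m b L"
proof -
  have K: "graded_submodule K" and sub: "\<And>k. K k \<subseteq> free {..<n} a k" and a: "\<And>j. j < n \<Longrightarrow> 0 \<le> a j"
    and reg: "regular s K (\<lambda>_. {0})" and min: "\<And>k v j. v \<in> K k \<Longrightarrow> mcoeff (v j) 0 = 0"
    using st by (auto simp: stage_def)
  obtain G where fin: "finite G" and gen: "generates K G" and deg: "\<And>p. p \<in> G \<Longrightarrow> 0 \<le> fst p \<and> fst p \<le> s"
    and ker: "\<And>u p. (\<Sum>p\<in>G. u p \<cdot> snd p) = 0 \<Longrightarrow> p \<in> G \<Longrightarrow> mcoeff (u p) 0 = 0"
    using minimal_generators[OF K sub a reg] by blast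
  have mem: "\<And>p. p \<in> G \<Longrightarrow> snd p \<in> K (fst p)"
    and span: "\<And>k v. v \<in> K k \<Longrightarrow> \<exists>u. (\<forall>p\<in>G. homogeneous (k - fst p) (u p)) \<and> v = (\<Sum>p\<in>G. u p \<cdot> snd p)"
    using gen unfolding generates_def by blast+
  define m where "m = card G"
  obtain e where e: "bij_betw e {..<m} G" using ex_bij_betw_nat_finite[OF fin] unfolding m_def lessThan_atLeast0 by blast
  have eG: "e j \<in> G" if "j < m" for j using e that by (auto simp: bij_betw_def)
  define b where "b j = fst (e j)" for j
  define M where "M = mat n m (\<lambda>(i, j). snd (e j) i)"
  have M: "M \<in> carrier_mat n m" by (simp add: M_def)
  have entry: "M $$ (i, j) = snd (e j) i" if "i < n" "j < m" for i j using that by (simp add: M_def)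
  have hM: "homogeneous_mat M a b"
    unfolding homogeneous_mat_def using M mem[OF eG] sub
    by (auto simp: entry b_def free_def)
  have mm: "mat_map M u = (\<Sum>j<m. u j \<cdot> snd (e j))" for u
  proof
    fix i
    have ap: "(\<Sum>j<m. u j \<cdot> snd (e j)) i = (\<Sum>j<m. u j * snd (e j) i)"
      by (induction m) auto
    show "mat_map M u i = (\<Sum>j<m. u j \<cdot> snd (e j)) i"
    proof (cases "i < n")
      case True
      then show ?thesis using M unfolding ap by (auto simp: mat_map_def entry mult.commute intro!: sum.cong)
    next
      case False
      have "snd (e j) i = 0" if "j < m" for j using mem[OF eG[OF that]] sub False by (auto simp: free_def)
      then show ?thesis using M False unfolding ap by (auto simp: mat_map_def)
    qed
  qed
  have img: "K k = mat_map M ` free {..<m} b k" for k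
  proof (rule Set.set_eqI, rule iffI)
    fix v assume "v \<in> K k"
    then obtain u where u: "\<forall>p\<in>G. homogeneous (k - fst p) (u p)" "v = (\<Sum>p\<in>G. u p \<cdot> snd p)" using span by blast
    define w where "w j = (if j < m then u (e j) else 0)" for j
    have "w \<in> free {..<m} b k" using u(1) eG by (auto simp: w_def free_def b_def)
    moreover have "mat_map M w = (\<Sum>j<m. u (e j) \<cdot> snd (e j))" unfolding mm by (intro sum.cong) (auto simp: w_def)
    then have "v = mat_map M w" using sum.reindex_bij_betw[OF e, of "\<lambda>p. u p \<cdot> snd p"] u(2) by simp
    ultimately show "v \<in> mat_map M ` free {..<m} b k" by blast
  next
    fix v assume "v \<in> mat_map M ` free {..<m} b k"
    then obtain u where u: "u \<in> free {..<m} b k" "v = mat_map M u" by blast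
    have "u j \<cdot> snd (e j) \<in> K k" if "j < m" for j
      using gs_smul[OF K mem[OF eG[OF that]], of "k - b j" "u j" k] u(1) that by (auto simp: free_def b_def)
    then show "v \<in> K k" unfolding u(2) mm by (intro gs_sum[OF K]) auto
  qed
  define L where "L = kernel_family M b"
  have Lmin: "mcoeff (v j) 0 = 0" if v: "v \<in> L k" for k v j
  proof (cases "j < m")
    case True
    define u where "u p = v (the_inv_into {..<m} e p)" for p
    have inv: "the_inv_into {..<m} e (e j) = j" if "j < m" for j
      using e that by (intro the_inv_into_f_f) (auto simp: bij_betw_def)
    have "(\<Sum>p\<in>G. u p \<cdot> snd p) = (\<Sum>j<m. u (e j) \<cdot> snd (e j))"
      using sum.reindex_bij_betw[OF e, of "\<lambda>p. u p \<cdot> snd p"] by simp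
    also have "\<dots> = mat_map M v" unfolding mm by (intro sum.cong) (auto simp: u_def inv)
    also have "\<dots> = 0" using v by (simp add: L_def kernel_family_def)
    finally have "mcoeff (u (e j)) 0 = 0" using ker eG[OF True] by blast
    then show ?thesis by (simp add: u_def inv[OF True])
  next
    case False
    then show ?thesis using v M by (simp add: L_def kernel_family_def free_def)
  qed
  have "regular s (free {..<m} b) L"
    using regular_iso[OF mat_map_iso[OF M hM img], of s] reg by (simp add: L_def)
  moreover have "regular (s + 1) (free {..<m} b) (\<lambda>_. {0})"
    using deg[OF eG] by (intro regular_free) (force simp: b_def)
  moreover have gsL: "graded_submodule L" unfolding L_def by (rule gs_kernel_family)
  moreover have subL: "L k \<subseteq> free {..<m} b k" for k unfolding L_def by (rule kernel_family_free[OF M])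
  ultimately have "regular (s + 1) L (\<lambda>_. {0})"
    using gs_0[OF gsL] by (rule_tac regular_kernel[OF gsL gs_zero, where L = "free {..<m} b"]) auto
  then have "stage (s + 1) m b L"
    unfolding stage_def using gsL subL Lmin deg[OF eG] by (auto simp: b_def)
  moreover have "mcoeff (M $$ (i, j)) 0 = 0" if "i < n" "j < m" for i j
    unfolding entry[OF that] by (rule min[OF mem[OF eG[OF that(2)]]])
  then have "covers n a K M m b L" unfolding covers_def using M hM img L_def by blast
  ultimately show ?thesis by blast
qed

lemma kernel_eq_image:
  assumes D: "D \<in> carrier_mat n m" "homogeneous_mat D a b" and c: "covers m b (kernel_family D b) M l c L"
  shows "mat_kernel D = (\<lambda>w. M *\<^sub>v w) ` carrier_vec l"
proof (rule Set.set_eqI, rule iffI)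
  have M: "M \<in> carrier_mat m l" "homogeneous_mat M b c" and img: "\<And>k. kernel_family D b k = mat_map M ` free {..<l} c k"
    using c by (auto simp: covers_def)
  fix v
  {
    assume v: "v \<in> mat_kernel D"
    then have vc: "v \<in> carrier_vec m" using D by (auto simp: mat_kernel_def)
    define x where "x = of_vec v"
    have x: "x \<in> supported m" "mat_map D x = 0"
      using vc v mat_kernel_iff[OF D(1) vc] by (auto simp: x_def of_vec_supported)
    obtain T where T: "finite T" "x = (\<Sum>k\<in>T. vcomp m b k x)" using supported_sum_vcomp[OF x(1)] by blast
    have "\<exists>u\<in>free {..<l} c k. vcomp m b k x = mat_map M u" for k
    proof -
      have "mat_map D (vcomp m b k x) = 0" using mat_map_vcomp[OF D, of k x] x(2) by simp
      then have "vcomp m b k x \<in> kernel_family D b k" using D(1) vcomp_free[of m b k x] by (simp add: kernel_family_def)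
      then show ?thesis using img by auto
    qed
    then obtain u where u: "\<And>k. u k \<in> free {..<l} c k" "\<And>k. vcomp m b k x = mat_map M (u k)" by metis
    define y where "y = (\<Sum>k\<in>T. u k)"
    have "x = mat_map M y" using T(2) unfolding y_def slinear_sum[OF slinear_mat_map] u(2) .
    moreover have "y \<in> supported l"
    proof -
      have "(\<Sum>k\<in>T. u k) j = 0" if "j \<ge> l" for j
        using T(1) by (induction T rule: finite_induct) (use free_supported[OF u(1)] that in \<open>auto simp: supported_def\<close>)
      then show ?thesis by (simp add: supported_def y_def)
    qed
    ultimately have "of_vec v = of_vec (M *\<^sub>v vec l y)"
      using of_vec_mult[OF M(1), of "vec l y"] of_vec_vec[of y l] by (simp add: x_def)
    then have "v = M *\<^sub>v vec l y" using M(1) by (intro of_vec_inj[OF vc]) auto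
    then show "v \<in> (\<lambda>w. M *\<^sub>v w) ` carrier_vec l" by auto
  }
  assume "v \<in> (\<lambda>w. M *\<^sub>v w) ` carrier_vec l"
  then obtain w where w: "w \<in> carrier_vec l" "v = M *\<^sub>v w" by blast
  define y where "y = of_vec w"
  obtain T where T: "finite T" "y = (\<Sum>k\<in>T. vcomp l c k y)"
    using supported_sum_vcomp[of y l c] of_vec_supported[OF w(1)] by (auto simp: y_def)
  have "mat_map D (mat_map M (vcomp l c k y)) = 0" for k
    using img[of k] vcomp_free[of l c k y] by (auto simp: kernel_family_def)
  then have "mat_map D (mat_map M (\<Sum>k\<in>T. vcomp l c k y)) = 0"
    by (simp only: slinear_sum[OF slinear_mat_map] sum.neutral_const)
  then have "mat_map D (of_vec v) = 0"
    using T(2) of_vec_mult[OF M(1) w(1)] w(2) by (metis y_def)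
  then show "v \<in> mat_kernel D" using mat_kernel_iff[OF D(1)] M(1) w by auto
qed

text \<open>Iterating \<open>stage_step\<close> continues the given map \<open>D0\<close> to a minimal resolution. The last two clauses
  record how the map after \<open>D0\<close> arises: it covers the kernel of \<open>D0\<close> by minimal generators.\<close>

lemma resolution_exists:
  assumes D: "D0 \<in> carrier_mat n0 n1" "homogeneous_mat D0 a0 a1" and st: "stage s n1 a1 (kernel_family D0 a1)"
  shows "\<exists>n a D. n 0 = n0 \<and> n 1 = n1 \<and> a 0 = a0 \<and> a 1 = a1 \<and> D 0 = D0 \<and>
    (\<forall>i. D i \<in> carrier_mat (n i) (n (Suc i)) \<and> homogeneous_mat (D i) (a i) (a (Suc i)) \<and>
      mat_kernel (D i) = (\<lambda>w. D (Suc i) *\<^sub>v w) ` carrier_vec (n (Suc (Suc i)))) \<and>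
    (\<forall>i. \<forall>k<n (Suc i). \<forall>j<n (Suc (Suc i)). mcoeff (D (Suc i) $$ (k, j)) 0 = 0) \<and>
    (\<forall>k. kernel_family D0 a1 k = mat_map (D 1) ` free {..<n 2} (a 2) k) \<and>
    (\<forall>k. \<forall>v\<in>kernel_family (D 1) (a 2) k. \<forall>j. mcoeff (v j) 0 = 0)"
proof -
  define P where "P i = (\<lambda>(m, b, K). stage (s + int i) m b K)" for i
  define Q where "Q = (\<lambda>(i :: nat) (m, b, K) (m', b', K'). \<exists>M. covers m b K M m' b' K')"
  define start where "start = (n1, a1, kernel_family D0 a1)"
  have "\<exists>f. f 0 = start \<and> (\<forall>i. P i (f i) \<and> Q i (f i) (f (Suc i)))"
  proof -
    have "\<exists>x. P 0 x \<and> x = start" using st by (simp add: P_def start_def)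
    moreover have "\<exists>y. (P (Suc i) y \<and> (Suc i = 0 \<longrightarrow> y = start)) \<and> Q i x y" if Pix: "P i x" for i x
    proof -
      obtain m b K where x: "x = (m, b, K)" by (metis prod_cases3)
      obtain M m' b' L where "covers m b K M m' b' L" "stage (s + int i + 1) m' b' L"
        using stage_step[of "s + int i" m b K] Pix by (auto simp: P_def x)
      then show ?thesis by (intro exI[of _ "(m', b', L)"]) (auto simp: P_def Q_def x algebra_simps)
    qed
    ultimately obtain f where "\<And>i. (P i (f i) \<and> (i = 0 \<longrightarrow> f i = start)) \<and> Q i (f i) (f (Suc i))"
      using dependent_nat_choice[of "\<lambda>i x. P i x \<and> (i = 0 \<longrightarrow> x = start)" Q] by (metis (no_types, lifting))
    then show ?thesis by blast
  qed
  then obtain f where f: "f 0 = start" "\<And>i. P i (f i)" "\<And>i. Q i (f i) (f (Suc i))" by blast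
  define N where "N i = fst (f i)" for i
  define B where "B i = fst (snd (f i))" for i
  define K where "K i = snd (snd (f i))" for i
  have fi: "f i = (N i, B i, K i)" for i by (simp add: N_def B_def K_def)
  have "\<forall>i. \<exists>M. covers (N i) (B i) (K i) M (N (Suc i)) (B (Suc i)) (K (Suc i))"
    using f(3) by (simp add: Q_def fi)
  then obtain M where M: "\<And>i. covers (N i) (B i) (K i) (M i) (N (Suc i)) (B (Suc i)) (K (Suc i))" by metis
  have stg: "stage (s + int i) (N i) (B i) (K i)" for i using f(2)[of i] by (simp add: P_def fi)
  have start: "N 0 = n1" "B 0 = a1" "K 0 = kernel_family D0 a1" using f(1) by (simp_all add: fi start_def)
  define n where "n i = (case i of 0 \<Rightarrow> n0 | Suc i' \<Rightarrow> N i')" for i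
  define a where "a i = (case i of 0 \<Rightarrow> a0 | Suc i' \<Rightarrow> B i')" for i
  define E where "E i = (case i of 0 \<Rightarrow> D0 | Suc i' \<Rightarrow> M i')" for i
  have carr: "E i \<in> carrier_mat (n i) (n (Suc i)) \<and> homogeneous_mat (E i) (a i) (a (Suc i))" for i
    using D M[of "i - 1"] start by (cases i) (auto simp: E_def n_def a_def covers_def)
  have Kk: "K i = kernel_family (E i) (a (Suc i))" for i
    using start M[of "i - 1"] by (cases i) (auto simp: E_def a_def covers_def)
  have ker: "mat_kernel (E i) = (\<lambda>w. E (Suc i) *\<^sub>v w) ` carrier_vec (n (Suc (Suc i)))" for i
    using carr[of i] M[of i] Kk[of i]
    by (intro kernel_eq_image[where n = "n i" and m = "n (Suc i)" and a = "a i" and b = "a (Suc i)" and c = "B (Suc i)" and L = "K (Suc i)"])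
      (auto simp: n_def a_def E_def)
  have mz: "mcoeff (E (Suc i) $$ (k, j)) 0 = 0" if "k < n (Suc i)" "j < n (Suc (Suc i))" for i k j
    using M[of i] that by (auto simp: covers_def E_def n_def)
  have im: "kernel_family D0 a1 k = mat_map (E 1) ` free {..<n 2} (a 2) k" for k
    using M[of 0] start by (auto simp: covers_def E_def n_def a_def numeral_2_eq_2)
  have kz: "mcoeff (v j) 0 = 0" if "v \<in> kernel_family (E 1) (a 2) k" for v k j
    using stg[of 1] that Kk[of 1] by (auto simp: stage_def numeral_2_eq_2)
  have init: "n 0 = n0" "n 1 = n1" "a 0 = a0" "a 1 = a1" "E 0 = D0"
    using start by (simp_all add: n_def a_def E_def)
  show ?thesis
    by (rule exI[of _ n], rule exI[of _ a], rule exI[of _ E], intro conjI allI ballI impI)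
      (use carr in \<open>simp_all only: init ker mz im kz\<close>)
qed

section \<open>A minimal resolution of the Milnor algebra\<close>

text \<open>Coordinates are indexed by the type \<open>3\<close> in derivations but by natural numbers in matrices.\<close>

definition idx :: "3 \<Rightarrow> nat" where "idx i = (if i = 0 then 0 else if i = 1 then 1 else 2)"
definition dir :: "nat \<Rightarrow> 3" where "dir j = (if j = 0 then 0 else if j = 1 then 1 else 2)"

lemma dir_idx [simp]: "dir (idx i) = i"
proof -
  have "\<forall>i. dir (idx i) = i" unfolding all_3 by (simp add: dir_def idx_def)
  then show ?thesis ..
qed

lemma idx_dir [simp]: "j < 3 \<Longrightarrow> idx (dir j) = j"
  by (auto simp: dir_def idx_def)

lemma idx_less [simp]: "idx i < 3"
  by (simp add: idx_def)

definition jacobian_row :: "poly3 \<Rightarrow> poly3 mat" where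
  "jacobian_row f = mat 1 3 (\<lambda>(i, j). partial_deriv (dir j) f)"

lemma jacobian_row_carrier: "jacobian_row f \<in> carrier_mat 1 3"
  by (simp add: jacobian_row_def)

lemma mat_map_jacobian_row: "mat_map (jacobian_row f) v = (\<lambda>i. if i < 1 then act (\<lambda>i. v (idx i)) f else 0)"
proof
  fix i
  have "(\<Sum>j<3. partial_deriv (dir j) f * v j) = act (\<lambda>i. v (idx i)) f"
    by (simp add: act_def sum_UNIV_3 numeral_3_eq_3 numeral_2_eq_2 dir_def idx_def algebra_simps)
  moreover have "(\<Sum>j<3. jacobian_row f $$ (0, j) * v j) = (\<Sum>j<3. partial_deriv (dir j) f * v j)"
    by (intro sum.cong) (auto simp: jacobian_row_def)
  ultimately show "mat_map (jacobian_row f) v i = (if i < 1 then act (\<lambda>i. v (idx i)) f else 0)"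
    using jacobian_row_carrier[of f] by (simp add: mat_map_def)
qed

lemma jacobian_row_zero_iff: "mat_map (jacobian_row f) v = 0 \<longleftrightarrow> act (\<lambda>i. v (idx i)) f = 0"
  unfolding mat_map_jacobian_row by (auto simp: fun_eq_iff)

lemma first_syzygies_iso:
  "quotient_iso (- e) (\<lambda>v i. v (idx i)) (kernel_family (jacobian_row f) (\<lambda>_. e)) (\<lambda>_. {0}) (syzygies f) (\<lambda>_. {0})"
proof (rule quotient_isoI)
  show "slinear (\<lambda>v i. v (idx i))" by (auto simp: slinear_def fun_eq_iff)
  show "graded_submodule (kernel_family (jacobian_row f) (\<lambda>_. e))" by (rule gs_kernel_family)
  show "graded_submodule (\<lambda>_. {0 :: 3 \<Rightarrow> poly3})" by (rule gs_zero)
  have dc: "dim_col (jacobian_row f) = 3" by (simp add: jacobian_row_def)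
  fix k
  {
    fix u assume u: "u \<in> kernel_family (jacobian_row f) (\<lambda>_. e) k"
    then show "(\<lambda>i. u (idx i)) \<in> syzygies f (k + - e)"
      by (auto simp: kernel_family_def dc free_def syzygies_def jacobian_row_zero_iff)
    show "(\<lambda>i :: 3. u (idx i)) \<in> {0} \<longleftrightarrow> u \<in> {0}"
    proof
      assume *: "(\<lambda>i :: 3. u (idx i)) \<in> {0}"
      have "u j = 0" for j
      proof (cases "j < 3")
        case True
        have "u (idx (dir j)) = 0" using * by (metis singletonD zero_fun_apply)
        then show ?thesis using True by simp
      qed (use u in \<open>simp add: kernel_family_def dc free_def\<close>)
      then show "u \<in> {0}" by auto
    qed auto
  }
  fix v assume v: "v \<in> syzygies f (k + - e)"
  define u where "u j = (if j < 3 then v (dir j) else 0)" for j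
  have uv: "(\<lambda>i. u (idx i)) = v" by (auto simp: u_def)
  have "u \<in> kernel_family (jacobian_row f) (\<lambda>_. e) k"
    using v by (auto simp: kernel_family_def dc free_def jacobian_row_zero_iff uv syzygies_def) (auto simp: u_def)
  then show "\<exists>u\<in>kernel_family (jacobian_row f) (\<lambda>_. e) k. v - (\<lambda>i. u (idx i)) \<in> {0}"
    by (intro bexI[of _ u]) (auto simp: uv)
qed

lemma
  shows first_syzygies_mem: "v \<in> kernel_family (jacobian_row f) (\<lambda>_. e) k \<Longrightarrow> (\<lambda>i. v (idx i)) \<in> syzygies f (k - e)"
    and first_syzygies_inj: "v \<in> kernel_family (jacobian_row f) (\<lambda>_. e) k \<Longrightarrow> (\<lambda>i :: 3. v (idx i)) = 0 \<Longrightarrow> v = 0"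
    and first_syzygies_surj: "\<theta> \<in> syzygies f k \<Longrightarrow> \<exists>u\<in>kernel_family (jacobian_row f) (\<lambda>_. e) (k + e). \<theta> = (\<lambda>i. u (idx i))"
proof -
  note q = first_syzygies_iso[of e f, unfolded quotient_iso_def]
  show "v \<in> kernel_family (jacobian_row f) (\<lambda>_. e) k \<Longrightarrow> (\<lambda>i. v (idx i)) \<in> syzygies f (k - e)"
    using q by auto
  show "v \<in> kernel_family (jacobian_row f) (\<lambda>_. e) k \<Longrightarrow> (\<lambda>i :: 3. v (idx i)) = 0 \<Longrightarrow> v = 0"
    using q by (metis singleton_iff)
  assume t: "\<theta> \<in> syzygies f k"
  have "\<forall>v\<in>syzygies f ((k + e) + - e). \<exists>u\<in>kernel_family (jacobian_row f) (\<lambda>_. e) (k + e). v - (\<lambda>i. u (idx i)) \<in> {0}"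
    using q by blast
  then have "\<exists>u\<in>kernel_family (jacobian_row f) (\<lambda>_. e) (k + e). \<theta> - (\<lambda>i. u (idx i)) \<in> {0}" using t by simp
  then show "\<exists>u\<in>kernel_family (jacobian_row f) (\<lambda>_. e) (k + e). \<theta> = (\<lambda>i. u (idx i))"
    by (simp only: singleton_iff right_minus_eq)
qed

context arrangement begin

text \<open>A constant vector field \<open>v\<close> with \<open>v(f) = 0\<close> is logarithmic, so each \<open>l\<^sub>a\<close> divides the constant
  \<open>v(l\<^sub>a)\<close>, which is therefore \<open>0\<close>. If \<open>v\<close> is nonzero, all lines pass through the point \<open>v\<close>.\<close>

lemma syzygies_degree_0:
  assumes np: "\<not> pencil A" shows "syzygies f 0 = {0}"
proof -
  have "\<theta> = 0" if t: "\<theta> \<in> syzygies f 0" for \<theta>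
  proof -
    define v where "v i = mcoeff (\<theta> i) 0" for i
    have \<theta>: "\<theta> i = const (v i)" for i
      using t homogeneous_0_const[of "\<theta> i"] by (simp add: syzygies_def v_def)
    have "dot a v = 0" if a: "a \<in> A" for a
    proof (rule ccontr)
      assume nz: "dot a v \<noteq> 0"
      have "linear_form a dvd apply_form \<theta> a" using t syzygies_subset a by (auto simp: log_der_def)
      also have "apply_form \<theta> a = const (dot a v)"
        by (simp add: apply_form_def \<theta> dot_def const_sum const_simps)
      finally have "linear_form a dvd const (dot a v) * const (inverse (dot a v))" by simp
      also have "const (dot a v) * const (inverse (dot a v)) = 1"
        using nz by (simp add: const_simps(4) flip: const_simps(2))
      finally show False
        using prime_elem_linear_form[OF arrangementD(2)[OF arr a]] by (simp add: prime_elem_def)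
    qed
    moreover have "v = (\<lambda>_. 0)"
    proof (rule ccontr)
      assume v0: "v \<noteq> (\<lambda>_. 0)"
      define P where "P = {w. \<exists>c. c \<noteq> 0 \<and> w = (\<lambda>i. c * v i)}"
      have "P \<in> proj_plane" unfolding proj_plane_def P_def using v0 by blast
      moreover have "dot a (\<lambda>i. c * v i) = c * dot a v" for a c by (simp add: dot_3 algebra_simps)
      then have "lines_through A P = A"
        using \<open>\<And>a. a \<in> A \<Longrightarrow> dot a v = 0\<close> by (auto simp: lines_through_def P_def dot_def)
      ultimately show False using np unfolding pencil_def by blast
    qed
    ultimately show ?thesis using \<theta> by (auto simp: const_simps fun_eq_iff)
  qed
  then show ?thesis using gs_0[OF gs_syzygies] by blast
qed

lemma ideal_family_jacobian: "ideal_family (jacobian_ideal f) = jacobian f"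
  by (intro ext) (simp add: ideal_family_def jacobian_def)

lemma jacobian_ideal_graded:
  assumes "p \<in> jacobian_ideal f" shows "hcomp k p \<in> jacobian_ideal f"
proof -
  obtain \<theta> where p: "p = act \<theta> f" using assms by (auto simp: jacobian_ideal_iff)
  have "hcomp k p = act (\<lambda>i. hcomp (k - (int d - 1)) (\<theta> i)) f"
    unfolding p act_def hcomp_sum
  proof (intro sum.cong refl)
    fix i
    show "hcomp k (\<theta> i * partial_deriv i f) = hcomp (k - (int d - 1)) (\<theta> i) * partial_deriv i f"
      using hcomp_mult[OF homogeneous_partial_deriv[OF homogeneous_f], of k i "\<theta> i"] by (simp only: mult.commute)
  qed
  then show ?thesis by (auto simp: jacobian_ideal_iff)
qed

text \<open>Seen as the kernel of the row of partial derivatives, the syzygies are shifted by \<open>d - 1\<close>, whence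
  \<open>(d - 2) + (d - 1) = 2d - 3\<close>. The kernel has entries in \<open>(x, y, z)\<close> because there are no constant
  syzygies.\<close>

lemma stage_first_syzygies:
  assumes np: "\<not> pencil A" and d3: "d \<ge> 3"
  shows "stage (2 * int d - 3) 3 (\<lambda>_. int d - 1) (kernel_family (jacobian_row f) (\<lambda>_. int d - 1))"
  unfolding stage_def
proof (intro conjI allI impI ballI)
  let ?K = "kernel_family (jacobian_row f) (\<lambda>_. int d - 1)"
  show "graded_submodule ?K" by (rule gs_kernel_family)
  show "?K k \<subseteq> free {..<3} (\<lambda>_. int d - 1) k" for k by (rule kernel_family_free[OF jacobian_row_carrier])
  have "regular (int d - 2) (syzygies f) (\<lambda>_. {0})"
    using regular_log_der_not_pencil[OF arr np] d3 card_A by (intro regular_syzygies) auto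
  then show "regular (2 * int d - 3) ?K (\<lambda>_. {0})"
    using regular_iso[OF first_syzygies_iso[of "int d - 1" f], of "2 * int d - 3"] by (simp add: algebra_simps)
  fix k v j assume v: "v \<in> ?K k"
  have vf: "v \<in> free {..<3} (\<lambda>_. int d - 1) k" using v kernel_family_free[OF jacobian_row_carrier] by blast
  show "mcoeff (v j) 0 = 0"
  proof (cases "j < 3 \<and> k \<noteq> int d - 1")
    case True
    then have "homogeneous (k - (int d - 1)) (v j)" using vf by (simp add: free_def)
    then show ?thesis using True by (intro mcoeff_0_homogeneous) auto
  next
    case False
    show ?thesis
    proof (cases "j < 3")
      case True
      then have "v \<in> ?K (int d - 1)" using v False by simp
      then have "v = 0"
        using first_syzygies_mem[of v f "int d - 1" "int d - 1"] first_syzygies_inj syzygies_degree_0[OF np] by fastforce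
      then show ?thesis by simp
    qed (use vf in \<open>simp add: free_def\<close>)
  qed
qed (use d_pos in auto)

text \<open>The resolution starts with \<open>S\<close> and the three partial derivatives, which generate \<open>J\<close> minimally
  as there are no constant syzygies. The columns of the next matrix are nonzero by minimality, so every shift in
  homological degree \<open>2\<close> comes from a nonzero syzygy.\<close>

lemma minimal_resolution_exists:
  assumes np: "\<not> pencil A" and d3: "d \<ge> 3"
  shows "\<exists>n a g D. minimal_graded_free_resolution (jacobian_ideal f) n a g D \<and> n 0 = 1 \<and>
    (\<forall>j<n 2. syzygies f (a 2 j - (int d - 1)) \<noteq> {0}) \<and> (n 2 = 0 \<longrightarrow> (\<forall>k. syzygies f k = {0}))"
proof -
  let ?e = "\<lambda>_ :: nat. int d - 1"
  have hom: "homogeneous_mat (jacobian_row f) (\<lambda>_. 0) ?e"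
    using homogeneous_partial_deriv[OF homogeneous_f] by (simp add: homogeneous_mat_def jacobian_row_def)
  obtain n a D where res: "n 0 = 1 \<and> n 1 = 3 \<and> a 0 = (\<lambda>_. 0) \<and> a 1 = ?e \<and> D 0 = jacobian_row f \<and>
    (\<forall>i. D i \<in> carrier_mat (n i) (n (Suc i)) \<and> homogeneous_mat (D i) (a i) (a (Suc i)) \<and>
      mat_kernel (D i) = (\<lambda>w. D (Suc i) *\<^sub>v w) ` carrier_vec (n (Suc (Suc i)))) \<and>
    (\<forall>i. \<forall>k<n (Suc i). \<forall>j<n (Suc (Suc i)). mcoeff (D (Suc i) $$ (k, j)) 0 = 0) \<and>
    (\<forall>k. kernel_family (jacobian_row f) ?e k = mat_map (D 1) ` free {..<n 2} (a 2) k) \<and>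
    (\<forall>k. \<forall>v\<in>kernel_family (D 1) (a 2) k. \<forall>j. mcoeff (v j) 0 = 0)"
    using resolution_exists[OF jacobian_row_carrier hom stage_first_syzygies[OF np d3]] by (elim exE)
  from res have n: "n 0 = 1" "n 1 = 3" and a: "a 0 = (\<lambda>_. 0)" "a 1 = ?e" and D0: "D 0 = jacobian_row f"
    by simp_all
  from res have "\<forall>i. D i \<in> carrier_mat (n i) (n (Suc i)) \<and> homogeneous_mat (D i) (a i) (a (Suc i)) \<and>
      mat_kernel (D i) = (\<lambda>w. D (Suc i) *\<^sub>v w) ` carrier_vec (n (Suc (Suc i)))" by (elim conjE)
  then have D: "\<And>i. D i \<in> carrier_mat (n i) (n (Suc i))" "\<And>i. homogeneous_mat (D i) (a i) (a (Suc i))"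
    and ker: "\<And>i. mat_kernel (D i) = (\<lambda>w. D (Suc i) *\<^sub>v w) ` carrier_vec (n (Suc (Suc i)))"
    by blast+
  from res have "\<forall>i. \<forall>k<n (Suc i). \<forall>j<n (Suc (Suc i)). mcoeff (D (Suc i) $$ (k, j)) 0 = 0" by (elim conjE)
  then have min: "\<And>i k j. k < n (Suc i) \<Longrightarrow> j < n (Suc (Suc i)) \<Longrightarrow> mcoeff (D (Suc i) $$ (k, j)) 0 = 0" by blast
  from res have "\<forall>k. kernel_family (jacobian_row f) ?e k = mat_map (D 1) ` free {..<n 2} (a 2) k" by (elim conjE)
  then have im: "\<And>k. kernel_family (jacobian_row f) ?e k = mat_map (D 1) ` free {..<n 2} (a 2) k" by blast
  from res have "\<forall>k. \<forall>v\<in>kernel_family (D 1) (a 2) k. \<forall>j. mcoeff (v j) 0 = 0" by (elim conjE)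
  then have km: "\<And>k v j. v \<in> kernel_family (D 1) (a 2) k \<Longrightarrow> mcoeff (v j) 0 = 0" by blast
  define g where "g = vec 1 (\<lambda>_. 1 :: poly3)"
  have gp: "g \<bullet> v = v $ 0" if "v \<in> carrier_vec 1" for v
    using that by (simp add: g_def scalar_prod_def)
  have "minimal_graded_free_resolution (jacobian_ideal f) n a g D"
    unfolding minimal_graded_free_resolution_def
  proof (intro conjI allI impI)
    show "g \<in> carrier_vec (n 0)" by (simp add: g_def n)
    show "homogeneous (a 0 j) (g $ j)" if "j < n 0" for j using that by (simp add: a g_def n)
    show "homogeneous (a (Suc i) j - a i k) (D i $$ (k, j))" if "k < n i" "j < n (Suc i)" for i k j
      using D(1)[of i] D(2)[of i] that by (simp add: homogeneous_mat_def)
    show "\<exists>v\<in>carrier_vec (n 0). s - g \<bullet> v \<in> jacobian_ideal f" for s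
    proof (intro bexI[of _ "vec 1 (\<lambda>_. s)"])
      have "0 \<in> jacobian_ideal f" unfolding jacobian_ideal_iff by (intro exI[of _ 0]) (simp add: act_simps)
      then show "s - g \<bullet> vec 1 (\<lambda>_. s) \<in> jacobian_ideal f" by (simp add: gp)
    qed (simp add: n)
    show "{v \<in> carrier_vec (n 0). g \<bullet> v \<in> jacobian_ideal f} = (\<lambda>w. D 0 *\<^sub>v w) ` carrier_vec (n 1)"
    proof (rule Set.set_eqI, rule iffI)
      fix v assume "v \<in> {v \<in> carrier_vec (n 0). g \<bullet> v \<in> jacobian_ideal f}"
      then have v: "v \<in> carrier_vec 1" "v $ 0 \<in> jacobian_ideal f" using gp by (auto simp: n)
      then obtain \<theta> where t: "v $ 0 = act \<theta> f" by (auto simp: jacobian_ideal_iff)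
      define w where "w = vec 3 (\<lambda>j. \<theta> (dir j))"
      have w: "w \<in> carrier_vec 3" by (simp add: w_def)
      have "(\<lambda>i. of_vec w (idx i)) = \<theta>" by (simp add: w_def of_vec_def)
      then have "of_vec (jacobian_row f *\<^sub>v w) = of_vec v"
        unfolding of_vec_mult[OF jacobian_row_carrier w] mat_map_jacobian_row
        using v(1) t by (auto simp: of_vec_def fun_eq_iff)
      then have "jacobian_row f *\<^sub>v w = v"
        by (rule of_vec_inj[OF mult_mat_vec_carrier[OF jacobian_row_carrier w] v(1)])
      then show "v \<in> (\<lambda>w. D 0 *\<^sub>v w) ` carrier_vec (n 1)" unfolding D0 n using w by blast
    next
      fix v assume "v \<in> (\<lambda>w. D 0 *\<^sub>v w) ` carrier_vec (n 1)"
      then obtain w where w: "w \<in> carrier_vec 3" "v = jacobian_row f *\<^sub>v w"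
        unfolding D0 n by blast
      have v: "v \<in> carrier_vec 1" using jacobian_row_carrier[of f] w by auto
      have "of_vec v 0 = act (\<lambda>i. of_vec w (idx i)) f"
        unfolding w(2) of_vec_mult[OF jacobian_row_carrier w(1)] mat_map_jacobian_row by simp
      then have "v $ 0 = act (\<lambda>i. of_vec w (idx i)) f" using v by (simp add: of_vec_def)
      then show "v \<in> {v \<in> carrier_vec (n 0). g \<bullet> v \<in> jacobian_ideal f}"
        using v by (auto simp: n gp jacobian_ideal_iff)
    qed
    show "mcoeff (D i $$ (k, j)) 0 = 0" if "k < n i" "j < n (Suc i)" for i k j
    proof (cases i)
      case 0
      have "homogeneous (int d - 1) (partial_deriv (dir j) f)" by (rule homogeneous_partial_deriv[OF homogeneous_f])
      then have "mcoeff (partial_deriv (dir j) f) 0 = 0" using d3 by (intro mcoeff_0_homogeneous) auto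
      moreover have "k < 1" "j < 3" using that n unfolding 0 by simp_all
      ultimately show ?thesis by (simp add: 0 D0 jacobian_row_def)
    next
      case (Suc i')
      then show ?thesis using min that by blast
    qed
  qed (use D(1) ker in auto)
  moreover have "syzygies f (a 2 j - (int d - 1)) \<noteq> {0}" if j: "j < n 2" for j
  proof
    assume z: "syzygies f (a 2 j - (int d - 1)) = {0}"
    define e where "e i = (if i = j then 1 else 0 :: poly3)" for i :: nat
    have ef: "e \<in> free {..<n 2} (a 2) (a 2 j)" using j by (auto simp: free_def e_def)
    define v where "v = mat_map (D 1) e"
    have "v \<in> kernel_family (jacobian_row f) ?e (a 2 j)" unfolding im v_def using ef by blast
    then have "v = 0" using first_syzygies_mem first_syzygies_inj z by blast
    then have "e \<in> kernel_family (D 1) (a 2) (a 2 j)"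
      using D(1)[of 1] ef by (simp add: kernel_family_def v_def numeral_2_eq_2)
    from km[OF this, of j] show False by (simp add: e_def lookup_one)
  qed
  moreover have "syzygies f k = {0}" if n2: "n 2 = 0" for k
  proof -
    have "\<theta> = 0" if t: "\<theta> \<in> syzygies f k" for \<theta>
    proof -
      obtain u where u: "u \<in> kernel_family (jacobian_row f) ?e (k + (int d - 1))" "\<theta> = (\<lambda>i. u (idx i))"
        using first_syzygies_surj[OF t] by blast
      obtain w where w: "w \<in> free {..<n 2} (a 2) (k + (int d - 1))" "u = mat_map (D 1) w" using u(1) unfolding im by blast
      have "w = 0" using w(1) n2 by (auto simp: free_def)
      then have "u = 0" using w(2) slinear_simps(3)[OF slinear_mat_map] by simp
      then show ?thesis using u(2) by (simp add: fun_eq_iff)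
    qed
    then show ?thesis using gs_0[OF gs_syzygies] by blast
  qed
  ultimately show ?thesis using n(1) by blast
qed

lemma resolution_bound:
  assumes np: "\<not> pencil A" and d3: "d \<ge> 3"
    and res: "minimal_graded_free_resolution (jacobian_ideal f) n a g D" and j: "j < n i"
  shows "a i j - int i \<le> 2 * int d - 5"
proof -
  have "regular (int d - 2) (syzygies f) (\<lambda>_. {0})"
    using regular_log_der_not_pencil[OF arr np] d3 card_A by (intro regular_syzygies) auto
  then have "regular (2 * int d - 5) polys (jacobian f)"
    using regular_milnor[of "int d - 3"] d3 by (simp add: algebra_simps)
  then show ?thesis
    using resolution_shift_bound[OF res, of "2 * int d - 5" j i] ideal_family_jacobian gs_jacobian jacobian_ideal_graded j
    by simp
qed

lemma reg_le:
  assumes np: "\<not> pencil A" and d3: "d \<ge> 3" shows "reg f \<le> 2 * int d - 5"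
  unfolding reg_def cm_regularity_def
proof (rule cSup_least)
  obtain n a g D where "minimal_graded_free_resolution (jacobian_ideal f) n a g D" "n 0 = 1"
    using minimal_resolution_exists[OF np d3] by blast
  then have "a 0 0 - int 0 \<in> {a i j - int i | n a g D i j. minimal_graded_free_resolution (jacobian_ideal f) n a g D \<and> j < n i}"
    by fastforce
  then show "{a i j - int i | n a g D i j. minimal_graded_free_resolution (jacobian_ideal f) n a g D \<and> j < n i} \<noteq> {}"
    by blast
qed (use resolution_bound[OF np d3] in auto)

end

section \<open>Generic arrangements\<close>

locale generic = arrangement +
  assumes gen: "generic_arrangement A" and d4: "d \<ge> 4"
begin

lemma not_pencil: "\<not> pencil A"
proof
  assume "pencil A"
  then obtain P where "P \<in> proj_plane" "lines_through A P = A" by (auto simp: pencil_def)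
  then show False using gen card_A d4 by (force simp: generic_arrangement_def multiplicity_at_def)
qed

lemma tjurina: "2 * int (total_tjurina A) = int d * (int d - 1)"
  using total_tjurina_generic[OF arr gen] card_A by simp

text \<open>For \<open>k = d - 3\<close> the count gives codimension \<open>3 dim S\<^sub>k\<close>, so there are no syzygies; for smaller \<open>k\<close>
  a syzygy could be multiplied up to degree \<open>d - 3\<close>.\<close>

lemma syzygies_low: "k \<le> int d - 3 \<Longrightarrow> syzygies f k = {0}"
proof -
  define k0 where "k0 = int d - 3"
  obtain n where n: "has_codim (free UNIV (\<lambda>_. 0) k0) (syzygies f k0) n"
    "2 * int n = (k0 + int d) * (k0 + int d + 1) - 2 * int (total_tjurina A)"
    using codim_syzygies[of k0] d4 by (auto simp: k0_def)
  have "2 * int n = 3 * ((k0 + 1) * (k0 + 2))"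
    unfolding n(2) tjurina by (simp add: k0_def algebra_simps)
  then have "n = 3 * binom2 k0" using binom2[of k0] d4 by (simp add: k0_def)
  then have z: "syzygies f k0 = {0}"
    using has_codim_full[OF gs_subspace[OF gs_syzygies] syzygies_free n(1)] has_codim_free3 by simp
  assume k: "k \<le> int d - 3"
  have "\<theta> = 0" if t: "\<theta> \<in> syzygies f k" for \<theta>
  proof -
    define q where "q = var 0 ^ nat (k0 - k)"
    have v0: "var 0 \<noteq> 0"
    proof
      assume "var 0 = 0"
      then have "partial_deriv 0 (var 0) = 0" by simp
      then show False by (simp add: partial_deriv_var)
    qed
    have "homogeneous (int m) (var 0 ^ m)" for m
    proof (induction m)
      case (Suc m)
      then show ?case using homogeneous_mult[OF homogeneous_var Suc] by (simp add: algebra_simps)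
    qed simp
    from this[of "nat (k0 - k)"] have "homogeneous (k0 - k) q" using k by (simp add: q_def k0_def)
    then have "q \<cdot> \<theta> \<in> syzygies f k0" using gs_smul[OF gs_syzygies t, of "k0 - k" q k0] by simp
    then have "q * \<theta> i = 0" for i using z by (metis singletonD smul_apply zero_fun_apply)
    then show ?thesis using v0 by (auto simp: q_def)
  qed
  then show ?thesis using gs_0[OF gs_syzygies] by blast
qed

text \<open>The count gives dimension \<open>d - 1\<close> for the syzygies of degree \<open>d - 2\<close>.\<close>

lemma syzygies_nonzero: "syzygies f (int d - 2) \<noteq> {0}"
proof
  assume z: "syzygies f (int d - 2) = {0}"
  obtain n where n: "has_codim (free UNIV (\<lambda>_. 0) (int d - 2)) (syzygies f (int d - 2)) n"
    "2 * int n = (int d - 2 + int d) * (int d - 2 + int d + 1) - 2 * int (total_tjurina A)"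
    using codim_syzygies[of "int d - 2"] d4 by auto
  have s0: "subspace {0 :: 3 \<Rightarrow> poly3}" by (auto simp: subspace_def smul_simps)
  have "n = 3 * binom2 (int d - 2)" using has_codim_unique[OF s0] n(1) has_codim_free3 unfolding z by blast
  then have "2 * int n = 3 * ((int d - 1) * int d)" using binom2[of "int d - 2"] by simp
  then have "3 * ((int d - 1) * int d) = (2 * int d - 2) * (2 * int d - 1) - int d * (int d - 1)"
    using n(2) tjurina by (simp add: algebra_simps)
  then have "2 * int d = 2" by (simp add: algebra_simps)
  then show False using d4 by simp
qed

lemma reg_ge: "reg f \<ge> 2 * int d - 5"
proof -
  have d3: "d \<ge> 3" using d4 by simp
  obtain n a g D where r: "minimal_graded_free_resolution (jacobian_ideal f) n a g D \<and> n 0 = 1 \<and>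
    (\<forall>j<n 2. syzygies f (a 2 j - (int d - 1)) \<noteq> {0}) \<and> (n 2 = 0 \<longrightarrow> (\<forall>k. syzygies f k = {0}))"
    using minimal_resolution_exists[OF not_pencil d3] by (elim exE)
  from r have res: "minimal_graded_free_resolution (jacobian_ideal f) n a g D" by (elim conjE)
  from r have nz: "\<forall>j<n 2. syzygies f (a 2 j - (int d - 1)) \<noteq> {0}" by (elim conjE)
  from r have n2: "n 2 = 0 \<longrightarrow> (\<forall>k. syzygies f k = {0})" by (elim conjE)
  let ?R = "{a i j - int i | n a g D i j. minimal_graded_free_resolution (jacobian_ideal f) n a g D \<and> j < n i}"
  have "n 2 > 0" using n2 syzygies_nonzero by blast
  then have "\<not> a 2 0 - (int d - 1) \<le> int d - 3" using nz syzygies_low by blast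
  then have "2 * int d - 5 \<le> a 2 0 - int 2" by simp
  also have "a 2 0 - int 2 \<in> ?R" using res \<open>n 2 > 0\<close> by blast
  then have "a 2 0 - int 2 \<le> Sup ?R"
    using resolution_bound[OF not_pencil d3] by (intro cSup_upper bdd_aboveI) auto
  finally show ?thesis by (simp add: reg_def cm_regularity_def)
qed

text \<open>Equality would force the codimension of the syzygies in \<open>S\<^sub>k\<^sup>3\<close>, for \<open>k = d - 4\<close>, to exceed the dimension
  of \<open>S\<^sub>k\<^sup>3\<close> by \<open>d - 3\<close>.\<close>

lemma milnor_dim_unstable: "milnor_dim f (2 * d - 5) \<noteq> total_tjurina A"
proof
  assume eq: "milnor_dim f (2 * d - 5) = total_tjurina A"
  define k where "k = int d - 4"
  have s0: "subspace {0 :: 3 \<Rightarrow> poly3}" by (auto simp: subspace_def smul_simps)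
  have sub: "{0} \<subseteq> syzygies f k" using gs_0[OF gs_syzygies] by blast
  obtain n where n: "has_codim (free UNIV (\<lambda>_. 0) k) (syzygies f k) n"
    using has_codim_exists[OF gs_subspace[OF gs_free] gs_subspace[OF gs_syzygies] s0 sub order_refl has_codim_free3] by blast
  have le: "n \<le> 3 * binom2 k" using has_codim_le[OF s0 sub has_codim_free3 n] .
  have K: "int (2 * d - 5) = k + int d - 1" using d4 by (simp add: k_def)
  have "int n = int (binom2 (k + int d - 1)) - int (total_tjurina A)"
    using milnor_dim_eq[OF n K] eq unfolding K by simp
  then have "2 * int n = (2 * int d - 4) * (2 * int d - 3) - int d * (int d - 1)"
    using binom2[of "k + int d - 1"] tjurina d4 by (simp add: k_def algebra_simps)
  moreover have "2 * int n \<le> 3 * ((int d - 3) * (int d - 2))"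
    using le binom2[of k] d4 by (simp add: k_def)
  ultimately have "2 * int d \<le> 6" by (simp add: algebra_simps)
  then show False using d4 by simp
qed

lemma st_ge: "st A \<ge> 2 * d - 4"
proof (rule ccontr)
  assume "\<not> st A \<ge> 2 * d - 4"
  moreover have "\<forall>k\<ge>2 * d - 4. milnor_dim (defining_poly A) k = total_tjurina A"
    using milnor_dim_stable d4 unfolding f_def by auto
  then have "\<forall>k\<ge>st A. milnor_dim (defining_poly A) k = total_tjurina A"
    unfolding st_def by (rule LeastI)
  ultimately show False using milnor_dim_unstable unfolding f_def by auto
qed

end

section \<open>Regularity and stability threshold of the Milnor algebra\<close>

theorem corollary3p6:
  fixes A :: "(3 \<Rightarrow> complex) set" and d :: nat and f :: poly3
  assumes "line_arrangement A" and "card A = d" and "d \<ge> 4"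
    and "f = defining_poly A"
  shows "(\<not> pencil A \<longrightarrow> reg f \<le> 2 * int d - 5) \<and> st A \<le> 2 * d - 4 \<and>
    (generic_arrangement A \<longrightarrow> reg f = 2 * int d - 5 \<and> st A = 2 * d - 4)"
proof -
  interpret arrangement A d f using assms by unfold_locales auto
  have st: "st A \<le> 2 * d - 4" using assms(3) by (intro st_le) simp
  have reg: "\<not> pencil A \<longrightarrow> reg f \<le> 2 * int d - 5" using assms(3) reg_le by simp
  have "reg f = 2 * int d - 5 \<and> st A = 2 * d - 4" if g: "generic_arrangement A"
  proof -
    interpret generic A d f using g assms(3) by unfold_locales
    show ?thesis using reg st reg_ge st_ge not_pencil by (meson order_antisym)
  qed
  then show ?thesis using st reg by blast
qed

end
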